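(* Let $\lambda$ be an admissible probability measure on $\mathcal X$, let $\mathcal A_1,\dots,\mathcal A_r$ be bounded Borel subsets of $\mathbb R^k$ with $\mathrm{vol}_{\mathbb R^k}(\partial\mathcal A_i)=0$ for all $i$, and let $N\in\mathbb Z_{\ge0}^r$. Then $$\lim_{L\to\infty}\lambda\big(\{x\in\mathcal X:\#\{j:L^{-n/k}\xi_j(x,L)\in\mathcal A_i\}=N_i\ \forall i\}\big)=\mu\big(\{\Gamma g\in\mathcal X:\#(\widehat{\mathbb Z}^ng\cap\mathcal C(\mathcal A_i,\mathcal W))=N_i\ \forall i\}\big).$$
   Context: Fix integers $k\ge1$, $m\ge0$ and set $n=k+m+1$. Let $G=\mathrm{SL}(n,\mathbb R)$, $\Gamma=\mathrm{SL}(n,\mathbb Z)$, $\mathcal X=\Gamma\backslash G$, and let $\mu$ be the unique right-$G$-invariant Borel probability measure on $\mathcal X$. Vectors in $\mathbb R^n$ are row vectors $y=(y',y'',y_n)\in\mathbb R^k\times\mathbb R^m\times\mathbb R$; $G$ acts from the right. $\widehat{\mathbb Z}^n$ is the set of primitive integer vectors. For $s\in\mathbb R^k$ let $U(s)=\begin{pmatrix}1_k&0&0\\0&1_m&0\\-s&0&1\end{pmatrix}$ (middle block absent if $m=0$), so $yU(s)=(y'-y_ns,y'',y_n)$, and $h_s(x)=xU(s)$. Let $\Phi(t)=\mathrm{diag}(e^{(m+1)t}1_k,e^{-kt}1_m,e^{-kt})$, $\varphi_t(x)=x\Phi(t)$, and $\varphi_tE=\{\varphi_t(x):x\in E\}$.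 A Borel probability measure $\lambda$ on $\mathcal X$ is admissible if $\lim_{t\to\infty}\lambda(\varphi_tE)=\mu(E)$ for every Borel $E\subset\mathcal X$ with $\mu(\partial E)=0$. Fix a norm $|\cdot|$ on $\mathbb R^k$. Let $\mathcal W\subset\mathbb R^m\times\mathbb R_{>0}$ be a bounded Borel set with non-empty interior and boundary of Lebesgue measure zero; $\mathcal C(\mathcal A,\widetilde{\mathcal W})=\{y:y'\in y_n\mathcal A,(y'',y_n)\in\widetilde{\mathcal W}\}$. Hitting times: for $x=\Gamma g$, $L>0$, $\xi_1(x,L),\xi_2(x,L),\dots$ lists with multiplicity the multiset $\{v'/v_n:v\in\widehat{\mathbb Z}^ng,(v'',v_n)\in L^{-1}\mathcal W\}$ ordered by nondecreasing $|\cdot|$; so $\#\{j:\xi_j(x,L)\in\mathcal A\}=\#(\widehat{\mathbb Z}^ng\cap\mathcal C(\mathcal A,L^{-1}\mathcal W))$. (These are the times the orbit $h_s(x)$ meets the section $\Gamma\backslash\Gamma H\{R(w):w\in L^{-1}\mathcal W\}$, with multiplicity.) *)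

theory Defs
  imports "HOL-Probability.Probability"
begin

text \<open>Conventions. The dimension is n = k + m + 1. Vectors in R^n are functions
  nat => real vanishing outside {0..<n}; n x n matrices are functions nat => nat => real
  vanishing outside {0..<n} x {0..<n}. Indices 0..k-1 form y', indices k..k+m-1 form y'',
  and index k+m is y_n. Row vectors act on the left: (v g) j = sum_i v i * g i j.\<close>

definition dimn :: "nat \<Rightarrow> nat \<Rightarrow> nat" where
  "dimn k m = k + m + 1"

definition mat_n :: "nat \<Rightarrow> (nat \<Rightarrow> nat \<Rightarrow> real) set" where
  "mat_n n = {g. \<forall>i j. (n \<le> i \<or> n \<le> j) \<longrightarrow> g i j = 0}"

definition vec_n :: "nat \<Rightarrow> (nat \<Rightarrow> real) set" where
  "vec_n n = {v. \<forall>i. n \<le> i \<longrightarrow> v i = 0}"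

definition mmul :: "nat \<Rightarrow> (nat \<Rightarrow> nat \<Rightarrow> real) \<Rightarrow> (nat \<Rightarrow> nat \<Rightarrow> real) \<Rightarrow> (nat \<Rightarrow> nat \<Rightarrow> real)" where
  "mmul n g h = (\<lambda>i j. if i < n \<and> j < n then (\<Sum>l<n. g i l * h l j) else 0)"

definition vmul :: "nat \<Rightarrow> (nat \<Rightarrow> real) \<Rightarrow> (nat \<Rightarrow> nat \<Rightarrow> real) \<Rightarrow> (nat \<Rightarrow> real)" where
  "vmul n v g = (\<lambda>j. if j < n then (\<Sum>i<n. v i * g i j) else 0)"

definition det_n :: "nat \<Rightarrow> (nat \<Rightarrow> nat \<Rightarrow> real) \<Rightarrow> real" where
  "det_n n g = (\<Sum>p | p permutes {..<n}. of_int (sign p) * (\<Prod>i<n. g i (p i)))"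

definition SLR :: "nat \<Rightarrow> (nat \<Rightarrow> nat \<Rightarrow> real) set" where
  "SLR n = {g \<in> mat_n n. det_n n g = 1}"

definition SLZ :: "nat \<Rightarrow> (nat \<Rightarrow> nat \<Rightarrow> real) set" where
  "SLZ n = {g \<in> SLR n. \<forall>i j. g i j \<in> \<int>}"

definition coset :: "nat \<Rightarrow> (nat \<Rightarrow> nat \<Rightarrow> real) \<Rightarrow> (nat \<Rightarrow> nat \<Rightarrow> real) set" where
  "coset n g = (\<lambda>\<gamma>. mmul n \<gamma> g) ` SLZ n"

definition Xsp :: "nat \<Rightarrow> (nat \<Rightarrow> nat \<Rightarrow> real) set set" where
  "Xsp n = coset n ` SLR n"

definition Xact :: "nat \<Rightarrow> (nat \<Rightarrow> nat \<Rightarrow> real) set \<Rightarrow> (nat \<Rightarrow> nat \<Rightarrow> real) \<Rightarrow> (nat \<Rightarrow> nat \<Rightarrow> real) set" where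
  "Xact n x h = (\<lambda>g. mmul n g h) ` x"

definition Xtop :: "nat \<Rightarrow> (nat \<Rightarrow> nat \<Rightarrow> real) set topology" where
  "Xtop n = topology_generated_by
     {E. E \<subseteq> Xsp n \<and> openin (subtopology euclidean (SLR n)) (\<Union>E)}"

definition Xborel :: "nat \<Rightarrow> (nat \<Rightarrow> nat \<Rightarrow> real) set measure" where
  "Xborel n = sigma (Xsp n) {E. E \<subseteq> Xsp n \<and> openin (Xtop n) E}"

definition Xmu :: "nat \<Rightarrow> (nat \<Rightarrow> nat \<Rightarrow> real) set measure" where
  "Xmu n = (THE M. sets M = sets (Xborel n) \<and> prob_space M \<and>
      (\<forall>h \<in> SLR n. \<forall>E \<in> sets M. emeasure M ((\<lambda>x. Xact n x h) ` E) = emeasure M E))"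

definition Phi :: "nat \<Rightarrow> nat \<Rightarrow> real \<Rightarrow> (nat \<Rightarrow> nat \<Rightarrow> real)" where
  "Phi k m t = (\<lambda>i j. if i = j \<and> i < dimn k m then
       (if i < k then exp (real (m + 1) * t) else exp (- real k * t)) else 0)"

definition phi_flow :: "nat \<Rightarrow> nat \<Rightarrow> real \<Rightarrow> (nat \<Rightarrow> nat \<Rightarrow> real) set \<Rightarrow> (nat \<Rightarrow> nat \<Rightarrow> real) set" where
  "phi_flow k m t x = Xact (dimn k m) x (Phi k m t)"

definition admissible :: "nat \<Rightarrow> nat \<Rightarrow> (nat \<Rightarrow> nat \<Rightarrow> real) set measure \<Rightarrow> bool" where
  "admissible k m lam \<longleftrightarrow> sets lam = sets (Xborel (dimn k m)) \<and> prob_space lam \<and>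
     (\<forall>E \<in> sets (Xborel (dimn k m)).
        measure (Xmu (dimn k m)) (Xtop (dimn k m) frontier_of E) = 0 \<longrightarrow>
        ((\<lambda>t. measure lam (phi_flow k m t ` E)) \<longlongrightarrow> measure (Xmu (dimn k m)) E) at_top)"

text \<open>Primitive integer vectors, and the set of primitive vectors Zhat^n g of x = Gamma g
  (the union over all representatives g of x, which equals Zhat^n g for any one of them).\<close>
definition primitive :: "nat \<Rightarrow> (nat \<Rightarrow> real) \<Rightarrow> bool" where
  "primitive n v \<longleftrightarrow> v \<in> vec_n n \<and> (\<forall>i. v i \<in> \<int>) \<and> v \<noteq> (\<lambda>_. 0) \<and>
     \<not> (\<exists>d::int. d \<ge> 2 \<and> (\<forall>i<n. \<exists>z::int. v i = of_int d * of_int z))"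

definition primlat :: "nat \<Rightarrow> (nat \<Rightarrow> nat \<Rightarrow> real) set \<Rightarrow> (nat \<Rightarrow> real) set" where
  "primlat n x = {vmul n v g | v g. primitive n v \<and> g \<in> x}"

text \<open>Coordinates: R^k and R^m are represented by the extensional function spaces
  PiE {..<k} and PiE {..<m}.\<close>
definition yprime :: "nat \<Rightarrow> (nat \<Rightarrow> real) \<Rightarrow> (nat \<Rightarrow> real)" where
  "yprime k y = (\<lambda>i\<in>{..<k}. y i)"

definition ydprime :: "nat \<Rightarrow> nat \<Rightarrow> (nat \<Rightarrow> real) \<Rightarrow> (nat \<Rightarrow> real)" where
  "ydprime k m y = (\<lambda>i\<in>{..<m}. y (k + i))"

definition ylast :: "nat \<Rightarrow> nat \<Rightarrow> (nat \<Rightarrow> real) \<Rightarrow> real" where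
  "ylast k m y = y (k + m)"

definition cone :: "nat \<Rightarrow> nat \<Rightarrow> (nat \<Rightarrow> real) set \<Rightarrow> ((nat \<Rightarrow> real) \<times> real) set \<Rightarrow> (nat \<Rightarrow> real) set" where
  "cone k m A W = {y \<in> vec_n (dimn k m).
      (\<exists>a \<in> A. \<forall>i<k. y i = ylast k m y * a i) \<and> (ydprime k m y, ylast k m y) \<in> W}"

text \<open>The multiset of hitting times xi_j(x,L) = v'/v_n, v in Zhat^n g with (v'',v_n) in L^{-1} W,
  indexed (with multiplicity) by v; hit_set collects those v with L^{-n/k} xi in A,
  so #{j : L^{-n/k} xi_j(x,L) in A} = card (hit_set ...).\<close>
definition hit_set :: "nat \<Rightarrow> nat \<Rightarrow> ((nat \<Rightarrow> real) \<times> real) set \<Rightarrow> (nat \<Rightarrow> nat \<Rightarrow> real) set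
     \<Rightarrow> real \<Rightarrow> (nat \<Rightarrow> real) set \<Rightarrow> (nat \<Rightarrow> real) set" where
  "hit_set k m W x L A = {v \<in> primlat (dimn k m) x.
      (\<lambda>i\<in>{..<m}. L * ydprime k m v i, L * ylast k m v) \<in> W \<and>
      (\<lambda>i\<in>{..<k}. L powr (- real (dimn k m) / real k) * (v i / ylast k m v)) \<in> A}"

end

theory Submission
  imports Defs "Jordan_Normal_Form.Determinant"
begin

text \<open>
  With \<open>t = ln L / k\<close>, the set of points whose rescaled hitting times have the prescribed counts is the image
  under \<open>phi_flow k m t\<close> of the set \<open>E\<close> of points whose primitive vectors have the prescribed counts in
  the fixed cones. By admissibility it suffices that the frontier of \<open>E\<close> is \<open>Xmu\<close>-null. The counts are locally constant at
  every point that has no primitive vector on the frontier of a cone, because only finitely many vectors can enter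
  a bounded cone nearby; and a point has such a vector with probability zero, because \<open>Xmu\<close> is invariant under
  transvections, whose parameters can be averaged over.

  Since \<open>Xmu\<close> is a definite description, existence and uniqueness of the invariant probability have to be proved.
  Haar measure on \<open>SL(n, R)\<close> is the Lebesgue measure of the cone of matrices of determinant in \<open>(0, 1]\<close> over a
  set. A fundamental domain of \<open>SL(n, Z)\<close> has finite Haar measure by reduction: Minkowski's theorem gives a
  representative with small last row, and one inducts on the lower-dimensional block that remains after this row has been normalised.
  Uniqueness follows by unfolding an invariant probability to \<open>SL(n, R)\<close> and comparing it with Haar measure through Tonelli's theorem.
\<close>

section \<open>Matrices and shears\<close>

text \<open>Two choices shape the proof. Volume is measured on matrices with determinant in
  \<open>(0, 1]\<close> instead of on the group: this class survives the passage from a matrix to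
  its lower-dimensional block, and finite covolume becomes Fubini over the last row. For a fixed
  last row the other rows are multiplied by a matrix of determinant one depending on that row alone,
  so each slice has at most the volume of the lower-dimensional reduction set. Lebesgue measure is
  seen to be SL(n, R)-invariant on generators: a shear moves some coordinates by amounts depending
  only on the others.

  The Borel sets of the quotient come from a topology on cosets, while all computations use
  representatives. The link is a countable cover of the group by open sets that meet each orbit at
  most once: it makes images of Borel sets Borel and yields a fundamental domain representing every
  orbit exactly once.

  The time \<open>ln L / k\<close> is forced by the section: \<open>exp (- k t)\<close> has to
  cancel the factor \<open>L\<close> on the last \<open>m + 1\<close> coordinates, and slopes are
  then stretched by \<open>exp (n t) = L powr (n / k)\<close>.\<close>

type_synonym rmat = "nat \<Rightarrow> nat \<Rightarrow> real"

definition idn :: "nat \<Rightarrow> rmat" where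
  "idn n = (\<lambda>i j. if i = j \<and> i < n then 1 else 0)"

abbreviation tomat :: "nat \<Rightarrow> rmat \<Rightarrow> real Matrix.mat" where
  "tomat n g \<equiv> Matrix.mat n n (\<lambda>(i, j). g i j)"

text \<open>The adjugate, with row \<open>j\<close> and column \<open>i\<close> deleted in the
  minor. On determinant one it is the inverse, and being polynomial in the entries it is visibly
  integral on \<open>SLZ\<close> and measurable.\<close>

definition minv :: "nat \<Rightarrow> rmat \<Rightarrow> rmat" where
  "minv n g = (\<lambda>i j. if i < n \<and> j < n then (-1) ^ (j + i) *
     det_n (n - 1) (\<lambda>a b. g (if a < j then a else Suc a) (if b < i then b else Suc b)) else 0)"

lemma det_tomat: "Determinant.det (tomat n g) = det_n n g"
proof -
  have "(\<Prod>i = 0..<n. tomat n g $$ (i, p i)) = (\<Prod>i<n. g i (p i))" if "p permutes {..<n}" for p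
    using permutes_in_image[OF that] by (auto simp: atLeast0LessThan intro!: prod.cong)
  then show ?thesis
    by (auto simp: Determinant.det_def det_n_def atLeast0LessThan sign_def intro!: sum.cong)
qed

lemma tomat_mmul: "tomat n (mmul n g h) = tomat n g * tomat n h"
  by (rule eq_matI) (auto simp: mmul_def scalar_prod_def atLeast0LessThan)

lemma tomat_eqD:
  assumes "tomat n a = tomat n b" "a \<in> mat_n n" "b \<in> mat_n n"
  shows "a = b"
proof (intro ext)
  fix i j
  show "a i j = b i j"
  proof (cases "i < n \<and> j < n")
    case True
    then have "tomat n a $$ (i, j) = tomat n b $$ (i, j)" using assms(1) by simp
    then show ?thesis using True by simp
  qed (use assms in \<open>auto simp: mat_n_def not_less\<close>)
qed

lemma mmul_in_mat_n [simp]: "mmul n g h \<in> mat_n n"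
  by (auto simp: mmul_def mat_n_def)

lemma idn_in_mat_n [simp]: "idn n \<in> mat_n n"
  by (auto simp: idn_def mat_n_def)

lemma minv_in_mat_n [simp]: "minv n g \<in> mat_n n"
  by (auto simp: minv_def mat_n_def)

lemma vmul_in_vec_n [simp]: "vmul n v g \<in> vec_n n"
  by (auto simp: vmul_def vec_n_def)

lemma mmul_assoc: "mmul n (mmul n a b) c = mmul n a (mmul n b c)"
  by (auto simp: mmul_def fun_eq_iff sum_distrib_left sum_distrib_right mult.assoc intro: sum.swap)

lemma vmul_mmul: "vmul n (vmul n v a) b = vmul n v (mmul n a b)"
  by (auto simp: mmul_def vmul_def fun_eq_iff sum_distrib_left sum_distrib_right mult.assoc intro: sum.swap)

lemma mmul_eq_vmul: "g \<in> mat_n n \<Longrightarrow> mmul n g h = (\<lambda>i. vmul n (g i) h)"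
  by (auto simp: mmul_def vmul_def mat_n_def fun_eq_iff)

lemma mmul_idn_left: "g \<in> mat_n n \<Longrightarrow> mmul n (idn n) g = g"
  by (auto simp: mmul_def idn_def mat_n_def fun_eq_iff if_distrib[of "\<lambda>x. x * _"] cong: if_cong)

lemma vmul_idn: "v \<in> vec_n n \<Longrightarrow> vmul n v (idn n) = v"
  by (auto simp: vmul_def idn_def vec_n_def fun_eq_iff if_distrib[of "\<lambda>x. _ * x"] cong: if_cong conj_cong)

lemma mmul_idn_right: "g \<in> mat_n n \<Longrightarrow> mmul n g (idn n) = g"
  by (auto simp: mmul_eq_vmul vmul_idn mat_n_def vec_n_def)

lemma tomat_idn: "tomat n (idn n) = 1\<^sub>m n"
  by (rule eq_matI) (auto simp: idn_def)

lemma det_mmul: "det_n n (mmul n g h) = det_n n g * det_n n h"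
  unfolding det_tomat[symmetric] tomat_mmul by (rule Determinant.det_mult[of _ n]) auto

lemma det_idn: "det_n n (idn n) = 1"
  unfolding det_tomat[symmetric] tomat_idn by (rule det_one)

lemma tomat_minv: "tomat n (minv n g) = adj_mat (tomat n g)"
proof (rule eq_matI)
  fix i j assume "i < dim_row (adj_mat (tomat n g))" "j < dim_col (adj_mat (tomat n g))"
  then have ij: "i < n" "j < n" by (auto simp: adj_mat_def)
  have "Matrix.mat (n - 1) (n - 1) (\<lambda>(a, b). tomat n g $$ (if a < j then a else Suc a, if b < i then b else Suc b))
      = tomat (n - 1) (\<lambda>a b. g (if a < j then a else Suc a) (if b < i then b else Suc b))"
    using ij by (intro eq_matI) auto
  from arg_cong[OF this, of Determinant.det]
  show "tomat n (minv n g) $$ (i, j) = adj_mat (tomat n g) $$ (i, j)"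
    using ij by (auto simp: adj_mat_def minv_def cofactor_def mat_delete_def det_tomat)
qed (auto simp: adj_mat_def)

lemma mmul_minv:
  assumes "g \<in> SLR n"
  shows "mmul n g (minv n g) = idn n" "mmul n (minv n g) g = idn n"
proof -
  have d: "Determinant.det (tomat n g) = 1" using assms by (simp add: det_tomat SLR_def)
  have A: "tomat n g \<in> carrier_mat n n" by simp
  have [simp]: "(1::real) \<cdot>\<^sub>m 1\<^sub>m n = 1\<^sub>m n" by (rule eq_matI) auto
  have "tomat n (mmul n g (minv n g)) = tomat n (idn n)"
    using adj_mat(2)[OF A] d by (simp add: tomat_mmul tomat_minv tomat_idn)
  then show "mmul n g (minv n g) = idn n" by (rule tomat_eqD) auto
  have "tomat n (mmul n (minv n g) g) = tomat n (idn n)"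
    using adj_mat(3)[OF A] d by (simp add: tomat_mmul tomat_minv tomat_idn)
  then show "mmul n (minv n g) g = idn n" by (rule tomat_eqD) auto
qed

lemma SLR_mat_n: "g \<in> SLR n \<Longrightarrow> g \<in> mat_n n"
  by (simp add: SLR_def)

lemma SLZ_SLR: "g \<in> SLZ n \<Longrightarrow> g \<in> SLR n"
  by (simp add: SLZ_def)

lemma idn_SLZ [simp]: "idn n \<in> SLZ n"
  by (auto simp: SLZ_def SLR_def det_idn) (auto simp: idn_def)

lemma idn_SLR [simp]: "idn n \<in> SLR n"
  by (rule SLZ_SLR) simp

lemma mmul_SLR: "g \<in> SLR n \<Longrightarrow> h \<in> SLR n \<Longrightarrow> mmul n g h \<in> SLR n"
  by (simp add: SLR_def det_mmul)

lemma minv_SLR: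
  assumes "g \<in> SLR n" shows "minv n g \<in> SLR n"
proof -
  have "det_n n (mmul n g (minv n g)) = 1" using mmul_minv[OF assms] by (simp add: det_idn)
  then show ?thesis using assms by (simp add: SLR_def det_mmul)
qed

lemma mmul_SLZ: "g \<in> SLZ n \<Longrightarrow> h \<in> SLZ n \<Longrightarrow> mmul n g h \<in> SLZ n"
  by (auto simp: SLZ_def mmul_SLR) (auto simp: mmul_def)

lemma det_n_Ints: "(\<And>i j. g i j \<in> \<int>) \<Longrightarrow> det_n n g \<in> \<int>"
  unfolding det_n_def by (intro Ints_sum Ints_mult Ints_prod Ints_of_int)

lemma minv_SLZ:
  assumes "g \<in> SLZ n" shows "minv n g \<in> SLZ n"
proof -
  have "minv n g i j \<in> \<int>" for i j
    using assms unfolding minv_def by (auto simp: SLZ_def intro!: Ints_mult det_n_Ints Ints_power)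
  then show ?thesis using minv_SLR[of g n] assms by (auto simp: SLZ_def)
qed

lemma mmul_cancel_left:
  assumes "g \<in> SLR n" "a \<in> mat_n n"
  shows "mmul n (minv n g) (mmul n g a) = a" "mmul n g (mmul n (minv n g) a) = a"
  using assms by (simp_all add: mmul_assoc[symmetric] mmul_minv mmul_idn_left)

lemma mmul_cancel_right:
  assumes "g \<in> SLR n" "a \<in> mat_n n"
  shows "mmul n (mmul n a g) (minv n g) = a" "mmul n (mmul n a (minv n g)) g = a"
  using assms by (simp_all add: mmul_assoc mmul_minv mmul_idn_right)

lemma vmul_cancel:
  assumes "g \<in> SLR n" "v \<in> vec_n n"
  shows "vmul n (vmul n v g) (minv n g) = v" "vmul n (vmul n v (minv n g)) g = v"
  using assms by (simp_all add: vmul_mmul mmul_minv vmul_idn)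

lemma minv_unique:
  assumes "g \<in> SLR n" "a \<in> mat_n n" "mmul n a g = idn n"
  shows "a = minv n g"
  using mmul_cancel_right(1)[OF assms(1,2)] assms(3) by (simp add: mmul_idn_left)

lemma minv_minv: "g \<in> SLR n \<Longrightarrow> minv n (minv n g) = g"
  using minv_unique[OF minv_SLR, of g n g] by (simp add: mmul_minv SLR_mat_n)

lemma minv_mmul:
  assumes "g \<in> SLR n" "h \<in> SLR n"
  shows "minv n (mmul n g h) = mmul n (minv n h) (minv n g)"
proof (rule minv_unique[symmetric])
  have "mmul n (mmul n (minv n h) (minv n g)) (mmul n g h) = mmul n (minv n h) (mmul n (minv n g) (mmul n g h))"
    by (simp add: mmul_assoc)
  then show "mmul n (mmul n (minv n h) (minv n g)) (mmul n g h) = idn n"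
    using assms by (simp add: mmul_cancel_left SLR_mat_n mmul_minv)
qed (use assms in \<open>auto intro: mmul_SLR\<close>)

text \<open>Identity plus a part with rows in \<open>A\<close> and columns outside \<open>A\<close>,
  which therefore squares to zero. Allowing a whole set \<open>A\<close> treats transvections and
  the block matrices \<open>blk n (idn n) u\<close> as one class.\<close>

definition shear :: "nat \<Rightarrow> nat set \<Rightarrow> rmat \<Rightarrow> bool" where
  "shear n A s \<longleftrightarrow> s \<in> mat_n n \<and> (\<forall>i<n. s i i = 1) \<and> (\<forall>i j. i \<noteq> j \<longrightarrow> s i j \<noteq> 0 \<longrightarrow> i \<in> A \<and> j \<notin> A)"

text \<open>Only the identity permutation contributes to the determinant. Another permutation
  \<open>p\<close> moves some \<open>i\<close> and hence also \<open>p i\<close>; nonzero factors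
  would put \<open>p i\<close> outside \<open>A\<close> as a column and inside \<open>A\<close> as a
  row.\<close>

lemma shear_SLR:
  assumes "shear n A s" shows "s \<in> SLR n"
proof -
  have "(\<Prod>i<n. s i (p i)) = 0" if p: "p permutes {..<n}" "p \<noteq> id" for p
  proof (rule ccontr)
    assume "(\<Prod>i<n. s i (p i)) \<noteq> 0"
    then have nz: "s i (p i) \<noteq> 0" if "i < n" for i using that by auto
    obtain i where i: "p i \<noteq> i" using p(2) by (auto simp: fun_eq_iff)
    then have "i < n" using p(1) by (auto simp: permutes_def)
    then have "p i < n" using permutes_in_image[OF p(1)] by auto
    have "p i \<notin> A" using assms nz[OF \<open>i < n\<close>] i by (metis shear_def)
    moreover have "p (p i) \<noteq> p i" using permutes_inj[OF p(1)] i by (auto dest: injD)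
    ultimately show False using assms nz[OF \<open>p i < n\<close>] by (metis shear_def)
  qed
  then have "det_n n s = (\<Sum>p | p permutes {..<n}. if p = id then 1 else 0)"
    using assms unfolding det_n_def by (intro sum.cong) (auto simp: shear_def sign_id)
  also have "\<dots> = 1" by (simp add: finite_permutations permutes_id)
  finally show ?thesis using assms by (simp add: SLR_def shear_def)
qed

text \<open>If \<open>s = 1 + N\<close> with \<open>N\<close> squaring to zero, the inverse is
  \<open>1 - N = 2 - s\<close>.\<close>

definition shear_inv :: "nat \<Rightarrow> rmat \<Rightarrow> rmat" where
  "shear_inv n s = (\<lambda>i j. 2 * idn n i j - s i j)"

lemma shear_shear_inv: "shear n A s \<Longrightarrow> shear n A (shear_inv n s)"
  by (auto simp: shear_def shear_inv_def mat_n_def idn_def)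

lemma mmul_shear_inv:
  assumes "shear n A s"
  shows "mmul n s (shear_inv n s) = idn n" "mmul n (shear_inv n s) s = idn n"
proof -
  have sm: "s \<in> mat_n n" using assms by (simp add: shear_def)
  \<comment> \<open>The off-diagonal part squares to zero: a surviving \<open>l\<close> would be a
    column outside \<open>A\<close> and a row inside \<open>A\<close>.\<close>
  have nil: "(\<Sum>l<n. (s i l - idn n i l) * (s l j - idn n l j)) = 0" for i j
    using assms by (intro sum.neutral ballI, unfold shear_def idn_def mult_eq_0_iff) (metis lessThan_iff right_minus_eq diff_zero)
  have "mmul n s (shear_inv n s) i j = idn n i j \<and> mmul n (shear_inv n s) s i j = idn n i j" for i j
  proof (cases "i < n \<and> j < n")
    case True
    have a: "(\<Sum>l<n. s i l * idn n l j) = s i j" "(\<Sum>l<n. idn n i l * s l j) = s i j"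
      "(\<Sum>l<n. idn n i l * idn n l j) = idn n i j"
      using fun_cong[OF fun_cong[OF mmul_idn_right[OF sm], of i], of j] fun_cong[OF fun_cong[OF mmul_idn_left[OF sm], of i], of j]
        fun_cong[OF fun_cong[OF mmul_idn_left[OF idn_in_mat_n, of n], of i], of j] True
      by (auto simp: mmul_def)
    have b: "(\<Sum>l<n. s i l * s l j) = 2 * s i j - idn n i j"
      using nil[of i j] a by (simp add: algebra_simps sum.distrib sum_subtractf)
    then show ?thesis using True a
      by (simp add: mmul_def shear_inv_def algebra_simps sum.distrib sum_subtractf sum_distrib_left[symmetric])
  qed (auto simp: mmul_def idn_def)
  then show "mmul n s (shear_inv n s) = idn n" "mmul n (shear_inv n s) s = idn n" by auto
qed

definition transvec :: "nat \<Rightarrow> nat \<Rightarrow> (nat \<Rightarrow> real) \<Rightarrow> rmat" where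
  "transvec n i u = (\<lambda>a b. idn n a b + (if a = i \<and> i < n \<and> b < n then u b else 0))"

lemma shear_transvec: "u i = 0 \<Longrightarrow> shear n {i} (transvec n i u)"
  by (auto simp: shear_def transvec_def mat_n_def idn_def)

lemma transvec_SLR: "u i = 0 \<Longrightarrow> transvec n i u \<in> SLR n"
  by (rule shear_SLR[OF shear_transvec])

lemma transvec_SLZ: "u i = 0 \<Longrightarrow> (\<And>b. u b \<in> \<int>) \<Longrightarrow> transvec n i u \<in> SLZ n"
  using transvec_SLR[of u i n] by (auto simp: SLZ_def) (auto simp: transvec_def idn_def)

lemma vmul_transvec:
  assumes "i < n"
  shows "vmul n v (transvec n i u) b = (if b < n then v b + v i * u b else 0)"
proof (cases "b < n")
  case True
  have "(\<Sum>a<n. v a * transvec n i u a b) = (\<Sum>a<n. (if a = b then v b else 0) + (if a = i then v i * u b else 0))"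
    using True assms by (intro sum.cong) (auto simp: transvec_def idn_def algebra_simps)
  also have "\<dots> = v b + v i * u b" using True assms by (simp add: sum.distrib)
  finally show ?thesis using True by (simp add: vmul_def)
qed (simp add: vmul_def)

text \<open>The block matrix with upper rows \<open>(M | u)\<close> and last row
  \<open>(0 | 1)\<close>. With determinant one these are the stabiliser of the last basis vector
  under the row action.\<close>

definition blk :: "nat \<Rightarrow> rmat \<Rightarrow> (nat \<Rightarrow> real) \<Rightarrow> rmat" where
  "blk n M u = (\<lambda>i j. if i < n \<and> j < n then M i j else if i < n \<and> j = n then u i
     else if i = n \<and> j = n then 1 else 0)"

lemma blk_in_mat_n [simp]: "blk n M u \<in> mat_n (Suc n)"
  by (auto simp: blk_def mat_n_def)

lemma det_blk: "det_n (Suc n) (blk n M u) = det_n n M"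
proof -
  let ?A = "tomat (Suc n) (blk n M u)"
  have "Determinant.det ?A = (\<Sum>j<Suc n. ?A $$ (n, j) * cofactor ?A n j)"
    by (rule laplace_expansion_row) auto
  also have "\<dots> = cofactor ?A n n" by (simp add: blk_def)
  also have "mat_delete ?A n n = tomat n M"
    by (rule eq_matI) (auto simp: mat_delete_def blk_def)
  then have "cofactor ?A n n = Determinant.det (tomat n M)"
    by (simp add: cofactor_def mult_2[symmetric])
  finally show ?thesis by (simp add: det_tomat)
qed

lemma mmul_blk: "mmul (Suc n) (blk n M u) (blk n M' u') = blk n (mmul n M M') (\<lambda>i. (\<Sum>l<n. M i l * u' l) + u i)"
  by (auto simp: fun_eq_iff mmul_def blk_def intro!: sum.cong)

lemma blk_idn: "blk n (idn n) (\<lambda>_. 0) = idn (Suc n)"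
  by (auto simp: fun_eq_iff blk_def idn_def)

lemma eq_blkI:
  assumes "g \<in> mat_n (Suc n)" "\<And>j. j < n \<Longrightarrow> g n j = 0" "g n n = 1"
  shows "g = blk n (\<lambda>i j. if i < n \<and> j < n then g i j else 0) (\<lambda>i. g i n)"
proof (intro ext)
  fix i j show "g i j = blk n (\<lambda>i j. if i < n \<and> j < n then g i j else 0) (\<lambda>i. g i n) i j"
    using assms by (cases "i = n"; cases "j = n") (auto simp: blk_def mat_n_def, metis Suc_leI nat_neq_iff)
qed

lemma shear_blk: "shear n A s \<Longrightarrow> shear (Suc n) (A \<inter> {..<n}) (blk n s (\<lambda>_. 0))"
  unfolding shear_def blk_def by (auto simp: mat_n_def less_Suc_eq)

lemma shear_blk_idn: "shear (Suc n) {..<n} (blk n (idn n) u)"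
  by (auto simp: shear_def) (auto simp: blk_def idn_def split: if_splits)

lemma det_n_1: "det_n (Suc 0) g = g 0 0"
proof -
  have "{p. p permutes {..<Suc 0}} = {id}" by (auto simp: lessThan_Suc permutes_sing)
  then show ?thesis by (simp add: det_n_def sign_id)
qed

text \<open>Gaussian elimination on the last row, with induction on the dimension. Shears on the
  right turn the last row into a basis vector, a shear on the left supplies the last column, and the
  remaining block is covered by the induction hypothesis. This is why \<open>P\<close> has to be
  closed under both multiplications.\<close>

lemma SLR_induct:
  assumes "g \<in> SLR n" "P (idn n)"
    and "\<And>g A s. g \<in> SLR n \<Longrightarrow> P g \<Longrightarrow> shear n A s \<Longrightarrow> P (mmul n g s)"
    and "\<And>g A s. g \<in> SLR n \<Longrightarrow> P g \<Longrightarrow> shear n A s \<Longrightarrow> P (mmul n s g)"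
  shows "P g"
  using assms
proof (induction n arbitrary: g P)
  case 0
  have "g = idn 0" using "0.prems"(1) by (auto simp: SLR_def mat_n_def idn_def fun_eq_iff)
  then show ?case using "0.prems"(2) by simp
next
  case (Suc n)
  note P0 = Suc.prems(2) and PR = Suc.prems(3) and PL = Suc.prems(4)
  have blkSLR: "blk n M u \<in> SLR (Suc n) \<longleftrightarrow> det_n n M = 1" for M u
    by (simp add: SLR_def det_blk)
  have D: "P (blk n M (\<lambda>_. 0))" if M: "M \<in> SLR n" for M
  proof (rule Suc.IH[OF M, of "\<lambda>M. P (blk n M (\<lambda>_. 0))"])
    show "P (blk n (idn n) (\<lambda>_. 0))" by (simp add: blk_idn P0)
  next
    fix g A s assume gs: "g \<in> SLR n" "P (blk n g (\<lambda>_. 0))" "shear n A s"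
    then have "blk n g (\<lambda>_. 0) \<in> SLR (Suc n)" by (simp add: SLR_def det_blk)
    with gs have "P (mmul (Suc n) (blk n g (\<lambda>_. 0)) (blk n s (\<lambda>_. 0)))"
      "P (mmul (Suc n) (blk n s (\<lambda>_. 0)) (blk n g (\<lambda>_. 0)))"
      using PR[OF _ _ shear_blk] PL[OF _ _ shear_blk] by blast+
    then show "P (blk n (mmul n g s) (\<lambda>_. 0))" "P (blk n (mmul n s g) (\<lambda>_. 0))" by (simp_all add: mmul_blk)
  qed
  have B: "P h" if h: "h \<in> SLR (Suc n)" "\<And>j. j < n \<Longrightarrow> h n j = 0" "h n n = 1" for h
  proof -
    define M where "M = (\<lambda>i j. if i < n \<and> j < n then h i j else 0)"
    have hb: "h = blk n M (\<lambda>i. h i n)" unfolding M_def by (rule eq_blkI) (use h SLR_mat_n in auto)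
    have "det_n n M = 1" using h(1) hb blkSLR by metis
    then have MS: "M \<in> SLR n" by (auto simp: SLR_def M_def mat_n_def)
    \<comment> \<open>The matrix factors as \<open>blk n (idn n) u\<close> times
      \<open>blk n M 0\<close>, and the left factor is a shear.\<close>
    have "P (mmul (Suc n) (blk n (idn n) (\<lambda>i. h i n)) (blk n M (\<lambda>_. 0)))"
      by (rule PL[OF _ D[OF MS] shear_blk_idn]) (use MS in \<open>simp add: SLR_def det_blk\<close>)
    then show ?thesis using MS hb by (simp add: mmul_blk mmul_idn_left SLR_mat_n)
  qed
  have reduce: "P h" if "h \<in> SLR (Suc n)" "shear (Suc n) A s" "P (mmul (Suc n) h s)" for h A s
  proof -
    have "P (mmul (Suc n) (mmul (Suc n) h s) (shear_inv (Suc n) s))"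
      by (rule PR[OF mmul_SLR[OF that(1) shear_SLR[OF that(2)]] that(3) shear_shear_inv[OF that(2)]])
    then show ?thesis using that(1) by (simp add: mmul_assoc mmul_shear_inv[OF that(2)] mmul_idn_right SLR_mat_n)
  qed
  have row: "mmul (Suc n) h (transvec (Suc n) i u) n b = (if b < Suc n then h n b + h n i * u b else 0)"
    if "h \<in> SLR (Suc n)" "i < Suc n" for h i u b
    using that by (simp add: mmul_eq_vmul SLR_mat_n vmul_transvec)
  have C: "P h" if h: "h \<in> SLR (Suc n)" "h n n = 1" for h
  proof -
    \<comment> \<open>Once the last entry is 1, multiples of the last column clear the rest of the
      last row.\<close>
    define u where "u = (\<lambda>b. if b < n then - h n b else 0)"
    have sh: "shear (Suc n) {n} (transvec (Suc n) n u)" by (rule shear_transvec) (simp add: u_def)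
    show ?thesis
      by (rule reduce[OF h(1) sh], rule B) (use h sh in \<open>auto simp: row u_def intro: mmul_SLR shear_SLR\<close>)
  qed
  have E: "P h" if h: "h \<in> SLR (Suc n)" "j < n" "h n j \<noteq> 0" for h j
  proof -
    \<comment> \<open>Adding this multiple of column \<open>j\<close> to the last column makes the
      last entry equal to 1.\<close>
    define u where "u = (\<lambda>b. if b = n then (1 - h n n) / h n j else 0)"
    have sh: "shear (Suc n) {j} (transvec (Suc n) j u)" by (rule shear_transvec) (use h in \<open>simp add: u_def\<close>)
    show ?thesis
      by (rule reduce[OF h(1) sh], rule C) (use h sh in \<open>auto simp: row u_def intro: mmul_SLR shear_SLR\<close>)
  qed
  show ?case
  proof (cases "\<exists>j<n. g n j \<noteq> 0")
    case True then show ?thesis using E[OF Suc.prems(1)] by auto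
  next
    case False
    show ?thesis
    proof (cases "g n n = 0")
      case True
      have "vmul (Suc n) (g n) (minv (Suc n) g) = idn (Suc n) n"
        using mmul_minv(1)[OF Suc.prems(1)] mmul_eq_vmul[OF SLR_mat_n[OF Suc.prems(1)]] by metis
      moreover have "vmul (Suc n) (g n) (minv (Suc n) g) n = 0"
        using True False by (auto simp: vmul_def less_Suc_eq intro!: sum.neutral)
      ultimately show ?thesis by (simp add: idn_def fun_eq_iff split: if_splits)
    next
      case nz: False
      show ?thesis
      proof (cases "n = 0")
        case True
        then show ?thesis using Suc.prems(1) det_n_1[of g] by (intro C) (auto simp: SLR_def)
      next
        case n0: False
        \<comment> \<open>Only the last entry of the last row is nonzero. Adding the last column to
          column 0 gives a nonzero entry to the left, which is the case \<open>E\<close>.\<close>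
        define u :: "nat \<Rightarrow> real" where "u = (\<lambda>b. if b = 0 then 1 else 0)"
        have sh: "shear (Suc n) {n} (transvec (Suc n) n u)" by (rule shear_transvec) (use n0 in \<open>simp add: u_def\<close>)
        show ?thesis
          by (rule reduce[OF Suc.prems(1) sh], rule E[of _ 0])
             (use Suc.prems(1) sh n0 nz False in \<open>auto simp: row u_def intro: mmul_SLR shear_SLR\<close>)
      qed
    qed
  qed
qed

text \<open>The Euclidean algorithm on the coordinates brings \<open>w\<close> to a multiple
  \<open>d\<close> of the last basis vector by an integral matrix, so \<open>w\<close> is
  \<open>d\<close> times the last row of the inverse. It terminates because the sum of absolute
  values drops by at least 1 as long as two entries are nonzero.\<close>

lemma integer_vector_row_multiple:
  assumes "w \<in> vec_n n" "\<And>i. w i \<in> \<int>" "w \<noteq> (\<lambda>_. 0)"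
  obtains \<gamma> d where "\<gamma> \<in> SLZ n" "d \<in> \<int>" "d \<noteq> 0" "\<And>j. j < n \<Longrightarrow> w j = d * \<gamma> (n - 1) j"
proof -
  define e where "e = (\<lambda>d::real. (\<lambda>j. if j = n - 1 then d else 0))"
  have "\<exists>\<gamma>\<in>SLZ n. \<exists>d\<in>\<int>. d \<noteq> 0 \<and> vmul n w \<gamma> = e d"
    using assms
  proof (induction "nat \<lfloor>\<Sum>i<n. \<bar>w i\<bar>\<rfloor>" arbitrary: w rule: less_induct)
    case less
    note IH = less.hyps and w = less.prems
    have reduce: "\<exists>\<gamma>\<in>SLZ n. \<exists>d\<in>\<int>. d \<noteq> 0 \<and> vmul n w \<gamma> = e d"
      if "s \<in> SLZ n" "\<exists>\<gamma>\<in>SLZ n. \<exists>d\<in>\<int>. d \<noteq> 0 \<and> vmul n (vmul n w s) \<gamma> = e d" for s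
      using that by (auto simp: vmul_mmul intro: mmul_SLZ)
    show ?case
    proof (cases "\<exists>i j. i < n \<and> j < n \<and> i \<noteq> j \<and> w i \<noteq> 0 \<and> w j \<noteq> 0")
      case True
      then obtain i j where ij: "i < n" "j < n" "i \<noteq> j" "w i \<noteq> 0" "w j \<noteq> 0" "\<bar>w j\<bar> \<le> \<bar>w i\<bar>"
        by (metis linear)
      \<comment> \<open>The signs make the larger entry shrink in absolute value by the size of the
        smaller one, which is at least 1.\<close>
      define u where "u = (\<lambda>b. if b = i then - sgn (w i) * sgn (w j) else 0)"
      define s where "s = transvec n j u"
      have s: "s \<in> SLZ n" unfolding s_def by (rule transvec_SLZ) (use ij in \<open>auto simp: u_def sgn_real_def\<close>)
      define w' where "w' = vmul n w s"
      have w'b: "w' b = (if b = i then w i - sgn (w i) * \<bar>w j\<bar> else w b)" for b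
        using ij w(1) by (auto simp: w'_def s_def vmul_transvec u_def vec_n_def sgn_real_def)
      have lt: "\<bar>w' i\<bar> \<le> \<bar>w i\<bar> - 1"
      proof -
        have "\<bar>w j\<bar> \<ge> 1" using w(2)[of j] ij(5) by (rule Ints_nonzero_abs_ge1)
        then show ?thesis using ij by (auto simp: w'b sgn_real_def abs_if)
      qed
      have "(\<Sum>b<n. \<bar>w' b\<bar>) = \<bar>w' i\<bar> + (\<Sum>b\<in>{..<n}-{i}. \<bar>w' b\<bar>)" using ij by (simp add: sum.remove)
      also have "\<dots> \<le> \<bar>w i\<bar> - 1 + (\<Sum>b\<in>{..<n}-{i}. \<bar>w b\<bar>)"
        using lt by (intro add_mono sum_mono) (auto simp: w'b)
      also have "\<dots> = (\<Sum>b<n. \<bar>w b\<bar>) - 1" using ij by (simp add: sum.remove[of _ i])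
      finally have le: "(\<Sum>b<n. \<bar>w' b\<bar>) \<le> (\<Sum>b<n. \<bar>w b\<bar>) - 1" .
      have "0 \<le> (\<Sum>b<n. \<bar>w' b\<bar>)" by (intro sum_nonneg) auto
      with le have "nat \<lfloor>\<Sum>b<n. \<bar>w' b\<bar>\<rfloor> < nat \<lfloor>\<Sum>b<n. \<bar>w b\<bar>\<rfloor>" by linarith
      moreover have "w' \<in> vec_n n" by (simp add: w'_def)
      moreover have "w' b \<in> \<int>" for b using w(2) by (auto simp: w'b sgn_real_def)
      moreover have "w' \<noteq> (\<lambda>_. 0)" using ij w'b[of j] by auto
      ultimately show ?thesis using IH[of w'] reduce[OF s] by (simp add: w'_def)
    next
      case False
      obtain i where i: "w i \<noteq> 0" using w(3) by auto
      then have "i < n" using w(1) by (auto simp: vec_n_def not_le[symmetric])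
      have z: "w b = 0" if "b \<noteq> i" for b using False i that w(1) \<open>i < n\<close> by (cases "b < n") (auto simp: vec_n_def)
      show ?thesis
      proof (cases "i = n - 1")
        case True
        have "vmul n w (idn n) = e (w i)" using w(1) z True by (auto simp: vmul_idn e_def)
        then show ?thesis using w(2) i by (intro bexI[of _ "idn n"] bexI[of _ "w i"]) auto
      next
        case False
        \<comment> \<open>The only nonzero entry is copied from \<open>i\<close> to
          \<open>n - 1\<close> by \<open>s\<close> and then erased at \<open>i\<close> by
          \<open>s'\<close>.\<close>
        define s where "s = transvec n i (\<lambda>b. if b = n - 1 then 1 else 0)"
        define s' where "s' = transvec n (n - 1) (\<lambda>b. if b = i then - 1 else 0)"
        have s: "s \<in> SLZ n" "s' \<in> SLZ n" using False \<open>i < n\<close> by (auto simp: s_def s'_def intro!: transvec_SLZ)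
        have "vmul n (vmul n w s) s' = e (w i)"
          using False \<open>i < n\<close> z by (auto simp: s_def s'_def vmul_transvec e_def fun_eq_iff)
        then show ?thesis using w(2) i s
          by (intro bexI[of _ "mmul n s s'"] bexI[of _ "w i"]) (auto simp: vmul_mmul mmul_SLZ)
      qed
    qed
  qed
  then obtain \<gamma> d where g: "\<gamma> \<in> SLZ n" "d \<in> \<int>" "d \<noteq> 0" "vmul n w \<gamma> = e d" by auto
  have "w j = d * minv n \<gamma> (n - 1) j" if "j < n" for j
  proof -
    have "w = vmul n (e d) (minv n \<gamma>)" using vmul_cancel(1)[OF SLZ_SLR[OF g(1)] assms(1)] g(4) by simp
    then have "w j = (\<Sum>i<n. e d i * minv n \<gamma> i j)" using that by (metis vmul_def)
    also have "\<dots> = (\<Sum>i<n. if i = n - 1 then d * minv n \<gamma> i j else 0)" by (rule sum.cong) (auto simp: e_def)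
    finally show ?thesis using that by simp
  qed
  then show ?thesis using that[OF minv_SLZ[OF g(1)] g(2,3)] by blast
qed

section \<open>Lebesgue measure on spaces of matrices\<close>

text \<open>On boxes the claim splits into the one-dimensional affine rule, and a product measure is
  determined by boxes. The case \<open>\<alpha> = 1\<close> gives translation invariance; general
  \<open>\<alpha>\<close> serves to pull back null sets.\<close>

lemma PiM_lborel_affine:
  fixes \<alpha> :: real and S :: "('i \<Rightarrow> real) set"
  assumes "finite I" "\<alpha> \<noteq> 0" "S \<in> sets (PiM I (\<lambda>_. lborel))"
  shows "ennreal (\<bar>\<alpha>\<bar> ^ card I) * emeasure (PiM I (\<lambda>_. lborel))
      ((\<lambda>x. \<lambda>i\<in>I. \<alpha> * x i + \<beta> i) -` S \<inter> space (PiM I (\<lambda>_. lborel))) = emeasure (PiM I (\<lambda>_. lborel)) S"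
proof -
  interpret product_sigma_finite "\<lambda>_::'i. lborel :: real measure" by standard
  let ?M = "PiM I (\<lambda>_. lborel :: real measure)"
  let ?T = "\<lambda>x. \<lambda>i\<in>I. \<alpha> * x i + \<beta> i"
  have T: "?T \<in> ?M \<rightarrow>\<^sub>M ?M" by (rule measurable_restrict) measurable
  define P where "P = scale_measure (ennreal (\<bar>\<alpha>\<bar> ^ card I)) (distr ?M ?M ?T)"
  have one: "ennreal \<bar>\<alpha>\<bar> * emeasure lborel ((\<lambda>x. \<alpha> * x + b) -` X) = emeasure lborel X"
    if X: "X \<in> sets lborel" for X b
  proof -
    have XX: "(\<lambda>x. \<alpha> * x + b) -` X \<in> sets borel"
      using measurable_sets[of "\<lambda>x. \<alpha> * x + b" borel borel X] X by simp
    have "emeasure lborel X = (\<integral>\<^sup>+x. indicator X x \<partial>lborel)" using X by simp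
    also have "\<dots> = \<bar>\<alpha>\<bar> * (\<integral>\<^sup>+x. indicator X (b + \<alpha> * x) \<partial>lborel)"
      using X assms(2) by (intro nn_integral_real_affine) auto
    also have "(\<integral>\<^sup>+x. indicator X (b + \<alpha> * x) \<partial>lborel) = (\<integral>\<^sup>+x. indicator ((\<lambda>x. \<alpha> * x + b) -` X) x \<partial>lborel)"
      by (intro nn_integral_cong) (simp add: indicator_def add.commute)
    finally show ?thesis using XX by simp
  qed
  have "P = ?M"
  proof (rule PiM_eqI)
    show "finite I" "sets P = sets ?M" using assms by (simp_all add: P_def)
    fix A :: "'i \<Rightarrow> real set" assume A: "\<And>i. i \<in> I \<Longrightarrow> A i \<in> sets lborel"
    have pre: "?T -` Pi\<^sub>E I A \<inter> space ?M = Pi\<^sub>E I (\<lambda>i. (\<lambda>x. \<alpha> * x + \<beta> i) -` A i)"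
      by (auto simp: space_PiM PiE_def Pi_def extensional_def)
    have pm: "(\<lambda>x. \<alpha> * x + \<beta> i) -` A i \<in> sets lborel" if "i \<in> I" for i
      using measurable_sets[of "\<lambda>x. \<alpha> * x + \<beta> i" borel borel "A i"] A[OF that] by simp
    have "P (Pi\<^sub>E I A) = ennreal (\<bar>\<alpha>\<bar> ^ card I) * emeasure ?M (Pi\<^sub>E I (\<lambda>i. (\<lambda>x. \<alpha> * x + \<beta> i) -` A i))"
      unfolding P_def using T A assms(1) by (simp add: emeasure_distr sets_PiM_I_finite pre del: vimage_Int)
    also have "\<dots> = ennreal (\<bar>\<alpha>\<bar> ^ card I) * (\<Prod>i\<in>I. emeasure lborel ((\<lambda>x. \<alpha> * x + \<beta> i) -` A i))"
      using pm assms(1) by (subst emeasure_PiM) auto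
    also have "\<dots> = (\<Prod>i\<in>I. ennreal \<bar>\<alpha>\<bar> * emeasure lborel ((\<lambda>x. \<alpha> * x + \<beta> i) -` A i))"
      by (simp add: prod.distrib ennreal_power)
    also have "\<dots> = (\<Prod>i\<in>I. emeasure lborel (A i))" using A by (intro prod.cong) (auto simp: one)
    finally show "P (Pi\<^sub>E I A) = (\<Prod>i\<in>I. emeasure lborel (A i))" .
  qed
  then have "emeasure ?M S = emeasure P S" by simp
  then show ?thesis unfolding P_def using T assms(3) by (simp add: emeasure_distr)
qed

lemma borel_measurable_rmatI:
  fixes f :: "'a \<Rightarrow> rmat"
  assumes "\<And>i j. (\<lambda>x. f x i j) \<in> borel_measurable M"
  shows "f \<in> borel_measurable M"
  by (rule measurable_coordinatewise_then_product, rule measurable_coordinatewise_then_product, rule assms)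

lemma borel_measurable_entry:
  fixes f :: "'a \<Rightarrow> rmat"
  assumes "f \<in> borel_measurable M"
  shows "(\<lambda>x. f x i j) \<in> borel_measurable M"
  by (rule measurable_product_then_coordinatewise[OF measurable_product_then_coordinatewise[OF assms]])

lemma continuous_on_rmat_entry: "continuous_on S (\<lambda>M::rmat. M i j)"
  by (rule continuous_on_product_then_coordinatewise[OF continuous_on_product_then_coordinatewise[OF continuous_on_id]])

section \<open>Lebesgue measure on a set of matrix entries\<close>

definition supp :: "(nat \<times> nat) set \<Rightarrow> rmat \<Rightarrow> bool" where
  "supp I x \<longleftrightarrow> (\<forall>i j. (i, j) \<notin> I \<longrightarrow> x i j = 0)"

definition zext :: "(nat \<times> nat) set \<Rightarrow> (nat \<times> nat \<Rightarrow> real) \<Rightarrow> rmat" where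
  "zext I x = (\<lambda>i j. if (i, j) \<in> I then x (i, j) else 0)"

definition madd :: "rmat \<Rightarrow> rmat \<Rightarrow> rmat" where
  "madd x y = (\<lambda>i j. x i j + y i j)"

text \<open>The entries in \<open>I\<close> carry Lebesgue measure and all others are zero. As all
  these measures live on one Borel space, blocks of entries can be split off and glued back by
  \<open>madd\<close>.\<close>

definition MI :: "(nat \<times> nat) set \<Rightarrow> rmat measure" where
  "MI I = distr (PiM I (\<lambda>_. lborel)) borel (zext I)"

lemma supp_zext [simp]: "supp I (zext I x)"
  by (simp add: supp_def zext_def)

lemma zext_measurable [measurable]: "zext I \<in> borel_measurable (PiM I (\<lambda>_. lborel))"
proof (rule borel_measurable_rmatI)
  fix i j show "(\<lambda>x. zext I x i j) \<in> borel_measurable (PiM I (\<lambda>_. lborel))"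
    using measurable_component_singleton[of "(i, j)" I "\<lambda>_. lborel :: real measure"]
    by (cases "(i, j) \<in> I") (auto simp: zext_def)
qed

lemma madd_measurable [measurable (raw)]:
  assumes "f \<in> borel_measurable M" "g \<in> borel_measurable M"
  shows "(\<lambda>x. madd (f x) (g x)) \<in> borel_measurable M"
  unfolding madd_def by (rule borel_measurable_rmatI) (intro borel_measurable_add borel_measurable_entry assms)

lemma sets_MI [simp, measurable_cong]: "sets (MI I) = sets borel"
  by (simp add: MI_def)

lemma space_MI [simp]: "space (MI I) = UNIV"
  by (simp add: MI_def)

lemma nn_integral_MI:
  "f \<in> borel_measurable borel \<Longrightarrow> (\<integral>\<^sup>+x. f x \<partial>MI I) = (\<integral>\<^sup>+x. f (zext I x) \<partial>PiM I (\<lambda>_. lborel))"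
  unfolding MI_def by (rule nn_integral_distr) measurable

lemma nn_integral_MI_supp_cong:
  assumes "f \<in> borel_measurable borel" "g \<in> borel_measurable borel" "\<And>x. supp I x \<Longrightarrow> f x = g x"
  shows "(\<integral>\<^sup>+x. f x \<partial>MI I) = (\<integral>\<^sup>+x. g x \<partial>MI I)"
  unfolding nn_integral_MI[OF assms(1)] nn_integral_MI[OF assms(2)] by (simp add: assms(3))

lemma emeasure_distr_nn_integral:
  assumes "T \<in> M \<rightarrow>\<^sub>M N" "S \<in> sets N"
  shows "emeasure (distr M N T) S = (\<integral>\<^sup>+x. indicator S (T x) \<partial>M)"
proof -
  have "(\<integral>\<^sup>+x. indicator S (T x) \<partial>M) = (\<integral>\<^sup>+x. indicator S x \<partial>distr M N T)"
    by (rule nn_integral_distr[symmetric]) (use assms in auto)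
  then show ?thesis using assms by simp
qed

lemma borel_measurable_nn_integral_MI:
  assumes "finite J" and [measurable]: "g \<in> borel_measurable borel"
  shows "(\<lambda>x. \<integral>\<^sup>+y. g (madd x y) \<partial>MI J) \<in> borel_measurable borel"
proof -
  interpret J: finite_product_sigma_finite "\<lambda>_::nat \<times> nat. lborel :: real measure" J by standard fact
  have eq: "(\<integral>\<^sup>+y. g (madd x y) \<partial>MI J) = (\<integral>\<^sup>+y. g (madd x (zext J y)) \<partial>PiM J (\<lambda>_. lborel))" for x
    by (rule nn_integral_MI) measurable
  have "(\<lambda>p. g (madd (fst p) (zext J (snd p)))) \<in> borel_measurable (borel \<Otimes>\<^sub>M PiM J (\<lambda>_. lborel))"
    by (intro measurable_compose[OF _ assms(2)] madd_measurable measurable_fst measurable_compose[OF measurable_snd zext_measurable])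
  then show ?thesis unfolding eq
    by (intro J.borel_measurable_nn_integral) (simp only: split_beta')
qed

lemma nn_integral_MI_union:
  assumes "finite I" "finite J" "I \<inter> J = {}" and [measurable]: "f \<in> borel_measurable borel"
  shows "(\<integral>\<^sup>+x. f x \<partial>MI (I \<union> J)) = (\<integral>\<^sup>+x. (\<integral>\<^sup>+y. f (madd x y) \<partial>MI J) \<partial>MI I)"
proof -
  interpret product_sigma_finite "\<lambda>_::nat \<times> nat. lborel :: real measure" by standard
  have eq: "zext (I \<union> J) (merge I J (x, y)) = madd (zext I x) (zext J y)" for x y
    using assms(3) by (auto simp: zext_def madd_def merge_def fun_eq_iff)
  have fm: "(\<lambda>x. f (zext (I \<union> J) x)) \<in> borel_measurable (PiM (I \<union> J) (\<lambda>_. lborel))"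
    by measurable
  have "(\<integral>\<^sup>+x. f x \<partial>MI (I \<union> J)) = (\<integral>\<^sup>+x. f (zext (I \<union> J) x) \<partial>PiM (I \<union> J) (\<lambda>_. lborel))"
    by (rule nn_integral_MI) fact
  also have "\<dots> = (\<integral>\<^sup>+x. (\<integral>\<^sup>+y. f (madd (zext I x) (zext J y)) \<partial>PiM J (\<lambda>_. lborel)) \<partial>PiM I (\<lambda>_. lborel))"
    unfolding eq[symmetric] by (rule product_nn_integral_fold[OF assms(3,1,2) fm])
  also have "\<dots> = (\<integral>\<^sup>+x. (\<integral>\<^sup>+y. f (madd (zext I x) y) \<partial>MI J) \<partial>PiM I (\<lambda>_. lborel))"
  proof (rule nn_integral_cong)
    fix x
    have "(\<lambda>y. f (madd (zext I x) y)) \<in> borel_measurable borel" by measurable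
    from nn_integral_MI[OF this, of J]
    show "(\<integral>\<^sup>+y. f (madd (zext I x) (zext J y)) \<partial>PiM J (\<lambda>_. lborel)) = (\<integral>\<^sup>+y. f (madd (zext I x) y) \<partial>MI J)" ..
  qed
  also have "\<dots> = (\<integral>\<^sup>+x. (\<integral>\<^sup>+y. f (madd x y) \<partial>MI J) \<partial>MI I)"
    by (rule nn_integral_MI[OF borel_measurable_nn_integral_MI[OF assms(2,4)], symmetric])
  finally show ?thesis .
qed

lemma nn_integral_MI_translate:
  assumes "finite I" "supp I c" and [measurable]: "f \<in> borel_measurable borel"
  shows "(\<integral>\<^sup>+x. f (madd x c) \<partial>MI I) = (\<integral>\<^sup>+x. f x \<partial>MI I)"
proof -
  let ?M = "PiM I (\<lambda>_. lborel :: real measure)"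
  let ?T = "\<lambda>x. \<lambda>p\<in>I. 1 * x p + c (fst p) (snd p)"
  have T: "?T \<in> ?M \<rightarrow>\<^sub>M ?M" by (rule measurable_restrict) measurable
  have D: "distr ?M ?M ?T = ?M"
  proof (rule measure_eqI)
    fix S assume S: "S \<in> sets (distr ?M ?M ?T)"
    then show "emeasure (distr ?M ?M ?T) S = emeasure ?M S"
      using T PiM_lborel_affine[OF assms(1), of 1 S "\<lambda>p. c (fst p) (snd p)"] by (simp add: emeasure_distr)
  qed simp
  have eq: "zext I (?T x) = madd (zext I x) c" for x
    using assms(2) by (auto simp: zext_def madd_def supp_def fun_eq_iff)
  have "(\<integral>\<^sup>+x. f x \<partial>MI I) = (\<integral>\<^sup>+x. f (zext I x) \<partial>distr ?M ?M ?T)" unfolding D by (rule nn_integral_MI) fact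
  also have "\<dots> = (\<integral>\<^sup>+x. f (zext I (?T x)) \<partial>?M)" by (rule nn_integral_distr[OF T]) measurable
  also have "\<dots> = (\<integral>\<^sup>+x. f (madd (zext I x) c) \<partial>?M)" by (simp only: eq)
  also have "\<dots> = (\<integral>\<^sup>+x. f (madd x c) \<partial>MI I)"
    by (rule nn_integral_MI[of "\<lambda>x. f (madd x c)", symmetric]) measurable
  finally show ?thesis by simp
qed

text \<open>The map fixes the entries in \<open>I\<close> and translates those in \<open>J\<close>
  by an amount depending on the \<open>I\<close>-part alone. Integrating over \<open>J\<close>
  first, with the \<open>I\<close>-part fixed, leaves a plain translation.\<close>

lemma MI_block_shear:
  assumes fin: "finite I" "finite J" "I \<inter> J = {}" and [measurable]: "T \<in> borel_measurable borel"
    and "\<And>x. supp J (\<phi> x)"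
    and T: "\<And>x y. supp I x \<Longrightarrow> supp J y \<Longrightarrow> T (madd x y) = madd x (madd y (\<phi> x))"
  shows "distr (MI (I \<union> J)) borel T = MI (I \<union> J)"
proof (rule measure_eqI)
  fix S assume "S \<in> sets (distr (MI (I \<union> J)) borel T)"
  then have [measurable]: "S \<in> sets borel" by simp
  define f :: "rmat \<Rightarrow> ennreal" where "f = indicator S"
  have f [measurable]: "f \<in> borel_measurable borel" by (simp add: f_def)
  note m = borel_measurable_nn_integral_MI[OF fin(2)]
  have "emeasure (distr (MI (I \<union> J)) borel T) S = (\<integral>\<^sup>+x. f (T x) \<partial>MI (I \<union> J))"
    unfolding f_def by (rule emeasure_distr_nn_integral) measurable
  also have "\<dots> = (\<integral>\<^sup>+x. (\<integral>\<^sup>+y. f (T (madd x y)) \<partial>MI J) \<partial>MI I)"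
    by (rule nn_integral_MI_union[OF fin]) measurable
  also have "\<dots> = (\<integral>\<^sup>+x. (\<integral>\<^sup>+y. f (madd x y) \<partial>MI J) \<partial>MI I)"
  proof (rule nn_integral_MI_supp_cong[OF m[of "\<lambda>x. f (T x)"] m[OF f]], measurable)
    fix x assume x: "supp I x"
    have "(\<integral>\<^sup>+y. f (T (madd x y)) \<partial>MI J) = (\<integral>\<^sup>+y. f (madd x (madd y (\<phi> x))) \<partial>MI J)"
    proof (rule nn_integral_MI_supp_cong)
      show "(\<lambda>y. f (T (madd x y))) \<in> borel_measurable borel"
        "(\<lambda>y. f (madd x (madd y (\<phi> x)))) \<in> borel_measurable borel" by measurable
    qed (simp only: T[OF x])
    also have "\<dots> = (\<integral>\<^sup>+y. f (madd x y) \<partial>MI J)"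
      by (rule nn_integral_MI_translate[OF fin(2) assms(5), of "\<lambda>y. f (madd x y)"]) measurable
    finally show "(\<integral>\<^sup>+y. f (T (madd x y)) \<partial>MI J) = (\<integral>\<^sup>+y. f (madd x y) \<partial>MI J)" .
  qed
  also have "\<dots> = (\<integral>\<^sup>+x. f x \<partial>MI (I \<union> J))"
    by (rule nn_integral_MI_union[OF fin, symmetric]) measurable
  finally show "emeasure (distr (MI (I \<union> J)) borel T) S = emeasure (MI (I \<union> J)) S"
    by (simp add: f_def)
qed simp

lemma box_borel:
  assumes "finite I" "\<And>p. p \<in> I \<Longrightarrow> B p \<in> sets borel"
  shows "{x::rmat. \<forall>p\<in>I. x (fst p) (snd p) \<in> B p} \<in> sets borel"
proof -
  have "{x \<in> space borel. (x::rmat) (fst p) (snd p) \<in> B p} \<in> sets borel" if "p \<in> I" for p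
    using measurable_sets[OF borel_measurable_entry[OF measurable_ident] assms(2)[OF that], of "fst p" "snd p"]
    by (simp add: vimage_def)
  then have "{x \<in> space borel. \<forall>p\<in>I. (x::rmat) (fst p) (snd p) \<in> B p} \<in> sets borel"
    using assms(1) by (intro sets.sets_Collect_finite_All)
  then show ?thesis by simp
qed

lemma emeasure_MI_box:
  assumes "finite I" "\<And>p. p \<in> I \<Longrightarrow> B p \<in> sets borel"
  shows "emeasure (MI I) {x. \<forall>p\<in>I. x (fst p) (snd p) \<in> B p} = (\<Prod>p\<in>I. emeasure lborel (B p))"
proof -
  interpret product_sigma_finite "\<lambda>_::nat \<times> nat. lborel :: real measure" by standard
  note m = box_borel[of I B, OF assms]
  have "emeasure (MI I) {x. \<forall>p\<in>I. x (fst p) (snd p) \<in> B p} =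
    emeasure (PiM I (\<lambda>_. lborel)) (zext I -` {x. \<forall>p\<in>I. x (fst p) (snd p) \<in> B p} \<inter> space (PiM I (\<lambda>_. lborel)))"
    unfolding MI_def by (rule emeasure_distr[OF _ m]) measurable
  also have "zext I -` {x. \<forall>p\<in>I. x (fst p) (snd p) \<in> B p} \<inter> space (PiM I (\<lambda>_. lborel)) = Pi\<^sub>E I B"
    by (auto simp: zext_def space_PiM PiE_def Pi_def)
  finally show ?thesis using assms by (simp add: emeasure_PiM)
qed

section \<open>Invariance of Lebesgue measure under multiplication by SL(n, R)\<close>

definition rmul :: "nat \<Rightarrow> rmat \<Rightarrow> rmat \<Rightarrow> rmat" where
  "rmul n g x = (\<lambda>i. vmul n (x i) g)"

definition lmul :: "nat \<Rightarrow> rmat \<Rightarrow> rmat \<Rightarrow> rmat" where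
  "lmul n g x = (\<lambda>i j. if i < n then \<Sum>l<n. g i l * x l j else 0)"

lemma rmul_eq_mmul: "x \<in> mat_n n \<Longrightarrow> rmul n g x = mmul n x g"
  by (simp add: rmul_def mmul_eq_vmul)

lemma lmul_eq_mmul: "x \<in> mat_n n \<Longrightarrow> lmul n g x = mmul n g x"
  by (auto simp: lmul_def mmul_def mat_n_def fun_eq_iff)

lemma rmul_measurable [measurable (raw)]:
  assumes "f \<in> borel_measurable M" "h \<in> borel_measurable M"
  shows "(\<lambda>x. rmul n (f x) (h x)) \<in> borel_measurable M"
proof (rule borel_measurable_rmatI)
  fix i j
  have "(\<lambda>x. \<Sum>l<n. h x i l * f x l j) \<in> borel_measurable M"
    by (intro borel_measurable_sum borel_measurable_times borel_measurable_entry assms)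
  then show "(\<lambda>x. rmul n (f x) (h x) i j) \<in> borel_measurable M"
    by (cases "j < n") (simp_all add: rmul_def vmul_def cong: conj_cong)
qed

lemma lmul_measurable [measurable (raw)]:
  assumes "f \<in> borel_measurable M" "h \<in> borel_measurable M"
  shows "(\<lambda>x. lmul n (f x) (h x)) \<in> borel_measurable M"
proof (rule borel_measurable_rmatI)
  fix i j
  have "(\<lambda>x. \<Sum>l<n. f x i l * h x l j) \<in> borel_measurable M"
    by (intro borel_measurable_sum borel_measurable_times borel_measurable_entry assms)
  then show "(\<lambda>x. lmul n (f x) (h x) i j) \<in> borel_measurable M"
    by (cases "i < n") (simp_all add: lmul_def cong: conj_cong)
qed

lemma mmul_measurable [measurable (raw)]:
  assumes "f \<in> borel_measurable M" "h \<in> borel_measurable M"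
  shows "(\<lambda>x. mmul n (f x) (h x)) \<in> borel_measurable M"
proof (rule borel_measurable_rmatI)
  fix i j
  have "(\<lambda>x. \<Sum>l<n. f x i l * h x l j) \<in> borel_measurable M"
    by (intro borel_measurable_sum borel_measurable_times borel_measurable_entry assms)
  then show "(\<lambda>x. mmul n (f x) (h x) i j) \<in> borel_measurable M"
    by (cases "i < n \<and> j < n") (simp_all add: mmul_def cong: conj_cong)
qed

lemma det_n_measurable:
  assumes "\<And>i j. (\<lambda>x. f x i j) \<in> borel_measurable M"
  shows "(\<lambda>x. det_n n (f x)) \<in> borel_measurable M"
  unfolding det_n_def by (intro borel_measurable_sum borel_measurable_times borel_measurable_prod assms borel_measurable_const)

lemma minv_measurable [measurable (raw)]:
  assumes "f \<in> borel_measurable M"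
  shows "(\<lambda>x. minv n (f x)) \<in> borel_measurable M"
proof (rule borel_measurable_rmatI)
  fix i j
  have "(\<lambda>x. (- 1) ^ (j + i) * det_n (n - 1) (\<lambda>a b. f x (if a < j then a else Suc a) (if b < i then b else Suc b))) \<in> borel_measurable M"
    by (intro borel_measurable_times borel_measurable_const det_n_measurable borel_measurable_entry assms)
  then show "(\<lambda>x. minv n (f x) i j) \<in> borel_measurable M"
    by (cases "i < n \<and> j < n") (simp_all add: minv_def cong: conj_cong)
qed

text \<open>Right multiplication keeps the columns in \<open>A\<close> and adds combinations of them
  to the columns outside \<open>A\<close>, so the former are the fixed block.\<close>

lemma rmul_shear_MI:
  assumes "finite R" "shear n A s"
  shows "distr (MI (R \<times> {..<n})) borel (rmul n s) = MI (R \<times> {..<n})"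
proof -
  let ?I = "R \<times> ({..<n} \<inter> A)" and ?J = "R \<times> ({..<n} - A)"
  define \<phi> where "\<phi> = (\<lambda>(x::rmat) r l. if r \<in> R \<and> l < n \<and> l \<notin> A then \<Sum>i<n. (if i \<in> A then x r i * s i l else 0) else 0)"
  have s: "\<And>i. i < n \<Longrightarrow> s i i = 1" "\<And>i j. i \<noteq> j \<Longrightarrow> i \<notin> A \<or> j \<in> A \<Longrightarrow> s i j = 0"
    using assms(2) by (auto simp: shear_def)
  have IJ: "?I \<union> ?J = R \<times> {..<n}" by auto
  have "distr (MI (?I \<union> ?J)) borel (rmul n s) = MI (?I \<union> ?J)"
  proof (rule MI_block_shear[where \<phi> = \<phi>])
    fix x y assume x: "supp ?I x" and y: "supp ?J y"
    show "rmul n s (madd x y) = madd x (madd y (\<phi> x))"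
    proof (intro ext)
      fix r l
      show "rmul n s (madd x y) r l = madd x (madd y (\<phi> x)) r l"
      proof (cases "r \<in> R \<and> l < n")
        case False
        then show ?thesis using x y by (auto simp: supp_def rmul_def vmul_def madd_def \<phi>_def)
      next
        case True
        have "(\<Sum>i<n. (x r i + y r i) * s i l) =
            (\<Sum>i<n. (if i = l then x r l + y r l else 0) + (if i \<in> A \<and> l \<notin> A then x r i * s i l else 0))"
          using True x y s by (intro sum.cong) (auto simp: supp_def)
        also have "\<dots> = x r l + y r l + \<phi> x r l"
          using True by (simp add: sum.distrib \<phi>_def)
        finally show ?thesis using True by (simp add: rmul_def vmul_def madd_def)
      qed
    qed
  qed (use assms in \<open>auto simp: supp_def \<phi>_def\<close>)
  then show ?thesis by (simp add: IJ)
qed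

text \<open>The roles are exchanged: the rows outside \<open>A\<close> are kept, and the rows in
  \<open>A\<close> receive combinations of them.\<close>

lemma lmul_shear_MI:
  assumes "finite C" "shear n A s"
  shows "distr (MI ({..<n} \<times> C)) borel (lmul n s) = MI ({..<n} \<times> C)"
proof -
  let ?I = "({..<n} - A) \<times> C" and ?J = "({..<n} \<inter> A) \<times> C"
  define \<phi> where "\<phi> = (\<lambda>(x::rmat) i c. if i < n \<and> i \<in> A \<and> c \<in> C then \<Sum>l<n. (if l \<notin> A then s i l * x l c else 0) else 0)"
  have s: "\<And>i. i < n \<Longrightarrow> s i i = 1" "\<And>i j. i \<noteq> j \<Longrightarrow> i \<notin> A \<or> j \<in> A \<Longrightarrow> s i j = 0"
    using assms(2) by (auto simp: shear_def)
  have IJ: "?I \<union> ?J = {..<n} \<times> C" by auto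
  have "distr (MI (?I \<union> ?J)) borel (lmul n s) = MI (?I \<union> ?J)"
  proof (rule MI_block_shear[where \<phi> = \<phi>])
    fix x y assume x: "supp ?I x" and y: "supp ?J y"
    show "lmul n s (madd x y) = madd x (madd y (\<phi> x))"
    proof (intro ext)
      fix i c
      show "lmul n s (madd x y) i c = madd x (madd y (\<phi> x)) i c"
      proof (cases "i < n \<and> c \<in> C")
        case False
        then show ?thesis using x y by (auto simp: supp_def lmul_def madd_def \<phi>_def)
      next
        case True
        have "(\<Sum>l<n. s i l * (x l c + y l c)) =
            (\<Sum>l<n. (if l = i then x i c + y i c else 0) + (if i \<in> A \<and> l \<notin> A then s i l * x l c else 0))"
          using True x y s by (intro sum.cong) (auto simp: supp_def)
        also have "\<dots> = x i c + y i c + \<phi> x i c"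
          using True by (simp add: sum.distrib \<phi>_def)
        finally show ?thesis using True by (simp add: lmul_def madd_def)
      qed
    qed
  qed (use assms in \<open>auto simp: supp_def \<phi>_def\<close>)
  then show ?thesis by (simp add: IJ)
qed

lemma rmul_mmul: "rmul n (mmul n g h) x = rmul n h (rmul n g x)"
  by (simp add: rmul_def vmul_mmul)

lemma lmul_mmul: "lmul n (mmul n g h) x = lmul n g (lmul n h x)"
  by (auto simp: lmul_def mmul_def fun_eq_iff sum_distrib_left sum_distrib_right mult.assoc intro: sum.swap)

text \<open>Only the column index is tied to \<open>n\<close>, the set of rows is free. A single row
  is the case of Minkowski's theorem; \<open>n\<close> rows of length \<open>Suc n\<close> occur in
  the reduction step.\<close>

lemma distr_rmul_MI:
  assumes "finite R" "g \<in> SLR n"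
  shows "distr (MI (R \<times> {..<n})) borel (rmul n g) = MI (R \<times> {..<n})"
proof (rule SLR_induct[OF assms(2), where P = "\<lambda>g. distr (MI (R \<times> {..<n})) borel (rmul n g) = MI (R \<times> {..<n})"])
  have "rmul n (idn n) (zext (R \<times> {..<n}) x) = zext (R \<times> {..<n}) x" for x
    by (auto simp: rmul_def zext_def fun_eq_iff vmul_idn vec_n_def)
  then have "rmul n (idn n) \<circ> zext (R \<times> {..<n}) = zext (R \<times> {..<n})" by (simp add: comp_def fun_eq_iff)
  then show "distr (MI (R \<times> {..<n})) borel (rmul n (idn n)) = MI (R \<times> {..<n})"
    unfolding MI_def by (subst distr_distr) auto
next
  fix g A s assume IH: "distr (MI (R \<times> {..<n})) borel (rmul n g) = MI (R \<times> {..<n})" and s: "shear n A s"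
  have *: "distr (MI (R \<times> {..<n})) borel (rmul n (mmul n a b)) = distr (distr (MI (R \<times> {..<n})) borel (rmul n a)) borel (rmul n b)" for a b
    by (subst distr_distr) (auto simp: comp_def rmul_mmul[abs_def])
  show "distr (MI (R \<times> {..<n})) borel (rmul n (mmul n g s)) = MI (R \<times> {..<n})"
    "distr (MI (R \<times> {..<n})) borel (rmul n (mmul n s g)) = MI (R \<times> {..<n})"
    unfolding * by (simp_all add: IH rmul_shear_MI[OF assms(1) s])
qed

lemma distr_lmul_MI:
  assumes "finite C" "g \<in> SLR n"
  shows "distr (MI ({..<n} \<times> C)) borel (lmul n g) = MI ({..<n} \<times> C)"
proof (rule SLR_induct[OF assms(2), where P = "\<lambda>g. distr (MI ({..<n} \<times> C)) borel (lmul n g) = MI ({..<n} \<times> C)"])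
  have "lmul n (idn n) (zext ({..<n} \<times> C) x) = zext ({..<n} \<times> C) x" for x
    by (auto simp: lmul_def zext_def fun_eq_iff idn_def if_distrib[of "\<lambda>x. x * _"] cong: if_cong)
  then have "lmul n (idn n) \<circ> zext ({..<n} \<times> C) = zext ({..<n} \<times> C)" by (simp add: comp_def fun_eq_iff)
  then show "distr (MI ({..<n} \<times> C)) borel (lmul n (idn n)) = MI ({..<n} \<times> C)"
    unfolding MI_def by (subst distr_distr) auto
next
  fix g A s assume IH: "distr (MI ({..<n} \<times> C)) borel (lmul n g) = MI ({..<n} \<times> C)" and s: "shear n A s"
  have *: "distr (MI ({..<n} \<times> C)) borel (lmul n (mmul n a b)) = distr (distr (MI ({..<n} \<times> C)) borel (lmul n b)) borel (lmul n a)" for a b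
    by (subst distr_distr) (auto simp: comp_def lmul_mmul[abs_def])
  show "distr (MI ({..<n} \<times> C)) borel (lmul n (mmul n g s)) = MI ({..<n} \<times> C)"
    "distr (MI ({..<n} \<times> C)) borel (lmul n (mmul n s g)) = MI ({..<n} \<times> C)"
    unfolding * by (simp_all add: IH lmul_shear_MI[OF assms(1) s])
qed

section \<open>Reduction theory\<close>

text \<open>Cover \<open>S\<close> by the pieces \<open>X \<gamma>\<close> that
  \<open>a \<gamma>\<close> sends into \<open>R\<close>. Their images lie in the sets
  \<open>Y \<gamma>\<close> of points of \<open>R\<close> that \<open>b \<gamma>\<close> sends back
  to \<open>S\<close>, and these are disjoint by \<open>once\<close>. Since
  \<open>a \<gamma>\<close> preserves the measure, the total over the pieces is at most that of
  \<open>R\<close>. Minkowski's theorem, finite covolume and the comparison of fundamental domains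
  are all instances.\<close>

lemma emeasure_le_of_orbits:
  assumes "countable \<Gamma>"
    and a: "\<And>\<gamma>. \<gamma> \<in> \<Gamma> \<Longrightarrow> a \<gamma> \<in> M \<rightarrow>\<^sub>M M" "\<And>\<gamma>. \<gamma> \<in> \<Gamma> \<Longrightarrow> distr M M (a \<gamma>) = M"
    and b: "\<And>\<gamma>. \<gamma> \<in> \<Gamma> \<Longrightarrow> b \<gamma> \<in> M \<rightarrow>\<^sub>M M"
    and SR: "S \<in> sets M" "R \<in> sets M"
    and ba: "\<And>\<gamma> x. \<gamma> \<in> \<Gamma> \<Longrightarrow> x \<in> S \<Longrightarrow> b \<gamma> (a \<gamma> x) = x"
    and cover: "\<And>x. x \<in> S \<Longrightarrow> \<exists>\<gamma>\<in>\<Gamma>. a \<gamma> x \<in> R"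
    and once: "\<And>y \<gamma> \<delta>. y \<in> R \<Longrightarrow> \<gamma> \<in> \<Gamma> \<Longrightarrow> \<delta> \<in> \<Gamma> \<Longrightarrow> b \<gamma> y \<in> S \<Longrightarrow> b \<delta> y \<in> S \<Longrightarrow> \<gamma> = \<delta>"
  shows "emeasure M S \<le> emeasure M R"
proof -
  define X where "X \<gamma> = S \<inter> (a \<gamma> -` R \<inter> space M)" for \<gamma>
  define Y where "Y \<gamma> = R \<inter> (b \<gamma> -` S \<inter> space M)" for \<gamma>
  have Xs: "X \<gamma> \<in> sets M" if "\<gamma> \<in> \<Gamma>" for \<gamma>
    using SR measurable_sets[OF a(1)[OF that]] by (auto simp: X_def)
  have Ys: "Y \<gamma> \<in> sets M" if "\<gamma> \<in> \<Gamma>" for \<gamma>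
    using SR measurable_sets[OF b(1)[OF that]] by (auto simp: Y_def)
  have "emeasure M S = (\<integral>\<^sup>+x. indicator S x \<partial>M)" using SR by simp
  also have "\<dots> \<le> (\<integral>\<^sup>+x. (\<integral>\<^sup>+\<gamma>. indicator (X \<gamma>) x \<partial>count_space \<Gamma>) \<partial>M)"
  proof (intro nn_integral_mono)
    fix x assume "x \<in> space M"
    show "indicator S x \<le> (\<integral>\<^sup>+\<gamma>. indicator (X \<gamma>) x \<partial>count_space \<Gamma>)"
    proof (cases "x \<in> S")
      case True
      then obtain \<gamma> where g: "\<gamma> \<in> \<Gamma>" "a \<gamma> x \<in> R" using cover by auto
      have "1 = (\<integral>\<^sup>+\<delta>. indicator {\<gamma>} \<delta> \<partial>count_space \<Gamma>)" using g by simp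
      also have "\<dots> \<le> (\<integral>\<^sup>+\<gamma>. indicator (X \<gamma>) x \<partial>count_space \<Gamma>)"
        using g True \<open>x \<in> space M\<close> by (intro nn_integral_mono) (auto simp: X_def indicator_def)
      finally show ?thesis using True by simp
    qed simp
  qed
  also have "\<dots> = (\<integral>\<^sup>+\<gamma>. (\<integral>\<^sup>+x. indicator (X \<gamma>) x \<partial>M) \<partial>count_space \<Gamma>)"
    using assms(1) Xs by (intro nn_integral_count_space_nn_integral) auto
  also have "\<dots> = (\<integral>\<^sup>+\<gamma>. emeasure M (X \<gamma>) \<partial>count_space \<Gamma>)"
    using Xs by (intro nn_integral_cong) simp
  also have "\<dots> \<le> (\<integral>\<^sup>+\<gamma>. emeasure M (Y \<gamma>) \<partial>count_space \<Gamma>)"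
  proof (intro nn_integral_mono)
    fix \<gamma> assume "\<gamma> \<in> space (count_space \<Gamma>)"
    then have g: "\<gamma> \<in> \<Gamma>" by simp
    have "X \<gamma> \<subseteq> a \<gamma> -` Y \<gamma> \<inter> space M"
      using ba[OF g] measurable_space[OF a(1)[OF g]] by (auto simp: X_def Y_def)
    then have "emeasure M (X \<gamma>) \<le> emeasure M (a \<gamma> -` Y \<gamma> \<inter> space M)"
      by (intro emeasure_mono measurable_sets[OF a(1)[OF g] Ys[OF g]])
    also have "\<dots> = emeasure (distr M M (a \<gamma>)) (Y \<gamma>)" by (simp add: emeasure_distr a(1)[OF g] Ys[OF g])
    finally show "emeasure M (X \<gamma>) \<le> emeasure M (Y \<gamma>)" by (simp add: a(2)[OF g])
  qed
  also have "\<dots> = emeasure M (\<Union>(Y ` \<Gamma>))"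
    using assms(1) Ys once by (intro emeasure_UN_countable[symmetric]) (auto simp: disjoint_family_on_def Y_def)
  also have "\<dots> \<le> emeasure M R" using SR by (intro emeasure_mono) (auto simp: Y_def)
  finally show ?thesis .
qed

section \<open>Minkowski's theorem for a cube\<close>

lemma countable_integer_vectors: "countable {w \<in> vec_n n. \<forall>i. w i \<in> \<int>}"
proof -
  have "countable (PiE {..<n} (\<lambda>_. \<int> :: real set))" by (intro countable_PiE) (auto simp: Ints_def)
  then have "countable ((\<lambda>v i. if i < n then v i else 0) ` PiE {..<n} (\<lambda>_. \<int> :: real set))" by (rule countable_image)
  moreover have "{w \<in> vec_n n. \<forall>i. w i \<in> \<int>} \<subseteq> (\<lambda>v i. if i < n then v i else 0) ` PiE {..<n} (\<lambda>_. \<int> :: real set)"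
  proof safe
    fix w assume w: "w \<in> vec_n n" "\<forall>i. w i \<in> \<int>"
    then show "w \<in> (\<lambda>v i. if i < n then v i else 0) ` PiE {..<n} (\<lambda>_. \<int> :: real set)"
      by (rule_tac image_eqI[where x = "restrict w {..<n}"]) (auto simp: vec_n_def fun_eq_iff)
  qed
  ultimately show ?thesis by (rule countable_subset[rotated])
qed

lemma countable_SLZ [simp]: "countable (SLZ n)"
proof -
  have "countable (PiE ({..<n} \<times> {..<n}) (\<lambda>_. \<int> :: real set))" by (intro countable_PiE) (auto simp: Ints_def)
  then have "countable (zext ({..<n} \<times> {..<n}) ` PiE ({..<n} \<times> {..<n}) (\<lambda>_. \<int> :: real set))" by (rule countable_image)
  moreover have "SLZ n \<subseteq> zext ({..<n} \<times> {..<n}) ` PiE ({..<n} \<times> {..<n}) (\<lambda>_. \<int> :: real set)"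
  proof
    fix g assume g: "g \<in> SLZ n"
    then have "g = zext ({..<n} \<times> {..<n}) (\<lambda>p\<in>{..<n} \<times> {..<n}. g (fst p) (snd p))"
      by (auto simp: SLZ_def SLR_def mat_n_def zext_def fun_eq_iff)
    moreover have "(\<lambda>p\<in>{..<n} \<times> {..<n}. g (fst p) (snd p)) \<in> PiE ({..<n} \<times> {..<n}) (\<lambda>_. \<int>)"
      using g by (auto simp: SLZ_def)
    ultimately show "g \<in> zext ({..<n} \<times> {..<n}) ` PiE ({..<n} \<times> {..<n}) (\<lambda>_. \<int> :: real set)" by blast
  qed
  ultimately show ?thesis by (rule countable_subset[rotated])
qed

lemma distr_MI_translate:
  assumes "finite I" "supp I c"
  shows "distr (MI I) (MI I) (\<lambda>x. madd x c) = MI I"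
proof (rule measure_eqI)
  fix S assume "S \<in> sets (distr (MI I) (MI I) (\<lambda>x. madd x c))"
  then have S: "S \<in> sets borel" by simp
  have "emeasure (distr (MI I) (MI I) (\<lambda>x. madd x c)) S = (\<integral>\<^sup>+x. indicator S (madd x c) \<partial>MI I)"
    using S by (intro emeasure_distr_nn_integral) auto
  also have "\<dots> = (\<integral>\<^sup>+x. indicator S x \<partial>MI I)"
    using S by (intro nn_integral_MI_translate assms) simp
  finally show "emeasure (distr (MI I) (MI I) (\<lambda>x. madd x c)) S = emeasure (MI I) S" using S by simp
qed simp

text \<open>Blichfeldt's argument: the preimage under \<open>g\<close> of the cube \<open>[0,2)\<^sup>n\<close> has volume \<open>2\<^sup>n > 1\<close>,
  so two of its points are congruent modulo the integer lattice.\<close>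
lemma minkowski_cube:
  assumes g: "g \<in> SLR n" and n: "n \<ge> 1"
  obtains w where "w \<in> vec_n n" "\<And>i. w i \<in> \<int>" "w \<noteq> (\<lambda>_. 0)" "\<And>j. j < n \<Longrightarrow> \<bar>vmul n w g j\<bar> < 2"
proof (rule ccontr)
  assume "\<not> thesis"
  then have no: "w = (\<lambda>_. 0)" if "w \<in> vec_n n" "\<And>i. w i \<in> \<int>" "\<And>j. j < n \<Longrightarrow> \<bar>vmul n w g j\<bar> < 2" for w
    using that \<open>\<And>w. \<lbrakk>w \<in> vec_n n; \<And>i. w i \<in> \<int>; w \<noteq> (\<lambda>_. 0); \<And>j. j < n \<Longrightarrow> \<bar>vmul n w g j\<bar> < 2\<rbrakk> \<Longrightarrow> thesis\<close> by blast
  \<comment> \<open>Row vectors are stored as row 0 of a matrix, so that the invariance of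
    \<open>MI\<close> under \<open>rmul\<close> applies to them.\<close>
  let ?I = "{0::nat} \<times> {..<n}"
  define box where "box c = {x::rmat. \<forall>p\<in>?I. x (fst p) (snd p) \<in> {0..<c}}" for c :: real
  define S where "S = rmul n g -` box 2"
  define W where "W = {w \<in> vec_n n. \<forall>i. w i \<in> (\<int>::real set)}"
  define row where "row w = (\<lambda>i j. if i = (0::nat) \<and> j < n then w j else (0::real))" for w
  have box_m: "box c \<in> sets borel" for c
    unfolding box_def by (rule box_borel) auto
  have box_e: "emeasure (MI ?I) (box c) = ennreal c ^ n" if "c \<ge> 0" for c
    unfolding box_def using that by (subst emeasure_MI_box) (auto simp: card_cartesian_product)
  have Sm: "S \<in> sets borel" unfolding S_def by (rule measurable_sets_borel[OF _ box_m]) measurable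
  have "emeasure (MI ?I) S \<le> emeasure (MI ?I) (box 1)"
  proof (rule emeasure_le_of_orbits[where \<Gamma> = W and a = "\<lambda>w x. madd x (row (\<lambda>j. - w j))" and b = "\<lambda>w x. madd x (row w)"])
    show "countable W" unfolding W_def by (rule countable_integer_vectors)
    show "distr (MI ?I) (MI ?I) (\<lambda>x. madd x (row (\<lambda>j. - w j))) = MI ?I" if "w \<in> W" for w
      by (intro distr_MI_translate) (auto simp: supp_def row_def)
    show "madd (madd x (row (\<lambda>j. - w j))) (row w) = x" for w x by (auto simp: madd_def row_def fun_eq_iff)
    show "\<exists>w\<in>W. madd x (row (\<lambda>j. - w j)) \<in> box 1" for x
    proof
      show "(\<lambda>j. if j < n then of_int \<lfloor>x 0 j\<rfloor> else 0) \<in> W" by (auto simp: W_def vec_n_def)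
      show "madd x (row (\<lambda>j. - (if j < n then of_int \<lfloor>x 0 j\<rfloor> else 0))) \<in> box 1"
        by (auto simp: box_def madd_def row_def) linarith
    qed
    show "w = w'" if "w \<in> W" "w' \<in> W" "madd y (row w) \<in> S" "madd y (row w') \<in> S" for y w w'
    proof -
      have lin: "vmul n (\<lambda>j. w j - w' j) g j = vmul n (madd y (row w) 0) g j - vmul n (madd y (row w') 0) g j" if "j < n" for j
        using that by (simp add: vmul_def madd_def row_def sum_subtractf[symmetric] algebra_simps)
      have "(\<lambda>j. w j - w' j) = (\<lambda>_. 0)"
      proof (rule no)
        show "(\<lambda>j. w j - w' j) \<in> vec_n n" "\<And>i. w i - w' i \<in> \<int>" using that(1,2) by (auto simp: W_def vec_n_def)
        fix j assume "j < n"
        then have "vmul n (madd y (row w) 0) g j \<in> {0..<2}" "vmul n (madd y (row w') 0) g j \<in> {0..<2}"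
          using that(3,4) by (auto simp: S_def box_def rmul_def)
        then show "\<bar>vmul n (\<lambda>j. w j - w' j) g j\<bar> < 2" unfolding lin[OF \<open>j < n\<close>] by auto
      qed
      then show ?thesis by (simp add: fun_eq_iff)
    qed
  qed (auto simp: Sm box_m)
  moreover have "emeasure (MI ?I) S = emeasure (distr (MI ?I) borel (rmul n g)) (box 2)"
    using box_m by (simp add: emeasure_distr S_def)
  ultimately have "emeasure (MI ?I) (box 2) \<le> emeasure (MI ?I) (box 1)"
    using distr_rmul_MI[of "{0}" g n] g by simp
  then have "(2::ennreal) ^ n \<le> 1" by (simp add: box_e)
  moreover have "(2::ennreal) ^ 1 \<le> 2 ^ n" by (intro power_increasing n) auto
  ultimately have "(2::ennreal) \<le> 1" by (metis order_trans power_one_right)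
  then show False by simp
qed

section \<open>A small last row and its normalisation\<close>

lemma det_n_scale: "det_n n (\<lambda>i j. c * g i j) = c ^ n * det_n n g"
  by (simp add: det_n_def prod.distrib sum_distrib_left mult_ac)

definition nrm :: "nat \<Rightarrow> rmat \<Rightarrow> rmat" where
  "nrm n M = (\<lambda>i j. inverse (root n (det_n n M)) * M i j)"

lemma nrm_SLR:
  assumes "n \<ge> 1" "M \<in> mat_n n" "0 < det_n n M"
  shows "nrm n M \<in> SLR n"
  using assms by (auto simp: SLR_def nrm_def det_n_scale mat_n_def power_inverse real_root_pow_pos)

text \<open>Minkowski's theorem for the rescaled matrix gives an integer vector \<open>w\<close>
  with \<open>w M\<close> bounded by 2, because the scale \<open>r\<close> is at most 1. As
  \<open>w\<close> is \<open>d\<close> times the last row of some \<open>\<gamma>\<close> in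
  \<open>SLZ\<close> and \<open>d\<close> has absolute value at least 1, passing to that row only
  shortens the vector.\<close>

lemma exists_small_last_row:
  assumes n: "n \<ge> 1" and M: "M \<in> mat_n n" "0 < det_n n M" "det_n n M \<le> 1"
  obtains \<gamma> where "\<gamma> \<in> SLZ n" "\<And>j. j < n \<Longrightarrow> \<bar>mmul n \<gamma> M (n - 1) j\<bar> \<le> 2"
proof -
  define r where "r = root n (det_n n M)"
  have r: "0 < r" "r \<le> 1" using n M by (auto simp: r_def)
  obtain w where w: "w \<in> vec_n n" "\<And>i. w i \<in> \<int>" "w \<noteq> (\<lambda>_. 0)" "\<And>j. j < n \<Longrightarrow> \<bar>vmul n w (nrm n M) j\<bar> < 2"
    using minkowski_cube[OF nrm_SLR[OF n M(1,2)] n] by blast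
  obtain \<gamma> d where g: "\<gamma> \<in> SLZ n" "d \<in> \<int>" "d \<noteq> 0" "\<And>j. j < n \<Longrightarrow> w j = d * \<gamma> (n - 1) j"
    using integer_vector_row_multiple[OF w(1,2,3)] by blast
  have "\<bar>mmul n \<gamma> M (n - 1) j\<bar> \<le> 2" if j: "j < n" for j
  proof -
    have "vmul n w (nrm n M) j = inverse r * (d * mmul n \<gamma> M (n - 1) j)"
      using j n g(4) by (simp add: vmul_def mmul_def nrm_def r_def[symmetric] sum_distrib_left mult_ac)
    then have "\<bar>d\<bar> * \<bar>mmul n \<gamma> M (n - 1) j\<bar> = r * \<bar>vmul n w (nrm n M) j\<bar>"
      using r by (simp add: abs_mult)
    also have "\<dots> \<le> 1 * 2" using r w(4)[OF j] by (intro mult_mono) auto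
    finally have 1: "\<bar>d\<bar> * \<bar>mmul n \<gamma> M (n - 1) j\<bar> \<le> 2" by simp
    have "1 * \<bar>mmul n \<gamma> M (n - 1) j\<bar> \<le> \<bar>d\<bar> * \<bar>mmul n \<gamma> M (n - 1) j\<bar>"
      using Ints_nonzero_abs_ge1[OF g(2,3)] by (intro mult_right_mono) auto
    with 1 show ?thesis by simp
  qed
  then show ?thesis using that g(1) by blast
qed

text \<open>A matrix of determinant one that carries the row \<open>v\<close> to the last basis
  vector when \<open>v n\<close> is nonzero. The last column is divided by \<open>v n\<close> and
  then used to clear the others; the factor \<open>v n\<close> on column 0 restores the determinant.
  The explicit formula makes it measurable in \<open>v\<close>.\<close>

definition Kmat :: "nat \<Rightarrow> (nat \<Rightarrow> real) \<Rightarrow> rmat" where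
  "Kmat n v = (\<lambda>i j. if i < n \<and> i = j then (if j = 0 then v n else 1)
     else if i = n \<and> j = n then inverse (v n)
     else if i = n \<and> j < n then - (v j * inverse (v n)) * (if j = 0 then v n else 1) else 0)"

lemma Kmat_SLR:
  assumes "n \<ge> 1" "v n \<noteq> 0"
  shows "Kmat n v \<in> SLR (Suc n)"
proof -
  have "Determinant.det (tomat (Suc n) (Kmat n v)) = prod_list (diag_mat (tomat (Suc n) (Kmat n v)))"
    by (rule det_lower_triangular[of "Suc n"]) (auto simp: Kmat_def)
  also have "\<dots> = (\<Prod>i = 0..<Suc n. Kmat n v i i)"
    by (simp add: prod_list_diag_prod)
  also have "\<dots> = (\<Prod>i = 0..<n. if i = 0 then v n else 1) * inverse (v n)"
    by (simp add: Kmat_def)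
  also have "\<dots> = 1" using assms by simp
  finally have "det_n (Suc n) (Kmat n v) = 1" by (simp add: det_tomat)
  moreover have "Kmat n v \<in> mat_n (Suc n)" by (auto simp: Kmat_def mat_n_def)
  ultimately show ?thesis by (simp add: SLR_def)
qed

lemma vmul_Kmat:
  assumes "v n \<noteq> 0"
  shows "vmul (Suc n) v (Kmat n v) = (\<lambda>j. if j = n then 1 else 0)"
proof
  fix j
  have "(\<Sum>i<n. v i * Kmat n v i j) = (\<Sum>i<n. if i = j then v j * (if j = 0 then v n else 1) else 0)"
    by (intro sum.cong) (auto simp: Kmat_def)
  then show "vmul (Suc n) v (Kmat n v) j = (if j = n then 1 else 0)"
    using assms by (auto simp: vmul_def Kmat_def)
qed

lemma Kmat_measurable:
  assumes "f \<in> borel_measurable M"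
  shows "(\<lambda>x. Kmat n (f x n)) \<in> borel_measurable M"
proof (rule borel_measurable_rmatI)
  fix i j
  have [measurable]: "(\<lambda>x. f x a b) \<in> borel_measurable M" for a b by (rule borel_measurable_entry[OF assms])
  show "(\<lambda>x. Kmat n (f x n) i j) \<in> borel_measurable M"
    unfolding Kmat_def by measurable
qed

lemma blk_SLZ: "\<gamma> \<in> SLZ n \<Longrightarrow> (\<And>i. t i \<in> \<int>) \<Longrightarrow> blk n \<gamma> t \<in> SLZ (Suc n)"
  by (auto simp: SLZ_def SLR_def det_blk) (auto simp: blk_def)

section \<open>The reduction set and its volume\<close>

abbreviation lebM :: "nat \<Rightarrow> rmat measure" where
  "lebM n \<equiv> MI ({..<n} \<times> {..<n})"

definition trunc :: "nat \<Rightarrow> rmat \<Rightarrow> rmat" where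
  "trunc n x = (\<lambda>i j. if i < n \<and> j < n then x i j else 0)"

lemma trunc_measurable:
  assumes "f \<in> borel_measurable M"
  shows "(\<lambda>x. trunc n (f x)) \<in> borel_measurable M"
proof (rule borel_measurable_rmatI)
  fix i j show "(\<lambda>x. trunc n (f x) i j) \<in> borel_measurable M"
    using borel_measurable_entry[OF assms, of i j] by (cases "i < n \<and> j < n") (simp_all add: trunc_def cong: conj_cong)
qed

text \<open>The condition on the upper rows after normalisation: the square block is reduced, and
  the last column is reduced modulo integers.\<close>

definition red_core :: "nat \<Rightarrow> rmat set \<Rightarrow> rmat set" where
  "red_core n R = {x. trunc n x \<in> R \<and> (\<forall>i<n. x i n \<in> {0..<1})}"

text \<open>Minkowski gives entries bounded by 2; the bound 4 leaves room for adding two of them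
  when the last entry has to be made nonzero.\<close>

definition red_step :: "nat \<Rightarrow> rmat set \<Rightarrow> rmat set" where
  "red_step n R = {x. (\<forall>j<Suc n. \<bar>x n j\<bar> \<le> 4) \<and> x n n \<noteq> 0 \<and> rmul (Suc n) (Kmat n (x n)) x \<in> red_core n R}"

lemma red_core_borel:
  assumes "R \<in> sets borel" shows "red_core n R \<in> sets borel"
proof -
  have [measurable]: "(\<lambda>x::rmat. x a b) \<in> borel_measurable borel" for a b
    using borel_measurable_entry[OF measurable_ident] by (simp add: id_def)
  have [measurable]: "trunc n \<in> borel \<rightarrow>\<^sub>M borel" by (rule trunc_measurable[OF measurable_ident[unfolded id_def]])
  note [measurable] = assms
  have "{x \<in> space borel. trunc n x \<in> R \<and> (\<forall>i<n. x i n \<in> {0..<1})} \<in> sets borel"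
    by measurable
  then show ?thesis by (simp add: red_core_def)
qed

lemma red_step_borel:
  assumes "R \<in> sets borel" shows "red_step n R \<in> sets borel"
proof -
  have [measurable]: "(\<lambda>x::rmat. x a b) \<in> borel_measurable borel" for a b
    using borel_measurable_entry[OF measurable_ident] by (simp add: id_def)
  have [measurable]: "(\<lambda>x. rmul (Suc n) (Kmat n (x n)) x) \<in> borel \<rightarrow>\<^sub>M borel"
    by (intro rmul_measurable Kmat_measurable measurable_ident[unfolded id_def])
  note [measurable] = red_core_borel[OF assms, of n]
  have "{x \<in> space borel. (\<forall>j<Suc n. \<bar>x n j\<bar> \<le> 4) \<and> x n n \<noteq> 0 \<and> rmul (Suc n) (Kmat n (x n)) x \<in> red_core n R} \<in> sets borel"
    by measurable
  then show ?thesis by (simp add: red_step_def)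
qed

text \<open>Fubini over the last column, which ranges over a unit cube of volume one.\<close>

lemma emeasure_red_core:
  assumes R: "R \<in> sets borel"
  shows "emeasure (MI ({..<n} \<times> {..<Suc n})) (red_core n R) \<le> emeasure (lebM n) R"
proof -
  let ?I = "{..<n} \<times> {..<n}" and ?J = "{..<n} \<times> {n}"
  define B where "B = {x::rmat. \<forall>p\<in>?J. x (fst p) (snd p) \<in> {0..<1::real}}"
  have B: "B \<in> sets borel" unfolding B_def by (rule box_borel) auto
  have U: "?I \<union> ?J = {..<n} \<times> {..<Suc n}" by (auto simp: less_Suc_eq)
  have [measurable]: "red_core n R \<in> sets borel" by (rule red_core_borel[OF R])
  note [measurable] = R B
  have "emeasure (MI (?I \<union> ?J)) (red_core n R) = (\<integral>\<^sup>+x. indicator (red_core n R) x \<partial>MI (?I \<union> ?J))" by simp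
  also have "\<dots> = (\<integral>\<^sup>+x. (\<integral>\<^sup>+y. indicator (red_core n R) (madd x y) \<partial>MI ?J) \<partial>MI ?I)"
    by (rule nn_integral_MI_union) auto
  also have "\<dots> = (\<integral>\<^sup>+x. indicator R x \<partial>MI ?I)"
  proof (rule nn_integral_MI_supp_cong)
    show "(\<lambda>x. \<integral>\<^sup>+y. indicator (red_core n R) (madd x y) \<partial>MI ?J) \<in> borel_measurable borel"
      by (rule borel_measurable_nn_integral_MI) auto
    fix x assume x: "supp ?I x"
    have "(\<integral>\<^sup>+y. indicator (red_core n R) (madd x y) \<partial>MI ?J) = (\<integral>\<^sup>+y. indicator R x * indicator B y \<partial>MI ?J)"
    proof (rule nn_integral_MI_supp_cong)
      fix y assume y: "supp ?J y"
      have "trunc n (madd x y) = x" using x y by (auto simp: trunc_def madd_def supp_def fun_eq_iff)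
      then show "indicator (red_core n R) (madd x y) = (indicator R x * indicator B y :: ennreal)"
        using x by (auto simp: indicator_def red_core_def madd_def supp_def B_def)
    qed measurable
    also have "\<dots> = indicator R x * emeasure (MI ?J) B"
      using B by (simp add: nn_integral_cmult)
    also have "emeasure (MI ?J) B = 1" unfolding B_def by (subst emeasure_MI_box) auto
    finally show "(\<integral>\<^sup>+y. indicator (red_core n R) (madd x y) \<partial>MI ?J) = indicator R x" by simp
  qed (use R in simp)
  finally show ?thesis using R by (simp add: U)
qed

text \<open>Fix the last row \<open>y\<close>. The slice is the preimage of
  \<open>red_core n R\<close> under right multiplication of the upper rows by
  \<open>Kmat n y\<close>, which preserves volume, so it has at most the volume of \<open>R\<close>.
  The last row itself ranges over a cube of side 8.\<close>

lemma emeasure_red_step: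
  assumes n: "n \<ge> 1" and R: "R \<in> sets borel" "emeasure (lebM n) R < \<infinity>"
  shows "emeasure (lebM (Suc n)) (red_step n R) < \<infinity>"
proof -
  let ?I = "{..<n} \<times> {..<Suc n}" and ?J = "{n} \<times> {..<Suc n}"
  define B where "B = {x::rmat. \<forall>p\<in>?J. x (fst p) (snd p) \<in> {-4..4::real}}"
  have B: "B \<in> sets borel" unfolding B_def by (rule box_borel) auto
  have U: "?J \<union> ?I = {..<Suc n} \<times> {..<Suc n}" by (auto simp: less_Suc_eq)
  have [measurable]: "red_core n R \<in> sets borel" "red_step n R \<in> sets borel"
    by (rule red_core_borel red_step_borel, rule R)+
  note [measurable] = B
  have "emeasure (MI (?J \<union> ?I)) (red_step n R) = (\<integral>\<^sup>+x. indicator (red_step n R) x \<partial>MI (?J \<union> ?I))" by simp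
  also have "\<dots> = (\<integral>\<^sup>+y. (\<integral>\<^sup>+x. indicator (red_step n R) (madd y x) \<partial>MI ?I) \<partial>MI ?J)"
    by (rule nn_integral_MI_union) auto
  also have "\<dots> \<le> (\<integral>\<^sup>+y. indicator B y * emeasure (lebM n) R \<partial>MI ?J)"
  proof -
    have m: "(\<lambda>y. \<integral>\<^sup>+x. indicator (red_step n R) (madd y x) \<partial>MI ?I) \<in> borel_measurable borel"
      by (rule borel_measurable_nn_integral_MI) auto
    have le: "(\<integral>\<^sup>+x. indicator (red_step n R) (madd y x) \<partial>MI ?I) \<le> indicator B y * emeasure (lebM n) R"
      if y: "supp ?J y" for y
    proof (cases "y \<in> B \<and> y n n \<noteq> 0")
      case False
      have "(\<integral>\<^sup>+x. indicator (red_step n R) (madd y x) \<partial>MI ?I) = (\<integral>\<^sup>+x. 0 \<partial>MI ?I)"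
      proof (rule nn_integral_MI_supp_cong)
        fix x assume x: "supp ?I x"
        have "madd y x n = y n" using x by (auto simp: madd_def supp_def)
        then show "indicator (red_step n R) (madd y x) = (0::ennreal)"
          using False by (auto simp: indicator_def red_step_def B_def abs_le_iff)
      qed measurable
      then show ?thesis by simp
    next
      case True
      define K where "K = Kmat n (y n)"
      have K: "K \<in> SLR (Suc n)" unfolding K_def by (rule Kmat_SLR) (use n True in auto)
      \<comment> \<open>On this slice the conditions on the last row hold, and membership in
        \<open>red_core\<close> looks at the upper rows only.\<close>
      have "(\<integral>\<^sup>+x. indicator (red_step n R) (madd y x) \<partial>MI ?I) = (\<integral>\<^sup>+x. indicator (red_core n R) (rmul (Suc n) K x) \<partial>MI ?I)"
      proof (rule nn_integral_MI_supp_cong)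
        fix x assume x: "supp ?I x"
        have e: "madd y x n = y n" using x by (auto simp: madd_def supp_def)
        have "madd y x i = x i" if "i < n" for i using y that by (auto simp: madd_def supp_def)
        then have "rmul (Suc n) K (madd y x) \<in> red_core n R \<longleftrightarrow> rmul (Suc n) K x \<in> red_core n R"
          by (auto simp: red_core_def rmul_def trunc_def cong: conj_cong if_cong)
        then show "indicator (red_step n R) (madd y x) = (indicator (red_core n R) (rmul (Suc n) K x) :: ennreal)"
          using True by (auto simp: indicator_def red_step_def e K_def[symmetric] B_def abs_le_iff minus_le_iff)
      qed measurable
      also have "\<dots> = emeasure (distr (MI ?I) borel (rmul (Suc n) K)) (red_core n R)"
        by (rule emeasure_distr_nn_integral[symmetric]) measurable
      also have "\<dots> = emeasure (MI ?I) (red_core n R)" using distr_rmul_MI[OF _ K, of "{..<n}"] by simp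
      also have "\<dots> \<le> emeasure (lebM n) R" by (rule emeasure_red_core[OF R(1)])
      finally show ?thesis using True by simp
    qed
    have mB: "(\<lambda>y. indicator B y * emeasure (lebM n) R) \<in> borel_measurable borel" by measurable
    show ?thesis
      unfolding nn_integral_MI[OF m, of ?J] nn_integral_MI[OF mB, of ?J] by (intro nn_integral_mono le) simp
  qed
  also have "\<dots> = emeasure (MI ?J) B * emeasure (lebM n) R"
    using B by (simp add: nn_integral_multc)
  also have "emeasure (MI ?J) B = 8 ^ Suc n"
    unfolding B_def by (subst emeasure_MI_box) (auto simp: card_cartesian_product)
  also have "8 ^ Suc n * emeasure (lebM n) R < \<infinity>"
    using R(2) by (simp add: ennreal_mult_less_top power_less_top_ennreal)
  finally show ?thesis by (simp only: U)
qed

text \<open>Multiplied by \<open>K\<close>, the matrix becomes a block matrix whose square block has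
  the same determinant, so the lower-dimensional reduction applies to the block. The lifted integral
  matrix \<open>\<delta>\<close> fixes the last row of \<open>M\<close>; hence \<open>K\<close>,
  which depends on that row only, also normalises the reduced matrix.\<close>

lemma red_step_reduces:
  assumes n: "n \<ge> 1"
    and R: "\<And>M. M \<in> mat_n n \<Longrightarrow> 0 < det_n n M \<Longrightarrow> det_n n M \<le> 1 \<Longrightarrow> \<exists>\<gamma>\<in>SLZ n. mmul n \<gamma> M \<in> R"
    and M: "M \<in> mat_n (Suc n)" "0 < det_n (Suc n) M" "det_n (Suc n) M \<le> 1"
    and v: "\<And>j. j < Suc n \<Longrightarrow> \<bar>M n j\<bar> \<le> 4" "M n n \<noteq> 0"
  shows "\<exists>\<gamma>\<in>SLZ (Suc n). mmul (Suc n) \<gamma> M \<in> red_step n R"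
proof -
  define K where "K = Kmat n (M n)"
  have K: "K \<in> SLR (Suc n)" unfolding K_def by (rule Kmat_SLR) (use n v in auto)
  define N where "N = mmul (Suc n) M K"
  have Nn: "N n = (\<lambda>j. if j = n then 1 else 0)"
    using vmul_Kmat[of "M n" n, OF v(2)] by (simp add: N_def K_def mmul_eq_vmul[OF M(1)])
  define M2 where "M2 = (\<lambda>i j. if i < n \<and> j < n then N i j else 0)"
  define u where "u = (\<lambda>i. N i n)"
  have Nb: "N = blk n M2 u" unfolding M2_def u_def by (rule eq_blkI) (auto simp: N_def[symmetric] Nn, simp add: N_def)
  have M2m: "M2 \<in> mat_n n" by (auto simp: M2_def mat_n_def)
  have "det_n n M2 = det_n (Suc n) M"
    using K det_blk[of n M2 u] by (simp add: Nb[symmetric] N_def det_mmul SLR_def)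
  then obtain \<gamma> where g: "\<gamma> \<in> SLZ n" "mmul n \<gamma> M2 \<in> R" using R[OF M2m] M by auto
  \<comment> \<open>The integral last column of \<open>\<delta>\<close> subtracts floors and brings
    the last column into \<open>[0, 1)\<close>.\<close>
  define t where "t = (\<lambda>i. - real_of_int \<lfloor>\<Sum>l<n. \<gamma> i l * u l\<rfloor>)"
  define \<delta> where "\<delta> = blk n \<gamma> t"
  have d: "\<delta> \<in> SLZ (Suc n)" unfolding \<delta>_def by (rule blk_SLZ[OF g(1)]) (simp add: t_def)
  have row: "mmul (Suc n) \<delta> M n = M n"
  proof
    fix j
    have "(\<Sum>l<n. blk n \<gamma> t n l * M l j) = 0" by (intro sum.neutral) (auto simp: blk_def)
    then show "mmul (Suc n) \<delta> M n j = M n j"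
      using M(1) by (auto simp: mmul_def \<delta>_def blk_def mat_n_def)
  qed
  have "rmul (Suc n) K (mmul (Suc n) \<delta> M) = mmul (Suc n) \<delta> N"
    by (simp add: rmul_eq_mmul N_def mmul_assoc)
  also have "\<dots> = blk n (mmul n \<gamma> M2) (\<lambda>i. (\<Sum>l<n. \<gamma> i l * u l) + t i)"
    by (simp add: Nb \<delta>_def mmul_blk)
  finally have eq: "rmul (Suc n) K (mmul (Suc n) \<delta> M) = blk n (mmul n \<gamma> M2) (\<lambda>i. (\<Sum>l<n. \<gamma> i l * u l) + t i)" .
  have "trunc n (blk n (mmul n \<gamma> M2) w) = mmul n \<gamma> M2" for w
    by (auto simp: trunc_def blk_def mmul_def fun_eq_iff)
  then have "rmul (Suc n) K (mmul (Suc n) \<delta> M) \<in> red_core n R"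
    unfolding eq using g(2) by (auto simp: red_core_def) (auto simp: blk_def t_def, linarith)
  then have "mmul (Suc n) \<delta> M \<in> red_step n R"
    using v by (simp add: red_step_def row K_def)
  then show ?thesis using d by blast
qed

text \<open>The range \<open>(0, 1]\<close> for the determinant gives the set room for a Lebesgue
  volume and is inherited by the block, whose determinant equals that of the full matrix.\<close>

lemma finite_volume_reduction_set:
  assumes "n \<ge> 1"
  shows "\<exists>R\<in>sets borel. emeasure (lebM n) R < \<infinity> \<and>
    (\<forall>M\<in>mat_n n. 0 < det_n n M \<longrightarrow> det_n n M \<le> 1 \<longrightarrow> (\<exists>\<gamma>\<in>SLZ n. mmul n \<gamma> M \<in> R))"
  using assms
proof (induction n rule: nat_induct_at_least)
  case base
  define R where "R = {x::rmat. \<forall>p\<in>{..<1} \<times> {..<1}. x (fst p) (snd p) \<in> {0..1::real}}"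
  have "R \<in> sets borel" unfolding R_def by (rule box_borel) auto
  moreover have "emeasure (lebM 1) R < \<infinity>" unfolding R_def by (subst emeasure_MI_box) auto
  moreover have "\<exists>\<gamma>\<in>SLZ 1. mmul 1 \<gamma> M \<in> R" if "M \<in> mat_n 1" "0 < det_n 1 M" "det_n 1 M \<le> 1" for M
    using that det_n_1[of M] by (intro bexI[of _ "idn 1"]) (auto simp: mmul_idn_left R_def)
  ultimately show ?case by blast
next
  case (Suc n)
  then obtain R where R: "R \<in> sets borel" "emeasure (lebM n) R < \<infinity>"
    "\<And>M. M \<in> mat_n n \<Longrightarrow> 0 < det_n n M \<Longrightarrow> det_n n M \<le> 1 \<Longrightarrow> \<exists>\<gamma>\<in>SLZ n. mmul n \<gamma> M \<in> R" by blast
  let ?N = "Suc n"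
  \<comment> \<open>The reduction step needs a nonzero last entry. \<open>E i\<close> adds column
    \<open>i\<close> to the last column; the finitely many preimages of \<open>red_step n R\<close>
    all have the same volume and together cover every case, with \<open>E n\<close> the
    identity.\<close>
  define E where "E i = (if i < n then transvec ?N i (\<lambda>b. if b = n then 1 else 0) else idn ?N)" for i
  have E: "E i \<in> SLR ?N" for i by (auto simp: E_def intro!: transvec_SLR)
  define Q where "Q = (\<Union>i\<le>n. rmul ?N (E i) -` red_step n R)"
  have Qm: "rmul ?N (E i) -` red_step n R \<in> sets borel" for i
    using measurable_sets[OF _ red_step_borel[OF R(1), of n], of "rmul ?N (E i)" borel] by simp
  have Qe: "emeasure (lebM ?N) (rmul ?N (E i) -` red_step n R) = emeasure (lebM ?N) (red_step n R)" for i
    using arg_cong[OF distr_rmul_MI[OF _ E, of "{..<?N}" i], of "\<lambda>M. emeasure M (red_step n R)"] red_step_borel[OF R(1), of n]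
    by (simp add: emeasure_distr)
  have "emeasure (lebM ?N) Q \<le> (\<Sum>i\<le>n. emeasure (lebM ?N) (rmul ?N (E i) -` red_step n R))"
    unfolding Q_def by (rule emeasure_subadditive_finite) (auto simp: Qm)
  also have "\<dots> < \<infinity>" unfolding Qe using emeasure_red_step[OF Suc.hyps(1) R(1,2)] by (simp add: ennreal_mult_less_top of_nat_less_top)
  finally have Qf: "emeasure (lebM ?N) Q < \<infinity>" .
  have "\<exists>\<gamma>\<in>SLZ ?N. mmul ?N \<gamma> M \<in> Q" if M: "M \<in> mat_n ?N" "0 < det_n ?N M" "det_n ?N M \<le> 1" for M
  proof -
    obtain \<gamma> where g: "\<gamma> \<in> SLZ ?N" "\<And>j. j < ?N \<Longrightarrow> \<bar>mmul ?N \<gamma> M n j\<bar> \<le> 2"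
      using exists_small_last_row[OF _ M] by auto
    define M1 where "M1 = mmul ?N \<gamma> M"
    have d1: "det_n ?N M1 = det_n ?N M" using g(1) by (simp add: M1_def det_mmul SLZ_def SLR_def)
    have "\<exists>i\<le>n. M1 n i \<noteq> 0"
    proof (rule ccontr)
      assume z: "\<not> (\<exists>i\<le>n. M1 n i \<noteq> 0)"
      have "Determinant.det (tomat ?N M1) = (\<Sum>j<?N. tomat ?N M1 $$ (n, j) * cofactor (tomat ?N M1) n j)"
        by (rule laplace_expansion_row) auto
      also have "\<dots> = 0" using z by (intro sum.neutral) (auto simp: less_Suc_eq_le)
      finally show False using d1 M by (simp add: det_tomat)
    qed
    then have "\<exists>i. i \<le> n \<and> M1 n i \<noteq> 0 \<and> (i < n \<longrightarrow> M1 n n = 0)" by (cases "M1 n n = 0") auto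
    then obtain i where i: "i \<le> n" "M1 n i \<noteq> 0" "i < n \<Longrightarrow> M1 n n = 0" by blast
    define M2 where "M2 = mmul ?N M1 (E i)"
    have M2n: "M2 n j = (if j < ?N then (if j = n \<and> i < n then M1 n n + M1 n i else M1 n j) else 0)" for j
    proof -
      have "M2 n = vmul ?N (M1 n) (E i)" unfolding M2_def by (subst mmul_eq_vmul) (simp_all add: M1_def)
      moreover have "M1 n \<in> vec_n ?N" by (auto simp: vec_n_def M1_def mmul_def)
      ultimately show ?thesis by (auto simp: E_def vmul_transvec vmul_idn vec_n_def)
    qed
    have "\<bar>M2 n j\<bar> \<le> 4" if "j < ?N" for j
      using g(2)[of j] g(2)[of n] g(2)[of i] that i(1) by (auto simp: M2n M1_def[symmetric])
    moreover have "M2 n n \<noteq> 0" using i by (auto simp: M2n)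
    moreover have "det_n ?N M2 = det_n ?N M" using d1 E[of i] by (simp add: M2_def det_mmul SLR_def)
    ultimately obtain \<delta> where d: "\<delta> \<in> SLZ ?N" "mmul ?N \<delta> M2 \<in> red_step n R"
      using red_step_reduces[OF Suc.hyps(1) R(3), of M2] M by (auto simp: M2_def)
    have "rmul ?N (E i) (mmul ?N (mmul ?N \<delta> \<gamma>) M) = mmul ?N \<delta> M2"
      by (simp add: rmul_eq_mmul M2_def M1_def mmul_assoc)
    then have "mmul ?N (mmul ?N \<delta> \<gamma>) M \<in> Q" unfolding Q_def using d(2) i(1) by (intro UN_I[of i]) auto
    then show ?thesis using mmul_SLZ[OF d(1) g(1)] by blast
  qed
  moreover have "Q \<in> sets borel" unfolding Q_def using Qm by (intro sets.finite_UN) auto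
  ultimately show ?case using Qf by blast
qed

section \<open>The quotient space and fundamental domains\<close>

lemma continuous_on_rmatI:
  fixes f :: "'a::topological_space \<Rightarrow> rmat"
  assumes "\<And>i j. continuous_on S (\<lambda>x. f x i j)"
  shows "continuous_on S f"
  by (rule continuous_on_coordinatewise_then_product, rule continuous_on_coordinatewise_then_product, rule assms)

lemma continuous_on_mmul: "continuous_on UNIV (mmul n \<gamma>)"
proof (rule continuous_on_rmatI)
  fix i j
  have "continuous_on UNIV (\<lambda>x. \<Sum>l<n. \<gamma> i l * (x::rmat) l j)"
    by (intro continuous_on_sum continuous_on_mult continuous_on_const continuous_on_rmat_entry)
  then show "continuous_on UNIV (\<lambda>x. mmul n \<gamma> x i j)"
    by (cases "i < n \<and> j < n") (simp_all add: mmul_def cong: conj_cong)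
qed

lemma rmat_entry_measurable [measurable]: "(\<lambda>x::rmat. x a b) \<in> borel_measurable borel"
  using borel_measurable_entry[OF measurable_ident] by (simp add: id_def)

lemma SLR_borel [measurable]: "SLR n \<in> sets borel"
proof -
  have [measurable]: "(\<lambda>g. det_n n g) \<in> borel_measurable borel" by (rule det_n_measurable) measurable
  have "{g \<in> space borel. (\<forall>i j. (n \<le> i \<or> n \<le> j) \<longrightarrow> (g::rmat) i j = 0) \<and> det_n n g = 1} \<in> sets borel"
    by measurable
  then show ?thesis by (simp add: SLR_def mat_n_def)
qed

text \<open>Near \<open>g\<close> the vector \<open>w\<close> is controlled by \<open>w h\<close>
  with a uniform constant: \<open>C0\<close> exceeds the size of the inverse of \<open>g\<close>,
  and for \<open>h\<close> within \<open>1 / (2 C0)\<close> of \<open>g\<close> the error is at most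
  half of the left-hand side, where it is absorbed. This is the source of all local finiteness
  below.\<close>

lemma SLR_local_bound:
  assumes "g \<in> SLR n"
  obtains U C where "open U" "g \<in> U" "C > 0"
    "\<And>h w. h \<in> U \<Longrightarrow> w \<in> vec_n n \<Longrightarrow> (\<Sum>i<n. \<bar>w i\<bar>) \<le> C * (\<Sum>i<n. \<bar>vmul n w h i\<bar>)"
proof -
  define C0 where "C0 = (\<Sum>j<n. \<Sum>i<n. \<bar>minv n g j i\<bar>) + 1"
  have C0: "C0 \<ge> 1" by (auto simp: C0_def intro!: sum_nonneg)
  have op: "(\<Sum>i<n. \<bar>vmul n w a i\<bar>) \<le> (\<Sum>j<n. \<Sum>i<n. \<bar>a j i\<bar>) * (\<Sum>j<n. \<bar>w j\<bar>)" for w a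
  proof -
    have "(\<Sum>i<n. \<bar>vmul n w a i\<bar>) \<le> (\<Sum>i<n. \<Sum>j<n. \<bar>w j\<bar> * \<bar>a j i\<bar>)"
    proof (intro sum_mono)
      fix i assume "i \<in> {..<n}"
      then show "\<bar>vmul n w a i\<bar> \<le> (\<Sum>j<n. \<bar>w j\<bar> * \<bar>a j i\<bar>)"
        using sum_abs[of "\<lambda>j. w j * a j i" "{..<n}"] by (simp add: vmul_def abs_mult)
    qed
    also have "\<dots> = (\<Sum>j<n. \<bar>w j\<bar> * (\<Sum>i<n. \<bar>a j i\<bar>))" by (subst sum.swap) (simp add: sum_distrib_left)
    also have "\<dots> \<le> (\<Sum>j<n. \<bar>w j\<bar> * (\<Sum>j<n. \<Sum>i<n. \<bar>a j i\<bar>))"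
      by (intro sum_mono mult_left_mono member_le_sum[of _ _ "\<lambda>j. \<Sum>i<n. \<bar>a j i\<bar>"]) (auto intro: sum_nonneg)
    finally show ?thesis by (simp add: sum_distrib_right[symmetric] mult.commute)
  qed
  define U where "U = {h::rmat. (\<Sum>j<n. \<Sum>i<n. \<bar>h j i - g j i\<bar>) < inverse (2 * C0)}"
  have "open U" unfolding U_def
    by (intro open_Collect_less continuous_on_sum continuous_on_rabs continuous_on_diff continuous_on_const continuous_on_rmat_entry)
  moreover have "g \<in> U" using C0 by (simp add: U_def)
  moreover have "(\<Sum>i<n. \<bar>w i\<bar>) \<le> 2 * C0 * (\<Sum>i<n. \<bar>vmul n w h i\<bar>)" if h: "h \<in> U" and w: "w \<in> vec_n n" for h w
  proof -
    let ?N = "\<lambda>w. \<Sum>i<n. \<bar>w i\<bar>"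
    have "?N w = ?N (vmul n (vmul n w g) (minv n g))" by (simp add: vmul_cancel[OF assms w])
    also have "\<dots> \<le> (C0 - 1) * ?N (vmul n w g)" using op[of "vmul n w g" "minv n g"] by (simp add: C0_def)
    also have "\<dots> \<le> C0 * ?N (vmul n w g)" by (intro mult_right_mono sum_nonneg) auto
    also have "?N (vmul n w g) \<le> ?N (vmul n w h) + ?N (vmul n w (\<lambda>j i. h j i - g j i))"
      unfolding sum.distrib[symmetric]
    proof (intro sum_mono)
      fix i assume "i \<in> {..<n}"
      then have "vmul n w g i = vmul n w h i - vmul n w (\<lambda>j i. h j i - g j i) i"
        by (simp add: vmul_def sum_subtractf[symmetric] algebra_simps)
      then show "\<bar>vmul n w g i\<bar> \<le> \<bar>vmul n w h i\<bar> + \<bar>vmul n w (\<lambda>j i. h j i - g j i) i\<bar>" by linarith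
    qed
    also have "?N (vmul n w (\<lambda>j i. h j i - g j i)) \<le> inverse (2 * C0) * ?N w"
      using op[of w "\<lambda>j i. h j i - g j i"] h
      by (elim order_trans) (intro mult_right_mono, auto simp: U_def intro: sum_nonneg)
    finally have "?N w \<le> C0 * (?N (vmul n w h) + inverse (2 * C0) * ?N w)" using C0 by auto
    also have "\<dots> = C0 * ?N (vmul n w h) + ?N w / 2" using C0 by (simp add: field_simps)
    finally show ?thesis by simp
  qed
  ultimately show ?thesis using C0 by (intro that[of U "2 * C0"]) auto
qed

text \<open>Within SL(n, R) such a set meets each orbit at most once, so \<open>coset n\<close> is
  injective on it.\<close>

definition good_open :: "nat \<Rightarrow> rmat set \<Rightarrow> bool" where
  "good_open n U \<longleftrightarrow> open U \<and> (\<forall>h \<in> U \<inter> SLR n. \<forall>\<gamma>\<in>SLZ n. mmul n \<gamma> h \<in> U \<longrightarrow> \<gamma> = idn n)"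

text \<open>If \<open>h\<close> and \<open>\<gamma> h\<close> are both close to \<open>g\<close>,
  each row of \<open>\<gamma> - 1\<close> has a small product with \<open>h\<close>. By the local
  bound the row has absolute sum below 1, and an integral row of this kind vanishes.\<close>

lemma exists_good_open:
  assumes g: "g \<in> SLR n"
  shows "\<exists>U. good_open n U \<and> g \<in> U"
proof -
  obtain U C where U: "open U" "g \<in> U" "C > 0"
    "\<And>h w. h \<in> U \<Longrightarrow> w \<in> vec_n n \<Longrightarrow> (\<Sum>i<n. \<bar>w i\<bar>) \<le> C * (\<Sum>i<n. \<bar>vmul n w h i\<bar>)"
    using SLR_local_bound[OF g] by metis
  define V where "V = U \<inter> {h. (\<Sum>j<n. \<Sum>i<n. \<bar>h j i - g j i\<bar>) < inverse (2 * C)}"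
  have "open {h::rmat. (\<Sum>j<n. \<Sum>i<n. \<bar>h j i - g j i\<bar>) < inverse (2 * C)}"
    by (intro open_Collect_less continuous_on_sum continuous_on_rabs continuous_on_diff continuous_on_const continuous_on_rmat_entry)
  then have "open V" using U by (auto simp: V_def)
  moreover have "g \<in> V" using U by (simp add: V_def)
  moreover have "\<gamma> = idn n" if h: "h \<in> V" "h \<in> SLR n" and \<gamma>: "\<gamma> \<in> SLZ n" "mmul n \<gamma> h \<in> V" for h \<gamma>
  proof (intro ext)
    fix a b
    show "\<gamma> a b = idn n a b"
    proof (cases "a < n \<and> b < n")
      case False then show ?thesis using \<gamma>(1) by (auto simp: SLZ_def SLR_def mat_n_def idn_def not_less)
    next
      case True
      define w where "w = (\<lambda>b. \<gamma> a b - idn n a b)"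
      have w: "w \<in> vec_n n" using \<gamma>(1) by (auto simp: w_def vec_n_def SLZ_def SLR_def mat_n_def idn_def)
      have row: "(\<Sum>i<n. \<bar>x a i - g a i\<bar>) < inverse (2 * C)" if "x \<in> V" for x
      proof -
        have "(\<Sum>i<n. \<bar>x a i - g a i\<bar>) \<le> (\<Sum>j<n. \<Sum>i<n. \<bar>x j i - g j i\<bar>)"
          using True by (intro member_le_sum[of a _ "\<lambda>j. \<Sum>i<n. \<bar>x j i - g j i\<bar>"]) (auto intro: sum_nonneg)
        also have "\<dots> < inverse (2 * C)" using that by (simp add: V_def)
        finally show ?thesis .
      qed
      have "vmul n w h i = mmul n \<gamma> h a i - h a i" if "i < n" for i
      proof -
        have "mmul n (idn n) h a i = h a i" using h(2) by (simp add: mmul_idn_left SLR_mat_n)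
        then show ?thesis using that True
          by (simp add: vmul_def mmul_def w_def algebra_simps sum_subtractf)
      qed
      then have "(\<Sum>i<n. \<bar>vmul n w h i\<bar>) = (\<Sum>i<n. \<bar>mmul n \<gamma> h a i - h a i\<bar>)" by simp
      also have "\<dots> \<le> (\<Sum>i<n. \<bar>mmul n \<gamma> h a i - g a i\<bar> + \<bar>h a i - g a i\<bar>)" by (intro sum_mono) auto
      also have "\<dots> < inverse (2 * C) + inverse (2 * C)"
        unfolding sum.distrib by (intro add_strict_mono row h \<gamma>)
      also have "\<dots> = inverse C" using U(3) by (simp add: field_simps)
      finally have "C * (\<Sum>i<n. \<bar>vmul n w h i\<bar>) < 1" using U(3) by (simp add: field_simps)
      then have "(\<Sum>i<n. \<bar>w i\<bar>) < 1" using U(4)[OF _ w, of h] h by (auto simp: V_def)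
      moreover have "\<bar>w b\<bar> \<le> (\<Sum>i<n. \<bar>w i\<bar>)" using True by (intro member_le_sum[of b _ "\<lambda>i. \<bar>w i\<bar>"]) auto
      ultimately have "\<bar>w b\<bar> < 1" by simp
      moreover have "w b \<in> \<int>" using \<gamma>(1) by (auto simp: w_def SLZ_def idn_def)
      ultimately have "w b = 0" using Ints_nonzero_abs_ge1[of "w b"] by auto
      then show ?thesis by (simp add: w_def)
    qed
  qed
  ultimately show ?thesis unfolding good_open_def by blast
qed

lemma good_open_cover:
  "\<exists>U :: nat \<Rightarrow> rmat set. (\<forall>i. good_open n (U i)) \<and> SLR n \<subseteq> (\<Union>i. U i)"
proof -
  obtain F where F: "F \<subseteq> {U. good_open n U}" "countable F" "\<Union>F = \<Union>{U. good_open n U}"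
    using Lindelof[of "{U. good_open n U}"] by (auto simp: good_open_def)
  \<comment> \<open>The empty set keeps the countable family nonempty, so that it can be listed by
    natural numbers.\<close>
  have "good_open n {}" by (simp add: good_open_def)
  then have "\<exists>f::nat \<Rightarrow> rmat set. insert {} F = range f"
    using F(2) by (metis countable_insert insert_not_empty range_from_nat_into)
  then obtain f :: "nat \<Rightarrow> rmat set" where f: "insert {} F = range f" by blast
  have "good_open n (f i)" for i
    using f F(1) \<open>good_open n {}\<close> by (metis insertE mem_Collect_eq rangeI subsetD)
  moreover have "SLR n \<subseteq> (\<Union>i. f i)"
  proof
    fix g assume "g \<in> SLR n"
    then have "g \<in> \<Union>F" using exists_good_open F(3) by blast
    then have "g \<in> \<Union>(insert {} F)" by simp
    then show "g \<in> (\<Union>i. f i)" unfolding f .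
  qed
  ultimately show ?thesis by blast
qed

section \<open>Cosets, quotient topology and Borel sets\<close>

lemma mem_coset:
  assumes "g \<in> SLR n" "h \<in> coset n g"
  shows "h \<in> SLR n" "coset n h = coset n g"
proof -
  obtain \<gamma> where \<gamma>: "\<gamma> \<in> SLZ n" "h = mmul n \<gamma> g" using assms(2) by (auto simp: coset_def)
  show "h \<in> SLR n" using \<gamma> assms by (simp add: mmul_SLR SLZ_SLR)
  have "coset n h \<subseteq> coset n g"
    using \<gamma> by (auto simp: coset_def mmul_assoc[symmetric] intro!: imageI mmul_SLZ)
  moreover have "mmul n \<delta> g \<in> coset n h" if "\<delta> \<in> SLZ n" for \<delta>
  proof -
    have "mmul n \<delta> g = mmul n (mmul n \<delta> (minv n \<gamma>)) h"
      using \<gamma> assms by (simp add: mmul_assoc mmul_cancel_left SLZ_SLR SLR_mat_n)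
    then show ?thesis using that \<gamma> by (auto simp: coset_def intro!: imageI mmul_SLZ minv_SLZ)
  qed
  ultimately show "coset n h = coset n g" by (auto simp: coset_def)
qed

lemma self_in_coset: "g \<in> SLR n \<Longrightarrow> g \<in> coset n g"
  unfolding coset_def by (rule image_eqI[of _ _ "idn n"]) (auto simp: mmul_idn_left SLR_mat_n)

lemma coset_mmul: "g \<in> SLR n \<Longrightarrow> \<gamma> \<in> SLZ n \<Longrightarrow> coset n (mmul n \<gamma> g) = coset n g"
  by (rule mem_coset(2)) (auto simp: coset_def)

lemma Xsp_mem:
  assumes "x \<in> Xsp n" "g \<in> x" shows "g \<in> SLR n" "x = coset n g"
proof -
  obtain h where "h \<in> SLR n" "x = coset n h" using assms(1) by (auto simp: Xsp_def)
  then show "g \<in> SLR n" "x = coset n g" using mem_coset[of h n g] assms(2) by simp_all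
qed

lemma Union_Xsp:
  assumes "E \<subseteq> Xsp n" shows "\<Union>E = {g \<in> SLR n. coset n g \<in> E}"
proof (intro equalityI subsetI)
  fix g assume "g \<in> \<Union>E"
  then obtain x where x: "x \<in> E" "g \<in> x" by blast
  then have "g \<in> SLR n" "x = coset n g" using Xsp_mem[of x n g] assms by auto
  then show "g \<in> {g \<in> SLR n. coset n g \<in> E}" using x by simp
next
  fix g assume "g \<in> {g \<in> SLR n. coset n g \<in> E}"
  then show "g \<in> \<Union>E" using self_in_coset[of g n] by blast
qed

lemma coset_image_Union: "E \<subseteq> Xsp n \<Longrightarrow> coset n ` \<Union>E = E"
  using Union_Xsp[of E n] by (auto simp: Xsp_def)

lemma Union_coset_image: "B \<subseteq> SLR n \<Longrightarrow> \<Union>(coset n ` B) = {g \<in> SLR n. \<exists>\<gamma>\<in>SLZ n. mmul n \<gamma> g \<in> B}"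
proof (intro equalityI subsetI)
  fix g assume B: "B \<subseteq> SLR n" and "g \<in> \<Union>(coset n ` B)"
  then obtain b where b: "b \<in> B" "g \<in> coset n b" by auto
  then have "b \<in> coset n g" "g \<in> SLR n" using B mem_coset[of b n g] self_in_coset[of b n] by auto
  then show "g \<in> {g \<in> SLR n. \<exists>\<gamma>\<in>SLZ n. mmul n \<gamma> g \<in> B}" using b by (auto simp: coset_def)
next
  fix g assume "g \<in> {g \<in> SLR n. \<exists>\<gamma>\<in>SLZ n. mmul n \<gamma> g \<in> B}"
  then obtain \<gamma> where "g \<in> SLR n" "\<gamma> \<in> SLZ n" "mmul n \<gamma> g \<in> B" by auto
  then show "g \<in> \<Union>(coset n ` B)" using coset_mmul[of g n \<gamma>] self_in_coset[of g n] by blast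
qed

text \<open>The generating sets already form a topology: unions of cosets commute with intersections
  because cosets are disjoint or equal. So \<open>Xtop\<close> is the quotient topology.\<close>

lemma openin_Xtop:
  assumes "openin (Xtop n) E"
  shows "E \<subseteq> Xsp n \<and> openin (subtopology euclidean (SLR n)) (\<Union>E)"
proof -
  have "generate_topology_on {E. E \<subseteq> Xsp n \<and> openin (subtopology euclidean (SLR n)) (\<Union>E)} E"
    using assms unfolding Xtop_def by (rule openin_topology_generated_by)
  then show ?thesis
  proof induction
    case (Int a b)
    then have "\<Union>(a \<inter> b) = \<Union>a \<inter> \<Union>b" using Union_Xsp[of a n] Union_Xsp[of b n] Union_Xsp[of "a \<inter> b" n] by auto
    then show ?case using Int by (auto simp: openin_Int)
  next
    case (UN K)
    have "\<Union>(\<Union>K) = \<Union>((\<lambda>E. \<Union>E) ` K)" by auto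
    moreover have "openin (subtopology euclidean (SLR n)) (\<Union>((\<lambda>E. \<Union>E) ` K))"
      using UN by (intro openin_Union) auto
    moreover have "\<Union>K \<subseteq> Xsp n" using UN by blast
    ultimately show ?case by simp
  qed auto
qed

lemma openin_XtopI: "E \<subseteq> Xsp n \<Longrightarrow> openin (subtopology euclidean (SLR n)) (\<Union>E) \<Longrightarrow> openin (Xtop n) E"
  unfolding Xtop_def by (rule topology_generated_by_Basis) simp

text \<open>The projection is open, since the saturation of \<open>V\<close> is a union of preimages
  of \<open>V\<close> under left multiplications.\<close>

lemma openin_coset_image:
  assumes "open V" shows "openin (Xtop n) (coset n ` (V \<inter> SLR n))"
proof (rule openin_XtopI)
  show "coset n ` (V \<inter> SLR n) \<subseteq> Xsp n" by (auto simp: Xsp_def)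
  have "\<Union>(coset n ` (V \<inter> SLR n)) = SLR n \<inter> (\<Union>\<gamma>\<in>SLZ n. mmul n \<gamma> -` V)"
    by (subst Union_coset_image) (auto intro: mmul_SLR SLZ_SLR)
  moreover have "open (\<Union>\<gamma>\<in>SLZ n. mmul n \<gamma> -` V)"
    using assms continuous_on_mmul by (intro open_UN ballI open_vimage)
  ultimately show "openin (subtopology euclidean (SLR n)) (\<Union>(coset n ` (V \<inter> SLR n)))"
    by (auto simp: openin_open)
qed

lemma space_Xborel [simp]: "space (Xborel n) = Xsp n"
  by (simp add: Xborel_def space_measure_of_conv)

lemma coset_measurable: "coset n \<in> restrict_space borel (SLR n) \<rightarrow>\<^sub>M Xborel n"
  unfolding Xborel_def
proof (rule measurable_measure_of)
  fix E assume "E \<in> {E. E \<subseteq> Xsp n \<and> openin (Xtop n) E}"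
  then have "openin (subtopology euclidean (SLR n)) (\<Union>E)" "E \<subseteq> Xsp n" using openin_Xtop by auto
  then have "\<Union>E \<in> sets borel" by (auto simp: openin_open intro: borel_open)
  moreover have "coset n -` E \<inter> space (restrict_space borel (SLR n)) = \<Union>E"
    using \<open>E \<subseteq> Xsp n\<close> by (auto simp: Union_Xsp space_restrict_space)
  ultimately show "coset n -` E \<inter> space (restrict_space borel (SLR n)) \<in> sets (restrict_space borel (SLR n))"
    using \<open>E \<subseteq> Xsp n\<close> by (auto simp: sets_restrict_space_iff Union_Xsp)
qed (auto simp: Xsp_def space_restrict_space)

lemma Union_Xborel:
  assumes "E \<in> sets (Xborel n)" shows "E \<subseteq> Xsp n" "\<Union>E \<in> sets borel"
proof -
  show E: "E \<subseteq> Xsp n" using sets.sets_into_space[OF assms] by simp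
  have "coset n -` E \<inter> SLR n \<in> sets (restrict_space borel (SLR n))"
    using measurable_sets[OF coset_measurable assms] by (simp add: space_restrict_space)
  then have "coset n -` E \<inter> SLR n \<in> sets borel" by (auto simp: sets_restrict_space_iff)
  also have "coset n -` E \<inter> SLR n = \<Union>E" using E by (auto simp: Union_Xsp)
  finally show "\<Union>E \<in> sets borel" .
qed

lemma openin_Xborel: "openin (Xtop n) E \<Longrightarrow> E \<in> sets (Xborel n)"
proof -
  assume E: "openin (Xtop n) E"
  let ?S = "{E. E \<subseteq> Xsp n \<and> openin (Xtop n) E}"
  have "E \<in> ?S" using E openin_Xtop[OF E] by blast
  moreover have "?S \<subseteq> Pow (Xsp n)" by blast
  ultimately show ?thesis unfolding Xborel_def by (metis sets_measure_of sigma_sets.Basic)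
qed

text \<open>Induction over the Borel sets. Images respect unions, and they respect complements
  inside \<open>U\<close> because \<open>coset n\<close> is injective there.\<close>

lemma coset_image_good_open:
  assumes U: "good_open n U" and B: "B \<in> sets borel"
  shows "coset n ` (B \<inter> U \<inter> SLR n) \<in> sets (Xborel n)"
proof -
  have "B \<in> sigma_sets UNIV {S. open S}" using B by (simp add: sets_borel)
  then show ?thesis
  proof induction
    case (Basic V)
    then have "openin (Xtop n) (coset n ` ((V \<inter> U) \<inter> SLR n))"
      using U by (intro openin_coset_image) (auto simp: good_open_def)
    then show ?case by (rule openin_Xborel)
  next
    case Empty show ?case by simp
  next
    case (Compl B)
    have "openin (Xtop n) (coset n ` (U \<inter> SLR n))" using U by (intro openin_coset_image) (auto simp: good_open_def)
    then have "coset n ` (U \<inter> SLR n) - coset n ` (B \<inter> U \<inter> SLR n) \<in> sets (Xborel n)"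
      by (intro sets.Diff[OF openin_Xborel Compl.IH])
    also have "coset n ` (U \<inter> SLR n) - coset n ` (B \<inter> U \<inter> SLR n) = coset n ` ((UNIV - B) \<inter> U \<inter> SLR n)"
    proof -
      have "g = h" if "g \<in> U" "g \<in> SLR n" "h \<in> U" "h \<in> SLR n" "coset n g = coset n h" for g h
      proof -
        have "g \<in> coset n h" using self_in_coset[OF that(2)] that by simp
        then obtain \<gamma> where \<gamma>: "\<gamma> \<in> SLZ n" "g = mmul n \<gamma> h" by (auto simp: coset_def)
        then have "\<gamma> = idn n" using U that unfolding good_open_def by blast
        then show ?thesis using \<gamma> that by (simp add: mmul_idn_left SLR_mat_n)
      qed
      then have inj: "inj_on (coset n) (U \<inter> SLR n)" by (auto intro!: inj_onI)
      have "(UNIV - B) \<inter> U \<inter> SLR n = U \<inter> SLR n - B \<inter> U \<inter> SLR n" by blast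
      then show ?thesis using inj_on_image_set_diff[OF inj, of "U \<inter> SLR n" "B \<inter> U \<inter> SLR n"] by auto
    qed
    finally show ?case .
  next
    case (Union A)
    have "coset n ` ((\<Union>i. A i) \<inter> U \<inter> SLR n) = (\<Union>i. coset n ` (A i \<inter> U \<inter> SLR n))" by auto
    then show ?case using Union.IH by auto
  qed
qed

lemma coset_image_Xborel:
  assumes B: "B \<in> sets borel" "B \<subseteq> SLR n"
  shows "coset n ` B \<in> sets (Xborel n)"
proof -
  obtain U :: "nat \<Rightarrow> rmat set" where U': "\<forall>i. good_open n (U i)" and U2: "SLR n \<subseteq> (\<Union>i. U i)"
    using good_open_cover[of n] by (elim exE conjE)
  have U1: "good_open n (U i)" for i using U' by simp
  note U = U1 U2
  have "coset n ` B = (\<Union>i::nat. coset n ` (B \<inter> U i \<inter> SLR n))"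
  proof -
    have "B = (\<Union>i. B \<inter> U i \<inter> SLR n)" using B(2) U(2) by blast
    then show ?thesis by (metis image_UN)
  qed
  then show ?thesis using coset_image_good_open[OF U(1) B(1)] by auto
qed

text \<open>Measurability on the quotient becomes measurability of a saturated set of matrices. One
  direction is measurability of \<open>coset n\<close>; the other recovers \<open>E\<close> as the
  image of its union.\<close>

lemma Xborel_iff: "E \<in> sets (Xborel n) \<longleftrightarrow> E \<subseteq> Xsp n \<and> \<Union>E \<in> sets borel"
proof
  assume E: "E \<subseteq> Xsp n \<and> \<Union>E \<in> sets borel"
  moreover have "\<Union>E \<subseteq> SLR n" using E Union_Xsp[of E n] by blast
  ultimately have "coset n ` \<Union>E \<in> sets (Xborel n)" by (intro coset_image_Xborel) auto
  then show "E \<in> sets (Xborel n)" using E by (simp add: coset_image_Union)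
qed (use Union_Xborel in blast)

lemma Xborel_CollectI:
  assumes "\<And>g. g \<in> SLR n \<Longrightarrow> P (coset n g) \<longleftrightarrow> Q g" "{g \<in> SLR n. Q g} \<in> sets borel"
  shows "{x \<in> Xsp n. P x} \<in> sets (Xborel n)"
proof -
  have "\<Union>{x \<in> Xsp n. P x} = {g \<in> SLR n. Q g}"
    using assms(1) by (subst Union_Xsp) (auto simp: Xsp_def)
  then show ?thesis using assms(2) unfolding Xborel_iff by simp
qed

section \<open>Fundamental domains and Borel sections\<close>

definition fund_dom :: "nat \<Rightarrow> rmat set \<Rightarrow> bool" where
  "fund_dom n F \<longleftrightarrow> F \<in> sets borel \<and> F \<subseteq> SLR n \<and> (\<forall>g\<in>SLR n. \<exists>!\<gamma>. \<gamma> \<in> SLZ n \<and> mmul n \<gamma> g \<in> F)"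

lemma fund_dom_exists:
  assumes "fund_dom n F" "g \<in> SLR n" shows "\<exists>\<gamma>\<in>SLZ n. mmul n \<gamma> g \<in> F"
proof -
  have "\<exists>!\<gamma>. \<gamma> \<in> SLZ n \<and> mmul n \<gamma> g \<in> F" using assms by (simp add: fund_dom_def)
  from ex1_implies_ex[OF this] show ?thesis by (simp add: Bex_def)
qed

lemma fund_dom_inj:
  assumes "fund_dom n F" "g \<in> SLR n" "\<gamma> \<in> SLZ n" "\<delta> \<in> SLZ n" "mmul n \<gamma> g \<in> F" "mmul n \<delta> g \<in> F"
  shows "\<gamma> = \<delta>"
proof -
  have "\<exists>!\<gamma>. \<gamma> \<in> SLZ n \<and> mmul n \<gamma> g \<in> F" using assms by (simp add: fund_dom_def)
  then show ?thesis by (rule ex1E) (metis assms(3-6))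
qed

text \<open>List the good open sets and let \<open>F i\<close> be the points of \<open>U i\<close>
  whose orbit misses all earlier ones. An orbit is represented in the first \<open>U i\<close> that
  it meets, and exactly once because \<open>U i\<close> is good.\<close>

lemma exists_fund_dom: "\<exists>F. fund_dom n F"
proof -
  obtain U :: "nat \<Rightarrow> rmat set" where U': "\<forall>i. good_open n (U i)" and U2: "SLR n \<subseteq> (\<Union>i. U i)"
    using good_open_cover[of n] by (elim exE conjE)
  have U1: "good_open n (U i)" for i using U' by simp
  note U = U1 U2
  define F where "F i = {g \<in> SLR n. g \<in> U i \<and> (\<forall>\<gamma>\<in>SLZ n. \<forall>j<i. mmul n \<gamma> g \<notin> U j)}" for i
  have Um [measurable]: "U i \<in> sets borel" for i using U(1)[of i] by (simp add: good_open_def)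
  have Fm: "F i \<in> sets borel" for i
  proof -
    have [measurable]: "mmul n \<gamma> \<in> borel \<rightarrow>\<^sub>M borel" for \<gamma>
      by (intro mmul_measurable measurable_const measurable_ident[unfolded id_def]) simp
    have 1: "mmul n \<gamma> -` U j \<in> sets borel" for \<gamma> j
      using measurable_sets[of "mmul n \<gamma>" borel borel "U j"] by simp
    have "F i = SLR n \<inter> U i - (\<Union>\<gamma>\<in>SLZ n. \<Union>j<i. mmul n \<gamma> -` U j)" by (auto simp: F_def)
    moreover have "(\<Union>\<gamma>\<in>SLZ n. \<Union>j<i. mmul n \<gamma> -` U j) \<in> sets borel"
    proof (rule sets.countable_UN'[OF countable_SLZ])
      show "(\<lambda>\<gamma>. \<Union>j<i. mmul n \<gamma> -` U j) ` SLZ n \<subseteq> sets borel"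
        using sets.finite_UN[of "{..<i}" "\<lambda>j. mmul n \<gamma> -` U j" borel for \<gamma>, OF finite_lessThan 1] by (intro image_subsetI)
    qed
    ultimately show ?thesis using SLR_borel[of n] Um[of i] by (simp add: sets.Diff sets.Int)
  qed
  have a1: "\<exists>!\<gamma>. \<gamma> \<in> SLZ n \<and> mmul n \<gamma> g \<in> (\<Union>i. F i)" if g: "g \<in> SLR n" for g
  proof -
    let ?P = "\<lambda>i. \<exists>\<gamma>\<in>SLZ n. mmul n \<gamma> g \<in> U i"
    obtain i0 where "g \<in> U i0" using U(2) g by blast
    then have "?P i0" using g by (intro bexI[of _ "idn n"]) (simp_all add: mmul_idn_left SLR_mat_n)
    then have "\<exists>i. ?P i" by (rule exI)
    define i where "i = (LEAST i. ?P i)"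
    have "?P i" unfolding i_def using \<open>\<exists>i. ?P i\<close> by (rule LeastI_ex)
    have min: "\<not> ?P j" if "j < i" for j using that not_less_Least unfolding i_def by blast
    obtain \<gamma> where \<gamma>: "\<gamma> \<in> SLZ n" "mmul n \<gamma> g \<in> U i" using \<open>?P i\<close> by auto
    have "mmul n \<gamma> g \<in> F i"
      using \<gamma> g min by (auto simp: F_def mmul_assoc[symmetric] intro: mmul_SLR SLZ_SLR mmul_SLZ)
    moreover have "\<delta> = \<gamma>" if \<delta>: "\<delta> \<in> SLZ n" "mmul n \<delta> g \<in> (\<Union>i. F i)" for \<delta>
    proof -
      obtain j where j: "mmul n \<delta> g \<in> F j" using \<delta> by auto
      have gd: "mmul n (mmul n \<delta> (minv n \<gamma>)) (mmul n \<gamma> g) = mmul n \<delta> g"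
        "mmul n (mmul n \<gamma> (minv n \<delta>)) (mmul n \<delta> g) = mmul n \<gamma> g"
        using \<gamma> \<delta> g by (simp_all add: mmul_assoc mmul_cancel_left SLZ_SLR SLR_mat_n)
      have "\<not> j < i" using min \<delta>(1) j by (auto simp: F_def)
      moreover have "\<not> i < j"
        using j \<gamma>(2) mmul_SLZ[OF \<gamma>(1) minv_SLZ[OF \<delta>(1)]] gd(2) by (auto simp: F_def)
      ultimately have "mmul n \<delta> g \<in> U i" using j by (auto simp: F_def)
      moreover have "mmul n \<gamma> g \<in> SLR n" using \<gamma> g by (simp add: mmul_SLR SLZ_SLR)
      \<comment> \<open>Both representatives lie in the same good set, so the integral matrix
        carrying one to the other is the identity.\<close>
      ultimately have "mmul n \<delta> (minv n \<gamma>) = idn n"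
        using U(1)[of i] \<gamma>(2) gd(1) mmul_SLZ[OF \<delta>(1) minv_SLZ[OF \<gamma>(1)]] unfolding good_open_def by auto
      then have "mmul n (mmul n \<delta> (minv n \<gamma>)) \<gamma> = \<gamma>" using \<gamma>(1) by (simp add: mmul_idn_left SLZ_SLR SLR_mat_n)
      then show ?thesis using \<gamma>(1) \<delta>(1) by (simp add: mmul_cancel_right SLZ_SLR SLR_mat_n)
    qed
    ultimately show ?thesis using \<gamma>(1) by (intro ex1I[of _ \<gamma>]) blast+
  qed
  have a2: "(\<Union>i. F i) \<in> sets borel" using Fm by auto
  have a3: "(\<Union>i. F i) \<subseteq> SLR n" by (auto simp: F_def)
  show ?thesis unfolding fund_dom_def by (intro exI[of _ "\<Union>i. F i"] conjI ballI a1 a2 a3)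
qed

definition sec :: "rmat set \<Rightarrow> rmat set \<Rightarrow> rmat" where
  "sec F x = (THE g. g \<in> x \<and> g \<in> F)"

lemma fund_dom_unique:
  assumes "fund_dom n F" "x \<in> Xsp n"
  shows "\<exists>!g. g \<in> x \<and> g \<in> F"
proof -
  obtain h where h: "h \<in> SLR n" "x = coset n h" using assms(2) by (auto simp: Xsp_def)
  obtain \<gamma> where \<gamma>: "\<gamma> \<in> SLZ n" "mmul n \<gamma> h \<in> F" using fund_dom_exists[OF assms(1) h(1)] by blast
  show ?thesis
  proof (rule ex1I[of _ "mmul n \<gamma> h"])
    show "mmul n \<gamma> h \<in> x \<and> mmul n \<gamma> h \<in> F" using \<gamma> h(2) by (simp add: coset_def)
    fix g assume g: "g \<in> x \<and> g \<in> F"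
    then obtain \<delta> where \<delta>: "\<delta> \<in> SLZ n" "g = mmul n \<delta> h" using h(2) by (auto simp: coset_def)
    then show "g = mmul n \<gamma> h" using fund_dom_inj[OF assms(1) h(1) \<delta>(1) \<gamma>(1)] \<gamma>(2) g by simp
  qed
qed

lemma sec_props:
  assumes "fund_dom n F" "x \<in> Xsp n"
  shows "sec F x \<in> x" "sec F x \<in> F" "sec F x \<in> SLR n" "coset n (sec F x) = x"
proof -
  show "sec F x \<in> x" "sec F x \<in> F" using theI'[OF fund_dom_unique[OF assms]] by (auto simp: sec_def)
  then show "sec F x \<in> SLR n" "coset n (sec F x) = x" using Xsp_mem[OF assms(2)] by auto
qed

lemma sec_coset:
  assumes "fund_dom n F" "g \<in> F" shows "sec F (coset n g) = g"
proof -
  have g: "g \<in> SLR n" using assms by (auto simp: fund_dom_def)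
  then have "coset n g \<in> Xsp n" by (auto simp: Xsp_def)
  then show ?thesis unfolding sec_def
    using fund_dom_unique[OF assms(1)] assms(2) self_in_coset[OF g] by (intro the1_equality) auto
qed

text \<open>The preimage of \<open>B\<close> is the coset image of \<open>B\<close> intersected with
  \<open>F\<close>, hence Borel although it is defined by a forward image.\<close>

lemma sec_measurable:
  assumes F: "fund_dom n F" shows "sec F \<in> Xborel n \<rightarrow>\<^sub>M borel"
proof (rule measurableI)
  fix B :: "rmat set" assume B: "B \<in> sets borel"
  have "sec F -` B \<inter> space (Xborel n) = coset n ` (B \<inter> F)"
  proof (intro equalityI subsetI)
    fix x assume x: "x \<in> sec F -` B \<inter> space (Xborel n)"
    then have "x = coset n (sec F x)" "sec F x \<in> B \<inter> F" using sec_props[OF F, of x] by auto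
    then show "x \<in> coset n ` (B \<inter> F)" by blast
  next
    fix x assume "x \<in> coset n ` (B \<inter> F)"
    then show "x \<in> sec F -` B \<inter> space (Xborel n)"
      using sec_coset[OF F] F by (auto simp: Xsp_def fund_dom_def)
  qed
  then show "sec F -` B \<inter> space (Xborel n) \<in> sets (Xborel n)"
    using coset_image_Xborel[of "B \<inter> F" n] B F by (auto simp: fund_dom_def)
qed simp

section \<open>The right action on the quotient\<close>

lemma Xact_coset: "Xact n (coset n g) h = coset n (mmul n g h)"
  by (auto simp: Xact_def coset_def mmul_assoc image_iff)

lemma Xact_Xsp: "x \<in> Xsp n \<Longrightarrow> h \<in> SLR n \<Longrightarrow> Xact n x h \<in> Xsp n"
  by (auto simp: Xsp_def Xact_coset intro: mmul_SLR)

lemma Xact_inverse: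
  assumes "x \<in> Xsp n" "h \<in> SLR n"
  shows "Xact n (Xact n x h) (minv n h) = x" "Xact n (Xact n x (minv n h)) h = x"
  using assms by (auto simp: Xsp_def Xact_coset mmul_cancel_right SLR_mat_n)

lemma Xact_image_eq_vimage:
  assumes "E \<subseteq> Xsp n" "h \<in> SLR n"
  shows "(\<lambda>x. Xact n x h) ` E = (\<lambda>x. Xact n x (minv n h)) -` E \<inter> Xsp n"
  using assms Xact_inverse[of _ n h] Xact_Xsp by (auto simp: image_iff) (metis subsetD)+

lemma Xact_measurable:
  assumes h: "h \<in> SLR n" shows "(\<lambda>x. Xact n x h) \<in> Xborel n \<rightarrow>\<^sub>M Xborel n"
proof (rule measurableI)
  fix E assume E: "E \<in> sets (Xborel n)"
  note [measurable] = Union_Xborel(2)[OF E]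
  have "{x \<in> Xsp n. Xact n x h \<in> E} \<in> sets (Xborel n)"
  proof (rule Xborel_CollectI[of n _ "\<lambda>g. mmul n g h \<in> \<Union>E"])
    show "Xact n (coset n g) h \<in> E \<longleftrightarrow> mmul n g h \<in> \<Union>E" if "g \<in> SLR n" for g
      using that h Union_Xsp[OF Union_Xborel(1)[OF E]] by (auto simp: Xact_coset mmul_SLR)
    have "{g \<in> space borel. g \<in> SLR n \<and> mmul n g h \<in> \<Union>E} \<in> sets borel" by measurable
    then show "{g \<in> SLR n. mmul n g h \<in> \<Union>E} \<in> sets borel" by simp
  qed
  then show "(\<lambda>x. Xact n x h) -` E \<inter> space (Xborel n) \<in> sets (Xborel n)"
    by (simp add: vimage_def Int_def conj_commute)
qed (use h Xact_Xsp in auto)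

section \<open>Haar measure\<close>

definition unit_det_cone :: "nat \<Rightarrow> rmat set" where
  "unit_det_cone n = {M \<in> mat_n n. 0 < det_n n M \<and> det_n n M \<le> 1}"

definition haar :: "nat \<Rightarrow> rmat measure" where
  "haar n = distr (density (lebM n) (indicator (unit_det_cone n))) borel (nrm n)"

lemma det_n_borel [measurable]: "det_n n \<in> borel_measurable borel"
  by (rule det_n_measurable) measurable

lemma unit_det_cone_borel [measurable]: "unit_det_cone n \<in> sets borel"
proof -
  have "{M \<in> space borel. (\<forall>i j. (n \<le> i \<or> n \<le> j) \<longrightarrow> (M::rmat) i j = 0) \<and> 0 < det_n n M \<and> det_n n M \<le> 1} \<in> sets borel"
    by measurable
  then show ?thesis by (simp add: unit_det_cone_def mat_n_def)
qed

lemma nrm_measurable [measurable]: "nrm n \<in> borel \<rightarrow>\<^sub>M borel"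
proof (rule borel_measurable_rmatI)
  fix i j show "(\<lambda>x. nrm n x i j) \<in> borel_measurable borel" unfolding nrm_def by measurable
qed

lemma sets_haar [simp, measurable_cong]: "sets (haar n) = sets borel"
  by (simp add: haar_def)

lemma space_haar [simp]: "space (haar n) = UNIV"
  by (simp add: haar_def)

lemma nn_integral_haar:
  assumes [measurable]: "f \<in> borel_measurable borel"
  shows "(\<integral>\<^sup>+g. f g \<partial>haar n) = (\<integral>\<^sup>+M. indicator (unit_det_cone n) M * f (nrm n M) \<partial>lebM n)"
proof -
  have "(\<integral>\<^sup>+g. f g \<partial>haar n) = (\<integral>\<^sup>+M. f (nrm n M) \<partial>density (lebM n) (indicator (unit_det_cone n)))"
    unfolding haar_def by (rule nn_integral_distr) measurable
  also have "\<dots> = (\<integral>\<^sup>+M. indicator (unit_det_cone n) M * f (nrm n M) \<partial>lebM n)"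
    by (rule nn_integral_density) measurable
  finally show ?thesis .
qed

lemma supp_mat_n: "supp ({..<n} \<times> {..<n}) M \<longleftrightarrow> M \<in> mat_n n"
  by (auto simp: supp_def mat_n_def)

lemma nrm_mmul:
  assumes "h \<in> SLR n"
  shows "nrm n (mmul n h M) = mmul n h (nrm n M)" "nrm n (mmul n M h) = mmul n (nrm n M) h"
proof -
  have d: "det_n n (mmul n h M) = det_n n M" "det_n n (mmul n M h) = det_n n M"
    using assms by (simp_all add: det_mmul SLR_def)
  show "nrm n (mmul n h M) = mmul n h (nrm n M)" "nrm n (mmul n M h) = mmul n (nrm n M) h"
    unfolding nrm_def d by (auto simp: mmul_def fun_eq_iff sum_distrib_left mult_ac)
qed

lemma unit_det_cone_mmul:
  assumes "h \<in> SLR n" "M \<in> mat_n n"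
  shows "mmul n h M \<in> unit_det_cone n \<longleftrightarrow> M \<in> unit_det_cone n"
    "mmul n M h \<in> unit_det_cone n \<longleftrightarrow> M \<in> unit_det_cone n"
  using assms by (auto simp: unit_det_cone_def det_mmul SLR_def)

text \<open>Multiplication by \<open>h\<close> preserves Lebesgue measure and the determinant cone
  and commutes with the radial projection \<open>nrm\<close>. The same holds on the right, so
  \<open>haar\<close> is bi-invariant.\<close>

lemma nn_integral_haar_left:
  assumes h: "h \<in> SLR n" and [measurable]: "f \<in> borel_measurable borel"
  shows "(\<integral>\<^sup>+g. f (mmul n h g) \<partial>haar n) = (\<integral>\<^sup>+g. f g \<partial>haar n)"
proof -
  let ?\<phi> = "\<lambda>M. indicator (unit_det_cone n) M * f (nrm n M)"
  have "(\<integral>\<^sup>+g. f g \<partial>haar n) = (\<integral>\<^sup>+M. ?\<phi> M \<partial>distr (lebM n) borel (lmul n h))"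
    by (simp add: nn_integral_haar distr_lmul_MI[OF _ h])
  also have "\<dots> = (\<integral>\<^sup>+M. ?\<phi> (lmul n h M) \<partial>lebM n)" by (rule nn_integral_distr) measurable
  also have "\<dots> = (\<integral>\<^sup>+M. indicator (unit_det_cone n) M * f (mmul n h (nrm n M)) \<partial>lebM n)"
  proof (rule nn_integral_MI_supp_cong)
    fix M assume "supp ({..<n} \<times> {..<n}) M"
    then have "M \<in> mat_n n" by (simp add: supp_mat_n)
    then show "?\<phi> (lmul n h M) = indicator (unit_det_cone n) M * f (mmul n h (nrm n M))"
      by (simp add: lmul_eq_mmul nrm_mmul[OF h] indicator_def unit_det_cone_mmul[OF h])
  qed measurable
  also have "\<dots> = (\<integral>\<^sup>+g. f (mmul n h g) \<partial>haar n)" by (rule nn_integral_haar[of "\<lambda>g. f (mmul n h g)", symmetric]) measurable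
  finally show ?thesis by simp
qed

lemma nn_integral_haar_right:
  assumes h: "h \<in> SLR n" and [measurable]: "f \<in> borel_measurable borel"
  shows "(\<integral>\<^sup>+g. f (mmul n g h) \<partial>haar n) = (\<integral>\<^sup>+g. f g \<partial>haar n)"
proof -
  let ?\<phi> = "\<lambda>M. indicator (unit_det_cone n) M * f (nrm n M)"
  have "(\<integral>\<^sup>+g. f g \<partial>haar n) = (\<integral>\<^sup>+M. ?\<phi> M \<partial>distr (lebM n) borel (rmul n h))"
    by (simp add: nn_integral_haar distr_rmul_MI[OF _ h])
  also have "\<dots> = (\<integral>\<^sup>+M. ?\<phi> (rmul n h M) \<partial>lebM n)" by (rule nn_integral_distr) measurable
  also have "\<dots> = (\<integral>\<^sup>+M. indicator (unit_det_cone n) M * f (mmul n (nrm n M) h) \<partial>lebM n)"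
  proof (rule nn_integral_MI_supp_cong)
    fix M assume "supp ({..<n} \<times> {..<n}) M"
    then have "M \<in> mat_n n" by (simp add: supp_mat_n)
    then show "?\<phi> (rmul n h M) = indicator (unit_det_cone n) M * f (mmul n (nrm n M) h)"
      by (simp add: rmul_eq_mmul nrm_mmul[OF h] indicator_def unit_det_cone_mmul[OF h])
  qed measurable
  also have "\<dots> = (\<integral>\<^sup>+g. f (mmul n g h) \<partial>haar n)" by (rule nn_integral_haar[of "\<lambda>g. f (mmul n g h)", symmetric]) measurable
  finally show ?thesis by simp
qed

lemma emeasure_haar_left:
  assumes "h \<in> SLR n" and [measurable]: "S \<in> sets borel"
  shows "emeasure (haar n) {g. mmul n h g \<in> S} = emeasure (haar n) S"
proof -
  have "{g \<in> space borel. mmul n h g \<in> S} \<in> sets borel" by measurable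
  then have "emeasure (haar n) {g. mmul n h g \<in> S} = (\<integral>\<^sup>+g. indicator {g. mmul n h g \<in> S} g \<partial>haar n)" by simp
  also have "\<dots> = (\<integral>\<^sup>+g. indicator S (mmul n h g) \<partial>haar n)" by (simp add: indicator_def)
  also have "\<dots> = emeasure (haar n) S" using assms by (subst nn_integral_haar_left) auto
  finally show ?thesis .
qed

lemma emeasure_haar_right:
  assumes "h \<in> SLR n" and [measurable]: "S \<in> sets borel"
  shows "emeasure (haar n) {g. mmul n g h \<in> S} = emeasure (haar n) S"
proof -
  have "{g \<in> space borel. mmul n g h \<in> S} \<in> sets borel" by measurable
  then have "emeasure (haar n) {g. mmul n g h \<in> S} = (\<integral>\<^sup>+g. indicator {g. mmul n g h \<in> S} g \<partial>haar n)" by simp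
  also have "\<dots> = (\<integral>\<^sup>+g. indicator S (mmul n g h) \<partial>haar n)" by (simp add: indicator_def)
  also have "\<dots> = emeasure (haar n) S" using assms by (subst nn_integral_haar_right) auto
  finally show ?thesis .
qed

lemma emeasure_haar: "S \<in> sets borel \<Longrightarrow> emeasure (haar n) S = emeasure (lebM n) {M \<in> unit_det_cone n. nrm n M \<in> S}"
proof -
  assume [measurable]: "S \<in> sets borel"
  have "{M \<in> space borel. M \<in> unit_det_cone n \<and> nrm n M \<in> S} \<in> sets borel" by measurable
  then have m: "{M \<in> unit_det_cone n. nrm n M \<in> S} \<in> sets borel" by simp
  have "emeasure (haar n) S = (\<integral>\<^sup>+g. indicator S g \<partial>haar n)" by simp
  also have "\<dots> = (\<integral>\<^sup>+M. indicator {M \<in> unit_det_cone n. nrm n M \<in> S} M \<partial>lebM n)"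
    by (subst nn_integral_haar, measurable) (rule nn_integral_cong, simp add: indicator_def)
  finally show ?thesis using m by simp
qed

lemma haar_not_SLR: "n \<ge> 1 \<Longrightarrow> emeasure (haar n) (- SLR n) = 0"
proof -
  assume n: "n \<ge> 1"
  have e: "{M \<in> unit_det_cone n. nrm n M \<in> - SLR n} = {}" using nrm_SLR[OF n] by (auto simp: unit_det_cone_def)
  have "- SLR n \<in> sets borel" by simp
  from emeasure_haar[OF this, of n] show ?thesis unfolding e by simp
qed

section \<open>Covolume of SL(n, Z): finite and positive\<close>

lemma distr_lmul_lebM: "h \<in> SLR n \<Longrightarrow> distr (lebM n) (lebM n) (lmul n h) = lebM n"
  using distr_lmul_MI[of "{..<n}" h n] by (simp cong: distr_cong)

text \<open>The cone over \<open>F\<close> is compared with the reduction set inside the determinant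
  cone: each of its points can be moved into \<open>R\<close>, and a given point of \<open>R\<close>
  is reached by at most one element, as \<open>F\<close> meets each orbit once.\<close>

lemma haar_fund_dom_finite:
  assumes n: "n \<ge> 1" and F: "fund_dom n F"
  shows "emeasure (haar n) F < \<infinity>"
proof -
  obtain R where R: "R \<in> sets borel" "emeasure (lebM n) R < \<infinity>"
    "\<And>M. M \<in> mat_n n \<Longrightarrow> 0 < det_n n M \<Longrightarrow> det_n n M \<le> 1 \<Longrightarrow> \<exists>\<gamma>\<in>SLZ n. mmul n \<gamma> M \<in> R"
    using finite_volume_reduction_set[OF n] by blast
  note [measurable] = R(1)
  have [measurable]: "F \<in> sets borel" using F by (simp add: fund_dom_def)
  let ?D = "unit_det_cone n"
  have m: "{M \<in> ?D. nrm n M \<in> F} \<in> sets borel"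
  proof -
    have "{M \<in> space borel. M \<in> ?D \<and> nrm n M \<in> F} \<in> sets borel" by measurable
    then show ?thesis by simp
  qed
  have Dm: "M \<in> mat_n n" if "M \<in> ?D" for M using that by (simp add: unit_det_cone_def)
  have "emeasure (haar n) F = emeasure (lebM n) {M \<in> ?D. nrm n M \<in> F}" by (rule emeasure_haar) measurable
  also have "\<dots> \<le> emeasure (lebM n) (R \<inter> ?D)"
  proof (rule emeasure_le_of_orbits[where \<Gamma> = "SLZ n" and a = "lmul n" and b = "\<lambda>\<gamma>. lmul n (minv n \<gamma>)"])
    fix \<gamma> assume \<gamma>: "\<gamma> \<in> SLZ n"
    show "distr (lebM n) (lebM n) (lmul n \<gamma>) = lebM n" by (rule distr_lmul_lebM[OF SLZ_SLR[OF \<gamma>]])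
    fix M assume "M \<in> {M \<in> ?D. nrm n M \<in> F}"
    then show "lmul n (minv n \<gamma>) (lmul n \<gamma> M) = M"
      using \<gamma> Dm[of M] by (simp add: lmul_eq_mmul mmul_cancel_left SLZ_SLR)
  next
    fix M assume M: "M \<in> {M \<in> ?D. nrm n M \<in> F}"
    then obtain \<gamma> where "\<gamma> \<in> SLZ n" "mmul n \<gamma> M \<in> R" using R(3)[of M] by (auto simp: unit_det_cone_def)
    then show "\<exists>\<gamma>\<in>SLZ n. lmul n \<gamma> M \<in> R \<inter> ?D"
      using M Dm[of M] by (auto simp: lmul_eq_mmul unit_det_cone_mmul SLZ_SLR)
  next
    fix y \<gamma> \<delta> assume y: "y \<in> R \<inter> ?D" and \<gamma>: "\<gamma> \<in> SLZ n" "\<delta> \<in> SLZ n"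
      and s: "lmul n (minv n \<gamma>) y \<in> {M \<in> ?D. nrm n M \<in> F}" "lmul n (minv n \<delta>) y \<in> {M \<in> ?D. nrm n M \<in> F}"
    have "nrm n y \<in> SLR n" using y nrm_SLR[OF n] by (auto simp: unit_det_cone_def)
    moreover have "mmul n (minv n \<gamma>) (nrm n y) \<in> F" "mmul n (minv n \<delta>) (nrm n y) \<in> F"
      using s y Dm[of y] \<gamma> by (auto simp: lmul_eq_mmul nrm_mmul minv_SLR SLZ_SLR)
    ultimately have "minv n \<gamma> = minv n \<delta>"
      using fund_dom_inj[OF F _ minv_SLZ[OF \<gamma>(1)] minv_SLZ[OF \<gamma>(2)]] by simp
    then show "\<gamma> = \<delta>" using minv_minv SLZ_SLR \<gamma> by metis
  qed (use m in auto)
  also have "\<dots> \<le> emeasure (lebM n) R" by (intro emeasure_mono) auto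
  finally show ?thesis using R(2) by (rule le_less_trans)
qed

text \<open>Explicit rational approximations with a single index, so that all entries of a matrix
  converge together.\<close>

lemma tendsto_floor_approx: "(\<lambda>k. real_of_int \<lfloor>real k * t\<rfloor> / real k) \<longlonglongrightarrow> t"
proof (rule tendsto_sandwich)
  show "\<forall>\<^sub>F k in sequentially. t - 1 / real k \<le> real_of_int \<lfloor>real k * t\<rfloor> / real k"
  proof (rule eventually_sequentiallyI[of 1])
    fix k :: nat assume k: "1 \<le> k"
    have "real k * t - 1 \<le> real_of_int \<lfloor>real k * t\<rfloor>" by linarith
    then have "(real k * t - 1) / real k \<le> real_of_int \<lfloor>real k * t\<rfloor> / real k" by (rule divide_right_mono) simp
    then show "t - 1 / real k \<le> real_of_int \<lfloor>real k * t\<rfloor> / real k" using k by (simp add: diff_divide_distrib)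
  qed
  show "\<forall>\<^sub>F k in sequentially. real_of_int \<lfloor>real k * t\<rfloor> / real k \<le> t"
  proof (rule eventually_sequentiallyI[of 1])
    fix k :: nat assume k: "1 \<le> k"
    have "real_of_int \<lfloor>real k * t\<rfloor> / real k \<le> (real k * t) / real k" by (intro divide_right_mono) auto
    then show "real_of_int \<lfloor>real k * t\<rfloor> / real k \<le> t" using k by simp
  qed
  have "(\<lambda>k. t - 1 / real k) \<longlonglongrightarrow> t - 0" by (intro tendsto_diff tendsto_const lim_1_over_n)
  then show "(\<lambda>k. t - 1 / real k) \<longlonglongrightarrow> t" by simp
qed simp

text \<open>Countably many rational translates of the cone cover all matrices.\<close>
lemma lebM_unit_det_cone_pos:
  assumes n: "n \<ge> 1"
  shows "emeasure (lebM n) (unit_det_cone n) \<noteq> 0"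
proof
  assume z: "emeasure (lebM n) (unit_det_cone n) = 0"
  let ?I = "{..<n} \<times> {..<n}"
  define Q where "Q = zext ?I ` PiE ?I (\<lambda>_. \<rat> :: real set)"
  have "countable Q" unfolding Q_def by (intro countable_image countable_PiE) (auto simp: countable_rat)
  define neg where "neg q = (\<lambda>i j. - q i j)" for q :: rmat
  have Qs: "supp ?I (neg q)" if "q \<in> Q" for q using that by (auto simp: Q_def neg_def supp_def zext_def)
  have m: "{x. madd x (neg q) \<in> unit_det_cone n} \<in> sets borel" for q
  proof -
    have "{x \<in> space borel. madd x (neg q) \<in> unit_det_cone n} \<in> sets borel" by measurable
    then show ?thesis by simp
  qed
  have null: "{x. madd x (neg q) \<in> unit_det_cone n} \<in> null_sets (lebM n)" if "q \<in> Q" for q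
  proof -
    have "emeasure (lebM n) {x. madd x (neg q) \<in> unit_det_cone n} = (\<integral>\<^sup>+x. indicator (unit_det_cone n) (madd x (neg q)) \<partial>lebM n)"
    proof -
      have "emeasure (lebM n) {x. madd x (neg q) \<in> unit_det_cone n} =
          (\<integral>\<^sup>+x. indicator {x. madd x (neg q) \<in> unit_det_cone n} x \<partial>lebM n)" using m[of q] by simp
      also have "\<dots> = (\<integral>\<^sup>+x. indicator (unit_det_cone n) (madd x (neg q)) \<partial>lebM n)"
        by (rule nn_integral_cong) (simp add: indicator_def)
      finally show ?thesis .
    qed
    also have "\<dots> = (\<integral>\<^sup>+x. indicator (unit_det_cone n) x \<partial>lebM n)"
      by (rule nn_integral_MI_translate) (auto intro: Qs that)
    also have "\<dots> = 0" using z by simp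
    finally show ?thesis using m[of q] by (simp add: null_sets_def)
  qed
  have UN: "(\<Union>q\<in>Q. {x. madd x (neg q) \<in> unit_det_cone n}) \<in> null_sets (lebM n)"
    by (rule null_sets_UN'[OF \<open>countable Q\<close> null])
  have cover: "x \<in> (\<Union>q\<in>Q. {x. madd x (neg q) \<in> unit_det_cone n})" if x: "supp ?I x" for x
  proof -
    \<comment> \<open>The difference \<open>x - q\<close> is aimed at half the identity, whose
      determinant \<open>(1/2) ^ n\<close> lies strictly between 0 and 1. By continuity of the
      determinant a close enough rational \<open>q\<close> puts \<open>x - q\<close> into the
      cone.\<close>
    define y where "y = (\<lambda>i j. x i j - (1/2) * idn n i j)"
    define q where "q k = zext ?I (\<lambda>p\<in>?I. real_of_int \<lfloor>real k * y (fst p) (snd p)\<rfloor> / real k)" for k :: nat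
    have qQ: "q k \<in> Q" for k unfolding q_def Q_def
      by (intro imageI restrict_PiE_iff[THEN iffD2] ballI Rats_divide Rats_of_int Rats_of_nat)
    have lim: "(\<lambda>k. madd x (neg (q k)) i j) \<longlonglongrightarrow> (1/2) * idn n i j" for i j
    proof (cases "(i, j) \<in> ?I")
      case True
      have "(\<lambda>k. x i j - real_of_int \<lfloor>real k * y i j\<rfloor> / real k) \<longlonglongrightarrow> x i j - y i j"
        by (intro tendsto_diff tendsto_const tendsto_floor_approx)
      then show ?thesis using True by (simp add: madd_def neg_def q_def zext_def y_def)
    next
      case False
      then show ?thesis using x by (auto simp: madd_def neg_def q_def zext_def supp_def idn_def)
    qed
    have "(\<lambda>k. det_n n (madd x (neg (q k)))) \<longlonglongrightarrow> det_n n (\<lambda>i j. (1/2) * idn n i j)"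
      unfolding det_n_def by (intro tendsto_sum tendsto_mult tendsto_const tendsto_prod lim)
    also have "det_n n (\<lambda>i j. (1/2) * idn n i j) = (1/2) ^ n" by (simp only: det_n_scale det_idn mult_1_right)
    finally have L: "(\<lambda>k. det_n n (madd x (neg (q k)))) \<longlonglongrightarrow> (1/2) ^ n" .
    have "(1/2::real) ^ n < 1" using n by (intro power_less_one_iff[THEN iffD2]) auto
    then have "\<forall>\<^sub>F k in sequentially. 0 < det_n n (madd x (neg (q k))) \<and> det_n n (madd x (neg (q k))) < 1"
      using order_tendstoD[OF L] by (intro eventually_conj) auto
    then obtain k where "0 < det_n n (madd x (neg (q k)))" "det_n n (madd x (neg (q k))) < 1"
      using eventually_happens'[OF sequentially_bot] by blast
    moreover have "madd x (neg (q k)) \<in> mat_n n"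
      using x by (auto simp: supp_mat_n[symmetric] supp_def madd_def neg_def q_def zext_def)
    ultimately have "madd x (neg (q k)) \<in> unit_det_cone n" by (simp add: unit_det_cone_def)
    then show ?thesis using qQ by blast
  qed
  \<comment> \<open>The contradiction: this box has volume one, yet its matrices supported on
    \<open>?I\<close> all lie in the null union.\<close>
  define B where "B = {x::rmat. \<forall>p\<in>?I. x (fst p) (snd p) \<in> {0..1::real}}"
  have B: "B \<in> sets borel" unfolding B_def by (rule box_borel) auto
  let ?N = "\<Union>q\<in>Q. {x. madd x (neg q) \<in> unit_det_cone n}"
  have Nm: "?N \<in> sets borel" using UN by auto
  have "emeasure (lebM n) B = (\<integral>\<^sup>+x. indicator B x \<partial>lebM n)" using B by simp
  also have "\<dots> = (\<integral>\<^sup>+x. indicator B x * indicator ?N x \<partial>lebM n)"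
  proof (rule nn_integral_MI_supp_cong)
    show "indicator B x = indicator B x * (indicator ?N x :: ennreal)" if "supp ?I x" for x
      using cover[OF that] by (simp add: indicator_def)
  qed (use B Nm in measurable)
  also have "\<dots> \<le> (\<integral>\<^sup>+x. indicator ?N x \<partial>lebM n)" by (intro nn_integral_mono) (auto simp: indicator_def)
  also have "\<dots> = 0" using UN by (simp add: null_sets_def Nm)
  finally have "emeasure (lebM n) B = 0" by simp
  moreover have "emeasure (lebM n) B = 1" unfolding B_def by (subst emeasure_MI_box) auto
  ultimately show False by simp
qed

lemma fund_dom_translates:
  assumes "fund_dom n F"
  shows "SLR n \<subseteq> (\<Union>\<gamma>\<in>SLZ n. {g. mmul n \<gamma> g \<in> F})"
  using fund_dom_exists[OF assms] by blast

text \<open>Countably many translates of \<open>F\<close> cover SL(n, R). If they were null, the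
  whole measure would vanish, against the positive volume of the determinant cone.\<close>

lemma haar_fund_dom_pos:
  assumes n: "n \<ge> 1" and F: "fund_dom n F"
  shows "emeasure (haar n) F \<noteq> 0"
proof
  assume z: "emeasure (haar n) F = 0"
  have [measurable]: "F \<in> sets borel" using F by (simp add: fund_dom_def)
  have m: "{g. mmul n \<gamma> g \<in> F} \<in> sets borel" for \<gamma>
  proof -
    have "{g \<in> space borel. mmul n \<gamma> g \<in> F} \<in> sets borel" by measurable
    then show ?thesis by simp
  qed
  have "{g. mmul n \<gamma> g \<in> F} \<in> null_sets (haar n)" if "\<gamma> \<in> SLZ n" for \<gamma>
    using emeasure_haar_left[OF SLZ_SLR[OF that], of F] z m by (simp add: null_sets_def)
  then have "(\<Union>\<gamma>\<in>SLZ n. {g. mmul n \<gamma> g \<in> F}) \<in> null_sets (haar n)" by (intro null_sets_UN' countable_SLZ)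
  moreover have "- SLR n \<in> null_sets (haar n)" using haar_not_SLR[OF n] by (simp add: null_sets_def)
  ultimately have "(\<Union>\<gamma>\<in>SLZ n. {g. mmul n \<gamma> g \<in> F}) \<union> - SLR n \<in> null_sets (haar n)" by (rule null_sets.Un)
  moreover have "(\<Union>\<gamma>\<in>SLZ n. {g. mmul n \<gamma> g \<in> F}) \<union> - SLR n = UNIV" using fund_dom_translates[OF F] by auto
  ultimately have "emeasure (haar n) UNIV = 0" by (simp add: null_sets_def)
  then show False using lebM_unit_det_cone_pos[OF n] emeasure_haar[of UNIV n] by simp
qed

lemma sigma_finite_haar:
  assumes n: "n \<ge> 1" shows "sigma_finite_measure (haar n)"
proof
  obtain F where F: "fund_dom n F" using exists_fund_dom by blast
  have [measurable]: "F \<in> sets borel" using F by (simp add: fund_dom_def)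
  have m: "{g. mmul n \<gamma> g \<in> F} \<in> sets borel" for \<gamma>
  proof -
    have "{g \<in> space borel. mmul n \<gamma> g \<in> F} \<in> sets borel" by measurable
    then show ?thesis by simp
  qed
  let ?A = "insert (- SLR n) ((\<lambda>\<gamma>. {g. mmul n \<gamma> g \<in> F}) ` SLZ n)"
  show "\<exists>A. countable A \<and> A \<subseteq> sets (haar n) \<and> \<Union> A = space (haar n) \<and> (\<forall>a\<in>A. emeasure (haar n) a \<noteq> \<infinity>)"
  proof (intro exI[of _ ?A] conjI ballI)
    show "\<Union> ?A = space (haar n)" using fund_dom_translates[OF F] by auto
    fix a assume "a \<in> ?A"
    then show "emeasure (haar n) a \<noteq> \<infinity>"
      using haar_not_SLR[OF n] emeasure_haar_left[OF SLZ_SLR, of _ n F] haar_fund_dom_finite[OF n F] by auto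
  qed (use m in auto)
qed

text \<open>Used in both directions, this shows that two Borel sets which represent the same orbits,
  each at most once, have the same Haar measure.\<close>

lemma haar_le_of_orbits:
  assumes SR: "S \<in> sets borel" "R \<in> sets borel" "S \<subseteq> SLR n" "R \<subseteq> SLR n"
    and cover: "\<And>g. g \<in> S \<Longrightarrow> \<exists>\<gamma>\<in>SLZ n. mmul n \<gamma> g \<in> R"
    and once: "\<And>g \<gamma> \<delta>. g \<in> SLR n \<Longrightarrow> \<gamma> \<in> SLZ n \<Longrightarrow> \<delta> \<in> SLZ n \<Longrightarrow> mmul n \<gamma> g \<in> S \<Longrightarrow> mmul n \<delta> g \<in> S \<Longrightarrow> \<gamma> = \<delta>"
  shows "emeasure (haar n) S \<le> emeasure (haar n) R"
proof (rule emeasure_le_of_orbits[where \<Gamma> = "SLZ n" and a = "mmul n" and b = "\<lambda>\<gamma>. mmul n (minv n \<gamma>)"])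
  fix \<gamma> assume \<gamma>: "\<gamma> \<in> SLZ n"
  show "distr (haar n) (haar n) (mmul n \<gamma>) = haar n"
  proof (rule measure_eqI)
    fix B assume "B \<in> sets (distr (haar n) (haar n) (mmul n \<gamma>))"
    then show "emeasure (distr (haar n) (haar n) (mmul n \<gamma>)) B = emeasure (haar n) B"
      using emeasure_haar_left[OF SLZ_SLR[OF \<gamma>], of B] by (simp add: emeasure_distr vimage_def)
  qed simp
  fix M assume "M \<in> S"
  then show "mmul n (minv n \<gamma>) (mmul n \<gamma> M) = M"
    using \<gamma> SR by (intro mmul_cancel_left) (auto simp: SLZ_SLR SLR_mat_n)
next
  fix y \<gamma> \<delta> assume "y \<in> R" "\<gamma> \<in> SLZ n" "\<delta> \<in> SLZ n" "mmul n (minv n \<gamma>) y \<in> S" "mmul n (minv n \<delta>) y \<in> S"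
  then have "minv n \<gamma> = minv n \<delta>" using SR by (intro once[of y]) (auto intro: minv_SLZ)
  then show "\<gamma> = \<delta>" using minv_minv SLZ_SLR \<open>\<gamma> \<in> SLZ n\<close> \<open>\<delta> \<in> SLZ n\<close> by metis
qed (use SR cover in auto)

section \<open>The invariant probability measure\<close>

definition invariant_prob :: "nat \<Rightarrow> rmat set measure \<Rightarrow> bool" where
  "invariant_prob n m \<longleftrightarrow> sets m = sets (Xborel n) \<and> prob_space m \<and>
     (\<forall>h \<in> SLR n. \<forall>E \<in> sets m. emeasure m ((\<lambda>x. Xact n x h) ` E) = emeasure m E)"

lemma space_eq_Xsp: "sets m = sets (Xborel n) \<Longrightarrow> space m = Xsp n"
  using sets_eq_imp_space_eq[of m "Xborel n"] by simp

lemma Union_Xsp_mmul: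
  assumes "E \<subseteq> Xsp n" "g \<in> \<Union>E" "\<gamma> \<in> SLZ n" shows "mmul n \<gamma> g \<in> \<Union>E"
  using assms Union_Xsp[OF assms(1)] by (auto simp: coset_mmul mmul_SLR SLZ_SLR)

text \<open>Right translation turns the left-hand set into the part of \<open>\<Union>E\<close>
  whose translate by \<open>h\<close> lies in \<open>F\<close>. This is the same saturated set cut
  by another fundamental domain, and its Haar measure does not depend on the domain.\<close>

lemma haar_translate_fund_dom:
  assumes n: "n \<ge> 1" and F: "fund_dom n F" and E: "E \<in> sets (Xborel n)" and h: "h \<in> SLR n"
  shows "emeasure (haar n) (\<Union>((\<lambda>x. Xact n x h) ` E) \<inter> F) = emeasure (haar n) (\<Union>E \<inter> F)"
proof -
  note ES = Union_Xborel(1)[OF E]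
  have [measurable]: "\<Union>E \<in> sets borel" by (rule Union_Xborel(2)[OF E])
  have Fm [measurable]: "F \<in> sets borel" and FS: "F \<subseteq> SLR n" using F by (simp_all add: fund_dom_def)
  have TS: "\<Union>E \<subseteq> SLR n" using Union_Xsp[OF ES] by blast
  have sub: "(\<lambda>x. Xact n x h) ` E \<subseteq> Xsp n" using ES Xact_Xsp[OF _ h] by blast
  have "g \<in> \<Union>((\<lambda>x. Xact n x h) ` E) \<longleftrightarrow> mmul n g (minv n h) \<in> \<Union>E" if g: "g \<in> SLR n" for g
  proof -
    have "coset n g \<in> Xsp n" using g by (auto simp: Xsp_def)
    then have "coset n g \<in> (\<lambda>x. Xact n x h) ` E \<longleftrightarrow> Xact n (coset n g) (minv n h) \<in> E"
      unfolding Xact_image_eq_vimage[OF ES h] by simp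
    then show ?thesis
      using g h Union_Xsp[OF sub] Union_Xsp[OF ES] by (simp add: Xact_coset mmul_SLR minv_SLR)
  qed
  then have S: "\<Union>((\<lambda>x. Xact n x h) ` E) \<inter> F = {g \<in> F. mmul n g (minv n h) \<in> \<Union>E}" using FS by blast
  have "{g \<in> space borel. g \<in> F \<and> mmul n g (minv n h) \<in> \<Union>E} \<in> sets borel" by measurable
  then have m1 [measurable]: "{g \<in> F. mmul n g (minv n h) \<in> \<Union>E} \<in> sets borel" by simp
  \<comment> \<open>\<open>S'\<close> is the literal preimage under right multiplication. Cancelling
    \<open>h\<close> is possible on SL(n, R), so \<open>S'\<close> and \<open>S''\<close> agree up
    to the null complement of that group.\<close>
  define S' where "S' = {g. mmul n g h \<in> {g \<in> F. mmul n g (minv n h) \<in> \<Union>E}}"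
  have "{g \<in> space borel. mmul n g h \<in> {g \<in> F. mmul n g (minv n h) \<in> \<Union>E}} \<in> sets borel" by measurable
  then have m2: "S' \<in> sets borel" by (simp add: S'_def)
  have nl: "- SLR n \<in> null_sets (haar n)" using haar_not_SLR[OF n] by (simp add: null_sets_def)
  define S'' where "S'' = {g \<in> \<Union>E. mmul n g h \<in> F}"
  have "{g \<in> space borel. g \<in> \<Union>E \<and> mmul n g h \<in> F} \<in> sets borel" by measurable
  then have m3: "S'' \<in> sets borel" by (simp add: S''_def)
  have S''S: "S'' \<subseteq> SLR n" using TS by (auto simp: S''_def)
  have "S' - (- SLR n) = S''"
  proof (rule Set.set_eqI)
    fix g
    show "g \<in> S' - (- SLR n) \<longleftrightarrow> g \<in> S''"
    proof (cases "g \<in> SLR n")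
      case True
      then have "mmul n (mmul n g h) (minv n h) = g" using h by (simp add: mmul_cancel_right SLR_mat_n)
      with True show ?thesis by (simp add: S'_def S''_def conj_commute del: Union_iff)
    next
      case False
      then have "g \<notin> S''" using TS unfolding S''_def by blast
      with False show ?thesis by simp
    qed
  qed
  then have "emeasure (haar n) (\<Union>((\<lambda>x. Xact n x h) ` E) \<inter> F) = emeasure (haar n) S''"
    using emeasure_Diff_null_set[OF nl, of S'] m2 emeasure_haar_right[OF h m1]
    unfolding S by (simp add: S'_def)
  also have "\<dots> = emeasure (haar n) (\<Union>E \<inter> F)"
  proof (rule antisym)
    show "emeasure (haar n) S'' \<le> emeasure (haar n) (\<Union>E \<inter> F)"
    proof (rule haar_le_of_orbits)
      fix g assume g: "g \<in> S''"
      then obtain \<gamma> where "\<gamma> \<in> SLZ n" "mmul n \<gamma> g \<in> F" using fund_dom_exists[OF F, of g] S''S by blast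
      then show "\<exists>\<gamma>\<in>SLZ n. mmul n \<gamma> g \<in> \<Union>E \<inter> F" using g Union_Xsp_mmul[OF ES, of g] by (auto simp: S''_def)
    next
      fix g \<gamma> \<delta> assume g: "g \<in> SLR n" "\<gamma> \<in> SLZ n" "\<delta> \<in> SLZ n" "mmul n \<gamma> g \<in> S''" "mmul n \<delta> g \<in> S''"
      then show "\<gamma> = \<delta>"
        using fund_dom_inj[OF F mmul_SLR[OF g(1) h] g(2,3)] by (simp add: S''_def mmul_assoc)
    qed (use m3 S''S FS in auto)
    show "emeasure (haar n) (\<Union>E \<inter> F) \<le> emeasure (haar n) S''"
    proof (rule haar_le_of_orbits)
      fix g assume g: "g \<in> \<Union>E \<inter> F"
      then have "mmul n g h \<in> SLR n" using FS h by (auto intro: mmul_SLR)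
      then obtain \<gamma> where "\<gamma> \<in> SLZ n" "mmul n \<gamma> (mmul n g h) \<in> F" using fund_dom_exists[OF F] by blast
      then show "\<exists>\<gamma>\<in>SLZ n. mmul n \<gamma> g \<in> S''"
        using g Union_Xsp_mmul[OF ES, of g] by (auto simp: S''_def mmul_assoc)
    next
      fix g \<gamma> \<delta> assume g: "g \<in> SLR n" "\<gamma> \<in> SLZ n" "\<delta> \<in> SLZ n" "mmul n \<gamma> g \<in> \<Union>E \<inter> F" "mmul n \<delta> g \<in> \<Union>E \<inter> F"
      then show "\<gamma> = \<delta>" using fund_dom_inj[OF F g(1,2,3)] by simp
    qed (use m3 S''S FS in auto)
  qed
  finally show ?thesis .
qed

text \<open>Haar measure on \<open>F\<close>, projected to the quotient and divided by its total
  mass \<open>c\<close>, which is positive and finite.\<close>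

lemma exists_invariant_prob:
  assumes n: "n \<ge> 1" shows "\<exists>m. invariant_prob n m"
proof -
  obtain F where F: "fund_dom n F" using exists_fund_dom by blast
  have Fm: "F \<in> sets borel" and FS: "F \<subseteq> SLR n" using F by (simp_all add: fund_dom_def)
  define c where "c = emeasure (haar n) F"
  have c: "c \<noteq> 0" "c < \<infinity>" using haar_fund_dom_pos[OF n F] haar_fund_dom_finite[OF n F] by (auto simp: c_def)
  define m where "m = scale_measure (1 / c) (distr (restrict_space (haar n) F) (Xborel n) (coset n))"
  have "coset n \<in> restrict_space borel F \<rightarrow>\<^sub>M Xborel n"
    by (rule measurable_restrict_mono[OF coset_measurable FS])
  moreover have "sets (restrict_space (haar n) F) = sets (restrict_space borel F)"
    by (rule sets_restrict_space_cong) simp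
  ultimately have cm: "coset n \<in> restrict_space (haar n) F \<rightarrow>\<^sub>M Xborel n"
    using measurable_cong_sets by blast
  have sm: "sets m = sets (Xborel n)" by (simp add: m_def)
  then have spm: "space m = Xsp n" by (rule space_eq_Xsp)
  have em: "emeasure m E = (1 / c) * emeasure (haar n) (\<Union>E \<inter> F)" if E: "E \<in> sets (Xborel n)" for E
  proof -
    have "coset n -` E \<inter> space (restrict_space (haar n) F) = \<Union>E \<inter> F"
      using Union_Xsp[OF Union_Xborel(1)[OF E]] FS by (auto simp: space_restrict_space)
    then show ?thesis unfolding m_def using cm E Fm
      by (simp add: emeasure_distr emeasure_restrict_space)
  qed
  have "prob_space m"
  proof
    have "\<Union>(Xsp n) \<inter> F = F" using Union_Xsp[of "Xsp n" n] FS by (auto simp: Xsp_def)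
    then have "emeasure m (Xsp n) = (1 / c) * c"
      using em[of "Xsp n"] sets.top[of "Xborel n"] by (simp add: c_def)
    also have "\<dots> = 1" using c by (simp add: ennreal_divide_times)
    finally show "emeasure m (space m) = 1" by (simp add: spm)
  qed
  moreover have "emeasure m ((\<lambda>x. Xact n x h) ` E) = emeasure m E" if "h \<in> SLR n" "E \<in> sets m" for h E
  proof -
    have E: "E \<in> sets (Xborel n)" using that sm by simp
    have "(\<lambda>x. Xact n x h) ` E = (\<lambda>x. Xact n x (minv n h)) -` E \<inter> space (Xborel n)"
      using Xact_image_eq_vimage[OF Union_Xborel(1)[OF E] that(1)] by simp
    then have "(\<lambda>x. Xact n x h) ` E \<in> sets (Xborel n)"
      using measurable_sets[OF Xact_measurable[OF minv_SLR[OF that(1)]] E] by simp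
    then show ?thesis using em E haar_translate_fund_dom[OF n F E that(1)] by simp
  qed
  ultimately show ?thesis using sm unfolding invariant_prob_def by blast
qed

section \<open>Unfolding and uniqueness\<close>

lemma borel_measurable_nn_integral_count_space:
  assumes "countable I" "\<And>i. i \<in> I \<Longrightarrow> f i \<in> borel_measurable N"
  shows "(\<lambda>x. \<integral>\<^sup>+i. f i x \<partial>count_space I) \<in> borel_measurable N"
proof -
  interpret sigma_finite_measure "count_space I" by (rule sigma_finite_measure_count_space_countable[OF assms(1)])
  have "(\<lambda>p. f (fst p) (snd p)) \<in> borel_measurable (count_space I \<Otimes>\<^sub>M N)"
    by (rule measurable_pair_measure_countable1) (use assms in auto)
  from measurable_compose[OF measurable_pair_swap' this] have "(\<lambda>(x, i). f i x) \<in> borel_measurable (N \<Otimes>\<^sub>M count_space I)" by (simp add: split_beta')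
  then show ?thesis by (rule borel_measurable_nn_integral)
qed

lemma distr_Xact:
  assumes m: "invariant_prob n m" and h: "h \<in> SLR n"
  shows "distr m m (\<lambda>x. Xact n x h) = m"
proof (rule measure_eqI)
  have sm: "sets m = sets (Xborel n)" using m by (simp add: invariant_prob_def)
  then have spm: "space m = Xsp n" by (rule space_eq_Xsp)
  fix E assume "E \<in> sets (distr m m (\<lambda>x. Xact n x h))"
  then have E: "E \<in> sets m" by simp
  have act: "(\<lambda>x. Xact n x h) \<in> m \<rightarrow>\<^sub>M m" using Xact_measurable[OF h] measurable_cong_sets[OF sm sm] by blast
  have ES: "E \<subseteq> Xsp n" using E sm Union_Xborel(1) by blast
  have "emeasure (distr m m (\<lambda>x. Xact n x h)) E = emeasure m ((\<lambda>x. Xact n x h) -` E \<inter> Xsp n)"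
    using act E by (simp add: emeasure_distr spm)
  also have "(\<lambda>x. Xact n x h) -` E \<inter> Xsp n = (\<lambda>x. Xact n x (minv n h)) ` E"
    using Xact_image_eq_vimage[OF ES minv_SLR[OF h]] by (simp add: minv_minv[OF h])
  also have "emeasure m \<dots> = emeasure m E" using m E minv_SLR[OF h] by (simp add: invariant_prob_def)
  finally show "emeasure (distr m m (\<lambda>x. Xact n x h)) E = emeasure m E" .
qed simp

text \<open>The sum of \<open>f\<close> over all representatives of \<open>x\<close>, the sum in
  unfolding. The section supplies a base point that depends measurably on \<open>x\<close>.\<close>

definition orbit_sum :: "nat \<Rightarrow> rmat set \<Rightarrow> (rmat \<Rightarrow> ennreal) \<Rightarrow> rmat set \<Rightarrow> ennreal" where
  "orbit_sum n F f x = (\<integral>\<^sup>+\<gamma>. f (mmul n \<gamma> (sec F x)) \<partial>count_space (SLZ n))"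

text \<open>The base point of the translated coset is the translated base point up to some
  \<open>\<delta>\<close> in \<open>SLZ\<close>; right multiplication by \<open>\<delta>\<close>
  merely permutes the summands.\<close>

lemma orbit_sum_Xact:
  assumes F: "fund_dom n F" and x: "x \<in> Xsp n" and h: "h \<in> SLR n"
  shows "orbit_sum n F f (Xact n x h) = orbit_sum n F (\<lambda>g. f (mmul n g h)) x"
proof -
  let ?s = "sec F x" and ?y = "sec F (Xact n x h)"
  have s: "?s \<in> SLR n" "coset n ?s = x" using sec_props[OF F x] by auto
  have "Xact n x h = coset n (mmul n ?s h)" using s(2) Xact_coset[of n ?s h] by simp
  then have "?y \<in> coset n (mmul n ?s h)" using sec_props(1)[OF F Xact_Xsp[OF x h]] by metis
  then obtain \<delta> where d: "\<delta> \<in> SLZ n" "?y = mmul n \<delta> (mmul n ?s h)" unfolding coset_def by blast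
  have bij: "bij_betw (\<lambda>\<gamma>. mmul n \<gamma> \<delta>) (SLZ n) (SLZ n)"
    by (rule bij_betw_byWitness[where f' = "\<lambda>\<gamma>. mmul n \<gamma> (minv n \<delta>)"])
      (use d in \<open>auto simp: mmul_cancel_right SLZ_SLR SLR_mat_n intro: mmul_SLZ minv_SLZ\<close>)
  have "orbit_sum n F f (Xact n x h) = (\<integral>\<^sup>+\<gamma>. f (mmul n (mmul n \<gamma> \<delta>) (mmul n ?s h)) \<partial>count_space (SLZ n))"
    by (simp add: orbit_sum_def d(2) mmul_assoc)
  also have "\<dots> = (\<integral>\<^sup>+\<gamma>. f (mmul n \<gamma> (mmul n ?s h)) \<partial>count_space (SLZ n))"
    by (rule nn_integral_bij_count_space[OF bij])
  finally show ?thesis by (simp add: orbit_sum_def mmul_assoc)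
qed

lemma sec_measurable_cong:
  assumes "fund_dom n F" "sets m = sets (Xborel n)" shows "sec F \<in> m \<rightarrow>\<^sub>M borel"
  using sec_measurable[OF assms(1)] measurable_cong_sets[OF assms(2) refl] by blast

lemma orbit_sum_measurable:
  assumes F: "fund_dom n F" and sm: "sets m = sets (Xborel n)" and [measurable]: "f \<in> borel_measurable borel"
  shows "orbit_sum n F f \<in> borel_measurable m"
proof -
  note [measurable] = sec_measurable_cong[OF F sm]
  show ?thesis unfolding orbit_sum_def[abs_def]
    by (rule borel_measurable_nn_integral_count_space[OF countable_SLZ]) measurable
qed

lemma nn_integral_orbit_sum_right:
  assumes F: "fund_dom n F" and m: "invariant_prob n m" and h: "h \<in> SLR n" and [measurable]: "f \<in> borel_measurable borel"
  shows "(\<integral>\<^sup>+x. orbit_sum n F (\<lambda>g. f (mmul n g h)) x \<partial>m) = (\<integral>\<^sup>+x. orbit_sum n F f x \<partial>m)"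
proof -
  have sm: "sets m = sets (Xborel n)" using m by (simp add: invariant_prob_def)
  then have spm: "space m = Xsp n" by (rule space_eq_Xsp)
  have act: "(\<lambda>x. Xact n x h) \<in> m \<rightarrow>\<^sub>M m" using Xact_measurable[OF h] measurable_cong_sets[OF sm sm] by blast
  have "(\<integral>\<^sup>+x. orbit_sum n F (\<lambda>g. f (mmul n g h)) x \<partial>m) = (\<integral>\<^sup>+x. orbit_sum n F f (Xact n x h) \<partial>m)"
    by (rule nn_integral_cong) (simp add: orbit_sum_Xact[OF F _ h] spm)
  also have "\<dots> = (\<integral>\<^sup>+x. orbit_sum n F f x \<partial>distr m m (\<lambda>x. Xact n x h))"
    by (rule nn_integral_distr[symmetric, OF act]) (simp add: orbit_sum_measurable[OF F sm assms(4)])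
  finally show ?thesis by (simp add: distr_Xact[OF m h])
qed

text \<open>Tonelli twice: the Haar integral is exchanged with \<open>m\<close>, and then with the
  countable sum over \<open>SLZ\<close>.\<close>

lemma nn_integral_haar_orbit_sum_swap:
  assumes n: "n \<ge> 1" and F: "fund_dom n F" and m: "invariant_prob n m"
    and [measurable]: "(\<lambda>p. \<Psi> (fst p) (snd p)) \<in> borel_measurable (borel \<Otimes>\<^sub>M borel)"
  shows "(\<integral>\<^sup>+h. (\<integral>\<^sup>+x. orbit_sum n F (\<Psi> h) x \<partial>m) \<partial>haar n) =
    (\<integral>\<^sup>+x. orbit_sum n F (\<lambda>g. \<integral>\<^sup>+h. \<Psi> h g \<partial>haar n) x \<partial>m)"
proof -
  interpret H: sigma_finite_measure "haar n" by (rule sigma_finite_haar[OF n])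
  interpret P: prob_space m using m by (simp add: invariant_prob_def)
  interpret PS: pair_sigma_finite "haar n" m by standard
  have sm: "sets m = sets (Xborel n)" using m by (simp add: invariant_prob_def)
  note [measurable] = sec_measurable_cong[OF F sm]
  have M1: "(\<lambda>p. \<Psi> (fst p) (mmul n \<gamma> (sec F (snd p)))) \<in> borel_measurable (haar n \<Otimes>\<^sub>M m)" for \<gamma>
  proof -
    have "(\<lambda>p. (fst p, mmul n \<gamma> (sec F (snd p)))) \<in> haar n \<Otimes>\<^sub>M m \<rightarrow>\<^sub>M borel \<Otimes>\<^sub>M borel" by measurable
    from measurable_compose[OF this assms(4)] show ?thesis by simp
  qed
  have M2: "(\<lambda>h. \<Psi> h g) \<in> borel_measurable (haar n)" for g
  proof -
    have "(\<lambda>h. (h, g)) \<in> haar n \<rightarrow>\<^sub>M borel \<Otimes>\<^sub>M borel" by measurable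
    from measurable_compose[OF this assms(4)] show ?thesis by simp
  qed
  have "(\<lambda>p. orbit_sum n F (\<Psi> (fst p)) (snd p)) \<in> borel_measurable (haar n \<Otimes>\<^sub>M m)"
    unfolding orbit_sum_def by (rule borel_measurable_nn_integral_count_space[OF countable_SLZ M1])
  then have "(\<lambda>(h, x). orbit_sum n F (\<Psi> h) x) \<in> borel_measurable (haar n \<Otimes>\<^sub>M m)" by (simp add: split_beta')
  from PS.Fubini'[OF this]
  have "(\<integral>\<^sup>+h. (\<integral>\<^sup>+x. orbit_sum n F (\<Psi> h) x \<partial>m) \<partial>haar n) = (\<integral>\<^sup>+x. (\<integral>\<^sup>+h. orbit_sum n F (\<Psi> h) x \<partial>haar n) \<partial>m)"
    by (rule sym)
  also have "\<dots> = (\<integral>\<^sup>+x. orbit_sum n F (\<lambda>g. \<integral>\<^sup>+h. \<Psi> h g \<partial>haar n) x \<partial>m)"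
    unfolding orbit_sum_def
    by (intro nn_integral_cong nn_integral_count_space_nn_integral[OF countable_SLZ] M2)
  finally show ?thesis .
qed

text \<open>The orbit meets \<open>F\<close> only at the base point, so only the identity can
  contribute.\<close>

lemma orbit_sum_indicator:
  assumes F: "fund_dom n F" and x: "x \<in> Xsp n" and E: "E \<subseteq> Xsp n"
  shows "orbit_sum n F (indicator (\<Union>E \<inter> F)) x = indicator E x"
proof -
  note s = sec_props[OF F x]
  have "mmul n \<gamma> (sec F x) \<in> \<Union>E \<inter> F \<longleftrightarrow> \<gamma> = idn n \<and> x \<in> E" if "\<gamma> \<in> SLZ n" for \<gamma>
  proof (cases "\<gamma> = idn n")
    case True
    then show ?thesis using s Union_Xsp[OF E] by (simp add: mmul_idn_left SLR_mat_n)
  next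
    case False
    then have "mmul n \<gamma> (sec F x) \<notin> F"
      using fund_dom_inj[OF F s(3) that idn_SLZ] s by (auto simp: mmul_idn_left SLR_mat_n)
    then show ?thesis using False by simp
  qed
  then have "orbit_sum n F (indicator (\<Union>E \<inter> F)) x = (\<integral>\<^sup>+\<gamma>. indicator {idn n} \<gamma> * indicator E x \<partial>count_space (SLZ n))"
    unfolding orbit_sum_def by (intro nn_integral_cong) (simp add: indicator_def)
  then show ?thesis by (simp add: nn_integral_multc)
qed

text \<open>Evaluate in two ways the integral over \<open>h\<close> and \<open>x\<close> of the
  orbit sum of \<open>k g * f (g h)\<close>, where \<open>k\<close> and \<open>f\<close> are the
  indicators of \<open>\<Union>E \<inter> F\<close> and \<open>F\<close>. Integrating
  \<open>f\<close> over \<open>h\<close> first, left invariance of Haar measure gives the left-hand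
  side. Translating by \<open>h\<close> under \<open>m\<close> first turns the integrand into
  \<open>k\<close> at \<open>g\<close> times the inverse of \<open>h\<close>, times
  \<open>f g\<close>, and right invariance gives the right-hand side. The point is that the latter
  does not mention \<open>m\<close>.\<close>

lemma invariant_prob_formula:
  assumes n: "n \<ge> 1" and F: "fund_dom n F" and m: "invariant_prob n m" and E: "E \<in> sets (Xborel n)"
  shows "emeasure (haar n) F * emeasure m E = (\<integral>\<^sup>+h. indicator (\<Union>E \<inter> F) (minv n h) \<partial>haar n)"
proof -
  interpret P: prob_space m using m by (simp add: invariant_prob_def)
  have sm: "sets m = sets (Xborel n)" using m by (simp add: invariant_prob_def)
  then have spm: "space m = Xsp n" by (rule space_eq_Xsp)
  note ES = Union_Xborel(1)[OF E]
  have Fm [measurable]: "F \<in> sets borel" and FS: "F \<subseteq> SLR n" using F by (simp_all add: fund_dom_def)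
  have [measurable]: "\<Union>E \<in> sets borel" by (rule Union_Xborel(2)[OF E])
  define k f :: "rmat \<Rightarrow> ennreal" where "k = indicator (\<Union>E \<inter> F)" and "f = indicator F"
  have [measurable]: "k \<in> borel_measurable borel" "f \<in> borel_measurable borel" by (simp_all add: k_def f_def)
  have sS: "mmul n \<gamma> (sec F x) \<in> SLR n" if "x \<in> Xsp n" "\<gamma> \<in> SLZ n" for x \<gamma>
    using sec_props(3)[OF F that(1)] that by (simp add: mmul_SLR SLZ_SLR)
  have AEh: "AE h in haar n. h \<in> SLR n"
    using haar_not_SLR[OF n] by (intro AE_I[of _ _ "- SLR n"]) auto
  have Sk: "(\<integral>\<^sup>+x. orbit_sum n F k x \<partial>m) = emeasure m E"
  proof -
    have "(\<integral>\<^sup>+x. orbit_sum n F k x \<partial>m) = (\<integral>\<^sup>+x. indicator E x \<partial>m)"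
      by (rule nn_integral_cong) (simp add: k_def orbit_sum_indicator[OF F _ ES] spm)
    then show ?thesis using E sm by simp
  qed
  have Sf: "(\<integral>\<^sup>+x. orbit_sum n F f x \<partial>m) = 1"
  proof -
    have "\<Union>(Xsp n) \<inter> F = F" using Union_Xsp[of "Xsp n" n] FS by (auto simp: Xsp_def)
    then have "(\<integral>\<^sup>+x. orbit_sum n F f x \<partial>m) = (\<integral>\<^sup>+x. indicator (Xsp n) x \<partial>m)"
      using orbit_sum_indicator[OF F _ order_refl] by (intro nn_integral_cong) (simp add: f_def spm)
    then show ?thesis using P.emeasure_space_1 spm sets.top[of m] by simp
  qed
  have "(\<integral>\<^sup>+h. (\<integral>\<^sup>+x. orbit_sum n F (\<lambda>g. k g * f (mmul n g h)) x \<partial>m) \<partial>haar n) =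
      (\<integral>\<^sup>+x. orbit_sum n F (\<lambda>g. \<integral>\<^sup>+h. k g * f (mmul n g h) \<partial>haar n) x \<partial>m)"
    by (rule nn_integral_haar_orbit_sum_swap[OF n F m]) measurable
  also have "\<dots> = (\<integral>\<^sup>+x. emeasure (haar n) F * orbit_sum n F k x \<partial>m)"
  proof (rule nn_integral_cong)
    fix x assume "x \<in> space m"
    then have x: "x \<in> Xsp n" by (simp add: spm)
    have "(\<integral>\<^sup>+h. k g * f (mmul n g h) \<partial>haar n) = emeasure (haar n) F * k g" if "g \<in> SLR n" for g
    proof -
      have "(\<integral>\<^sup>+h. k g * f (mmul n g h) \<partial>haar n) = k g * (\<integral>\<^sup>+h. f (mmul n g h) \<partial>haar n)"
        by (rule nn_integral_cmult) measurable
      also have "(\<integral>\<^sup>+h. f (mmul n g h) \<partial>haar n) = (\<integral>\<^sup>+h. f h \<partial>haar n)" by (rule nn_integral_haar_left[OF that]) measurable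
      finally show ?thesis by (simp add: f_def mult.commute)
    qed
    then have "orbit_sum n F (\<lambda>g. \<integral>\<^sup>+h. k g * f (mmul n g h) \<partial>haar n) x =
        (\<integral>\<^sup>+\<gamma>. emeasure (haar n) F * k (mmul n \<gamma> (sec F x)) \<partial>count_space (SLZ n))"
      unfolding orbit_sum_def using sS[OF x] by (intro nn_integral_cong) simp
    also have "\<dots> = emeasure (haar n) F * orbit_sum n F k x" unfolding orbit_sum_def by (rule nn_integral_cmult) simp
    finally show "orbit_sum n F (\<lambda>g. \<integral>\<^sup>+h. k g * f (mmul n g h) \<partial>haar n) x = emeasure (haar n) F * orbit_sum n F k x" .
  qed
  also have "\<dots> = emeasure (haar n) F * emeasure m E"
    by (subst nn_integral_cmult) (auto simp: Sk intro: orbit_sum_measurable[OF F sm])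
  finally have A1: "(\<integral>\<^sup>+h. (\<integral>\<^sup>+x. orbit_sum n F (\<lambda>g. k g * f (mmul n g h)) x \<partial>m) \<partial>haar n) = emeasure (haar n) F * emeasure m E" .
  have "(\<integral>\<^sup>+h. (\<integral>\<^sup>+x. orbit_sum n F (\<lambda>g. k g * f (mmul n g h)) x \<partial>m) \<partial>haar n) =
      (\<integral>\<^sup>+h. (\<integral>\<^sup>+x. orbit_sum n F (\<lambda>g. k (mmul n g (minv n h)) * f g) x \<partial>m) \<partial>haar n)"
  proof (rule nn_integral_cong_AE, use AEh in eventually_elim)
    fix h assume h: "h \<in> SLR n"
    have "(\<integral>\<^sup>+x. orbit_sum n F (\<lambda>g. k g * f (mmul n g h)) x \<partial>m) =
        (\<integral>\<^sup>+x. orbit_sum n F (\<lambda>g. k (mmul n (mmul n g h) (minv n h)) * f (mmul n g h)) x \<partial>m)"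
      unfolding orbit_sum_def
      by (intro nn_integral_cong) (simp add: mmul_cancel_right[OF h] spm)
    also have "\<dots> = (\<integral>\<^sup>+x. orbit_sum n F (\<lambda>g. k (mmul n g (minv n h)) * f g) x \<partial>m)"
      by (rule nn_integral_orbit_sum_right[OF F m h, of "\<lambda>g. k (mmul n g (minv n h)) * f g"]) measurable
    finally show "(\<integral>\<^sup>+x. orbit_sum n F (\<lambda>g. k g * f (mmul n g h)) x \<partial>m) =
      (\<integral>\<^sup>+x. orbit_sum n F (\<lambda>g. k (mmul n g (minv n h)) * f g) x \<partial>m)" .
  qed
  also have "\<dots> = (\<integral>\<^sup>+x. orbit_sum n F (\<lambda>g. \<integral>\<^sup>+h. k (mmul n g (minv n h)) * f g \<partial>haar n) x \<partial>m)"
    by (rule nn_integral_haar_orbit_sum_swap[OF n F m]) measurable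
  also have "\<dots> = (\<integral>\<^sup>+x. (\<integral>\<^sup>+h. k (minv n h) \<partial>haar n) * orbit_sum n F f x \<partial>m)"
  proof (rule nn_integral_cong)
    fix x assume "x \<in> space m"
    then have x: "x \<in> Xsp n" by (simp add: spm)
    have "(\<integral>\<^sup>+h. k (mmul n g (minv n h)) * f g \<partial>haar n) = (\<integral>\<^sup>+h. k (minv n h) \<partial>haar n) * f g" if g: "g \<in> SLR n" for g
    proof -
      have "(\<integral>\<^sup>+h. k (mmul n g (minv n h)) * f g \<partial>haar n) = (\<integral>\<^sup>+h. k (mmul n g (minv n h)) \<partial>haar n) * f g"
        by (rule nn_integral_multc) measurable
      \<comment> \<open>The argument of \<open>k\<close> is the inverse of \<open>h\<close> times
        the inverse of \<open>g\<close>, so a right translation of \<open>h\<close> removes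
        \<open>g\<close>.\<close>
      also have "(\<integral>\<^sup>+h. k (mmul n g (minv n h)) \<partial>haar n) = (\<integral>\<^sup>+h. k (minv n (mmul n h (minv n g))) \<partial>haar n)"
        by (rule nn_integral_cong_AE, use AEh in eventually_elim) (simp add: minv_mmul minv_SLR minv_minv g)
      also have "\<dots> = (\<integral>\<^sup>+h. k (minv n h) \<partial>haar n)"
        by (rule nn_integral_haar_right[OF minv_SLR[OF g], of "\<lambda>h. k (minv n h)"]) measurable
      finally show ?thesis .
    qed
    then have "orbit_sum n F (\<lambda>g. \<integral>\<^sup>+h. k (mmul n g (minv n h)) * f g \<partial>haar n) x =
        (\<integral>\<^sup>+\<gamma>. (\<integral>\<^sup>+h. k (minv n h) \<partial>haar n) * f (mmul n \<gamma> (sec F x)) \<partial>count_space (SLZ n))"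
      unfolding orbit_sum_def using sS[OF x] by (intro nn_integral_cong) simp
    also have "\<dots> = (\<integral>\<^sup>+h. k (minv n h) \<partial>haar n) * orbit_sum n F f x" unfolding orbit_sum_def by (rule nn_integral_cmult) simp
    finally show "orbit_sum n F (\<lambda>g. \<integral>\<^sup>+h. k (mmul n g (minv n h)) * f g \<partial>haar n) x =
      (\<integral>\<^sup>+h. k (minv n h) \<partial>haar n) * orbit_sum n F f x" .
  qed
  also have "\<dots> = (\<integral>\<^sup>+h. k (minv n h) \<partial>haar n)"
    by (subst nn_integral_cmult) (auto simp: Sf intro: orbit_sum_measurable[OF F sm])
  finally show ?thesis using A1 by (simp add: k_def)
qed

text \<open>Both measures satisfy the same formula, and the factor \<open>haar n F\<close> can be
  cancelled, being neither zero nor infinite.\<close>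

lemma invariant_prob_unique:
  assumes n: "n \<ge> 1" and m: "invariant_prob n m" "invariant_prob n m'"
  shows "m = m'"
proof (rule measure_eqI)
  obtain F where F: "fund_dom n F" using exists_fund_dom by blast
  have sm: "sets m = sets (Xborel n)" "sets m' = sets (Xborel n)" using m by (simp_all add: invariant_prob_def)
  then show "sets m = sets m'" by simp
  fix E assume "E \<in> sets m"
  then have E: "E \<in> sets (Xborel n)" using sm by simp
  have "emeasure (haar n) F * emeasure m E = emeasure (haar n) F * emeasure m' E"
    using invariant_prob_formula[OF n F m(1) E] invariant_prob_formula[OF n F m(2) E] by simp
  then show "emeasure m E = emeasure m' E"
    using haar_fund_dom_pos[OF n F] haar_fund_dom_finite[OF n F] by (auto simp: ennreal_mult_cancel_left)
qed

lemma invariant_prob_Xmu: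
  assumes n: "n \<ge> 1" shows "invariant_prob n (Xmu n)"
proof -
  have "\<exists>!m. invariant_prob n m"
    using exists_invariant_prob[OF n] invariant_prob_unique[OF n] by (intro ex_ex1I)
  then have "invariant_prob n (THE m. invariant_prob n m)" by (rule theI')
  then show ?thesis unfolding Xmu_def invariant_prob_def .
qed

section \<open>Primitive vectors on null sets\<close>

lemma countable_primitive: "countable {w. primitive n w}"
  by (rule countable_subset[OF _ countable_integer_vectors[of n]]) (auto simp: primitive_def)

lemma primitive_vec_n: "primitive n w \<Longrightarrow> w \<in> vec_n n"
  by (simp add: primitive_def)

lemma vmul_zero: "vmul n (\<lambda>_. 0) g = (\<lambda>_. 0)"
  by (auto simp: vmul_def)

text \<open>A common divisor of \<open>w \<gamma>\<close> would also divide \<open>w\<close>, which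
  is recovered by the integral inverse of \<open>\<gamma>\<close>.\<close>

lemma primitive_vmul_SLZ:
  assumes w: "primitive n w" and g: "\<gamma> \<in> SLZ n"
  shows "primitive n (vmul n w \<gamma>)"
proof -
  have c: "vmul n (vmul n w \<gamma>) (minv n \<gamma>) = w"
    using w g by (simp add: vmul_cancel SLZ_SLR primitive_vec_n)
  have "\<not> (\<exists>d::int. d \<ge> 2 \<and> (\<forall>i<n. \<exists>z::int. vmul n w \<gamma> i = of_int d * of_int z))"
  proof
    assume "\<exists>d::int. d \<ge> 2 \<and> (\<forall>i<n. \<exists>z::int. vmul n w \<gamma> i = of_int d * of_int z)"
    then obtain d :: int and z :: "nat \<Rightarrow> int" where d: "d \<ge> 2" and z: "\<And>i. i < n \<Longrightarrow> vmul n w \<gamma> i = of_int d * of_int (z i)"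
      by metis
    have "\<exists>y::int. w j = of_int d * of_int y" if "j < n" for j
    proof -
      have "w j = (\<Sum>i<n. vmul n w \<gamma> i * minv n \<gamma> i j)"
        using fun_cong[OF c, of j] that by (simp add: vmul_def)
      also have "\<dots> = of_int d * (\<Sum>i<n. of_int (z i) * minv n \<gamma> i j)"
        using z by (simp add: sum_distrib_left mult.assoc)
      finally have e: "w j = of_int d * (\<Sum>i<n. of_int (z i) * minv n \<gamma> i j)" .
      have "(\<Sum>i<n. of_int (z i) * minv n \<gamma> i j) \<in> \<int>"
        using minv_SLZ[OF g] by (intro Ints_sum Ints_mult) (auto simp: SLZ_def)
      with e show ?thesis by (auto elim!: Ints_cases)
    qed
    then show False using w d unfolding primitive_def by blast
  qed
  moreover have "vmul n w \<gamma> i \<in> \<int>" for i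
    using w g unfolding vmul_def by (auto simp: primitive_def SLZ_def intro!: Ints_sum Ints_mult)
  moreover have "vmul n w \<gamma> \<noteq> (\<lambda>_. 0)"
    using c w by (auto simp: vmul_zero primitive_def)
  ultimately show ?thesis by (simp add: primitive_def)
qed

lemma primlat_coset:
  assumes "g \<in> SLR n"
  shows "primlat n (coset n g) = (\<lambda>w. vmul n w g) ` {w. primitive n w}"
proof
  show "primlat n (coset n g) \<subseteq> (\<lambda>w. vmul n w g) ` {w. primitive n w}"
    by (auto simp: primlat_def coset_def vmul_mmul[symmetric] intro!: imageI primitive_vmul_SLZ)
  show "(\<lambda>w. vmul n w g) ` {w. primitive n w} \<subseteq> primlat n (coset n g)"
    using self_in_coset[OF assms] by (auto simp: primlat_def)
qed

lemma inj_on_vmul: "g \<in> SLR n \<Longrightarrow> inj_on (\<lambda>w. vmul n w g) (vec_n n)"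
  by (rule inj_on_inverseI[where g = "\<lambda>v. vmul n v (minv n g)"]) (simp add: vmul_cancel)

lemma primlat_Xact:
  assumes "x \<in> Xsp n" "h \<in> SLR n"
  shows "primlat n (Xact n x h) = (\<lambda>v. vmul n v h) ` primlat n x"
proof -
  obtain g where g: "g \<in> SLR n" "x = coset n g" using assms(1) by (auto simp: Xsp_def)
  show ?thesis using g assms(2) by (auto simp: Xact_coset primlat_coset mmul_SLR vmul_mmul image_image)
qed

lemma primlat_vec_n:
  assumes "v \<in> primlat n x" shows "v \<in> vec_n n"
  using assms by (auto simp: primlat_def)

lemma primlat_nonzero:
  assumes x: "x \<in> Xsp n" and v: "v \<in> primlat n x"
  shows "\<exists>i<n. v i \<noteq> 0"
proof (rule ccontr)
  assume "\<not> ?thesis"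
  then have v0: "v = (\<lambda>_. 0)" using primlat_vec_n[OF v] by (auto simp: vec_n_def fun_eq_iff) (metis not_less)
  obtain g where g: "g \<in> SLR n" "x = coset n g" using x by (auto simp: Xsp_def)
  then obtain w where w: "primitive n w" "v = vmul n w g" using v by (auto simp: primlat_coset)
  then have "w = vmul n v (minv n g)" using g by (simp add: vmul_cancel primitive_vec_n)
  then show False using w(1) v0 by (simp add: vmul_zero primitive_def)
qed

section \<open>Averaging over transvections\<close>

lemma vmul_measurable [measurable (raw)]:
  fixes v :: "'a \<Rightarrow> nat \<Rightarrow> real"
  assumes "v \<in> borel_measurable M" "g \<in> borel_measurable M"
  shows "(\<lambda>x. vmul n (v x) (g x)) \<in> borel_measurable M"
proof (rule measurable_coordinatewise_then_product)
  fix j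
  note [measurable] = borel_measurable_entry[OF assms(2)] measurable_product_then_coordinatewise[OF assms(1)]
  show "(\<lambda>x. vmul n (v x) (g x) j) \<in> borel_measurable M"
    unfolding vmul_def by (cases "j < n") simp_all
qed

lemma primlat_avoids_Xborel:
  assumes S: "S \<in> sets borel"
  shows "{x \<in> Xsp n. primlat n x \<inter> S = {}} \<in> sets (Xborel n)"
proof (rule Xborel_CollectI)
  fix g assume "g \<in> SLR n"
  then show "primlat n (coset n g) \<inter> S = {} \<longleftrightarrow> (\<forall>w\<in>{w. primitive n w}. vmul n w g \<notin> S)"
    by (auto simp: primlat_coset)
next
  note [measurable] = S
  have "{g \<in> space borel. g \<in> SLR n \<and> (\<forall>w\<in>{w. primitive n w}. vmul n w g \<notin> S)} \<in> sets borel"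
    by (intro sets.sets_Collect_conj sets.sets_Collect_countable_All'[OF _ countable_primitive]) measurable
  then show "{g \<in> SLR n. \<forall>w\<in>{w. primitive n w}. vmul n w g \<notin> S} \<in> sets borel" by simp
qed

text \<open>Right multiplication by \<open>transvec n i u\<close> moves \<open>v\<close> to \<open>v + v\<^sub>i u\<close> and preserves \<open>m\<close>. Averaging over
  the random vector \<open>u\<close> thus reduces the claim to a null condition on each lattice vector separately.\<close>
lemma AE_primlat_avoids:
  fixes u :: "'p \<Rightarrow> nat \<Rightarrow> real"
  assumes m: "invariant_prob n m" and P: "sigma_finite_measure P" "emeasure P (space P) \<noteq> 0"
    and u: "\<And>j. (\<lambda>\<omega>. u \<omega> j) \<in> borel_measurable P" "\<And>\<omega>. u \<omega> i = 0" and i: "i < n"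
    and S: "S \<in> sets borel" "\<And>y. y \<in> S \<Longrightarrow> y i \<noteq> 0"
    and null: "\<And>w. w \<in> vec_n n \<Longrightarrow> w i \<noteq> 0 \<Longrightarrow> AE \<omega> in P. (\<lambda>j. if j < n then w j + w i * u \<omega> j else 0) \<notin> S"
  shows "AE x in m. primlat n x \<inter> S = {}"
proof -
  interpret P: sigma_finite_measure P by (rule P)
  interpret M: prob_space m using m by (simp add: invariant_prob_def)
  interpret PM: pair_sigma_finite P m by standard
  have sm: "sets m = sets (Xborel n)" using m by (simp add: invariant_prob_def)
  then have spm: "space m = Xsp n" by (rule space_eq_Xsp)
  obtain F where F: "fund_dom n F" using exists_fund_dom by blast
  define T where "T \<omega> = transvec n i (u \<omega>)" for \<omega>
  have T: "T \<omega> \<in> SLR n" for \<omega> unfolding T_def by (rule transvec_SLR) (rule u(2))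
  have vT: "vmul n v (T \<omega>) = (\<lambda>j. if j < n then v j + v i * u \<omega> j else 0)" for v \<omega>
    using i by (auto simp: T_def vmul_transvec)
  note [measurable] = u(1) S(1) sec_measurable_cong[OF F sm]
  have [measurable]: "T \<in> borel_measurable P"
  proof (rule borel_measurable_rmatI)
    fix a b show "(\<lambda>\<omega>. T \<omega> a b) \<in> borel_measurable P"
      unfolding T_def transvec_def by (cases "a = i \<and> i < n \<and> b < n") simp_all
  qed
  have pl: "primlat n (Xact n x (T \<omega>)) \<inter> S = {} \<longleftrightarrow> (\<forall>w\<in>{w. primitive n w}. vmul n (vmul n w (sec F x)) (T \<omega>) \<notin> S)"
    if "x \<in> Xsp n" for x \<omega>
  proof -
    note s = sec_props[OF F that]
    have "primlat n x = (\<lambda>w. vmul n w (sec F x)) ` {w. primitive n w}" using primlat_coset[OF s(3)] s(4) by simp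
    then show ?thesis by (auto simp: primlat_Xact[OF that T])
  qed
  define Q where "Q \<omega> x \<longleftrightarrow> (\<forall>w\<in>{w. primitive n w}. vmul n (vmul n w (sec F x)) (T \<omega>) \<notin> S)" for \<omega> x
  have Qm: "{p \<in> space (P \<Otimes>\<^sub>M m). Q (fst p) (snd p)} \<in> sets (P \<Otimes>\<^sub>M m)"
    unfolding Q_def by (intro sets.sets_Collect_countable_All'[OF _ countable_primitive]) measurable
  have Qx: "AE \<omega> in P. Q \<omega> x" if "x \<in> Xsp n" for x
    unfolding Q_def
  proof (rule AE_ball_countable'[OF _ countable_primitive])
    fix w :: "nat \<Rightarrow> real"
    let ?v = "vmul n w (sec F x)"
    show "AE \<omega> in P. vmul n ?v (T \<omega>) \<notin> S"
    proof (cases "?v i = 0")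
      \<comment> \<open>A vanishing coordinate \<open>i\<close> stays zero under the transvection,
        and \<open>S\<close> contains no vector of this kind.\<close>
      case True
      then have "vmul n ?v (T \<omega>) i = 0" for \<omega> by (simp add: vT i)
      then show ?thesis using S(2) by (intro AE_I2) blast
    next
      case False
      then show ?thesis unfolding vT by (intro null) simp_all
    qed
  qed
  have "AE x in m. AE \<omega> in P. Q \<omega> x" by (rule AE_I2) (simp add: Qx spm)
  then have ae: "AE \<omega> in P. AE x in m. Q \<omega> x" using PM.AE_commute[OF Qm] by simp
  \<comment> \<open>As \<open>P\<close> is not the zero measure, some single parameter is good for
    almost every \<open>x\<close>; invariance under that one transvection then suffices.\<close>
  have "\<exists>\<omega>. AE x in m. Q \<omega> x"
  proof (rule ccontr)
    assume "\<not> ?thesis"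
    with ae have "AE \<omega> in P. False" by simp
    then show False using P(2) by (simp add: AE_iff_measurable[OF _ refl])
  qed
  then obtain \<omega> where "AE x in m. Q \<omega> x" by blast
  then have "AE x in m. primlat n (Xact n x (T \<omega>)) \<inter> S = {}"
    by (rule AE_mp, intro AE_I2 impI) (simp add: pl Q_def spm)
  moreover have act: "(\<lambda>x. Xact n x (T \<omega>)) \<in> m \<rightarrow>\<^sub>M m"
    using Xact_measurable[OF T] measurable_cong_sets[OF sm sm] by blast
  moreover have "{x \<in> space m. primlat n x \<inter> S = {}} \<in> sets m"
    using primlat_avoids_Xborel[OF S(1)] by (simp add: spm sm)
  ultimately have "AE x in distr m m (\<lambda>x. Xact n x (T \<omega>)). primlat n x \<inter> S = {}"
    by (simp add: AE_distr_iff)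
  then show ?thesis unfolding distr_Xact[OF m T] .
qed

text \<open>Each lattice vector has a nonzero coordinate \<open>i\<close>. Adding
  \<open>\<omega>\<close> times it to coordinate \<open>j\<close> makes the latter vanish for
  exactly one \<open>\<omega>\<close>.\<close>

lemma AE_primlat_coordinates_nonzero:
  assumes m: "invariant_prob n m" and n: "n \<ge> 2"
  shows "AE x in m. \<forall>v\<in>primlat n x. \<forall>j<n. v j \<noteq> 0"
proof -
  have spm: "space m = Xsp n" using m by (simp add: invariant_prob_def space_eq_Xsp)
  have "AE x in m. primlat n x \<inter> {y. y i \<noteq> 0 \<and> y j = 0} = {}" if ij: "i < n" "j < n" "i \<noteq> j" for i j
  proof (rule AE_primlat_avoids[OF m, where P = lborel and i = i and u = "\<lambda>\<omega> l. if l = j then \<omega> else 0"])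
    have "{y \<in> space borel. (y::nat \<Rightarrow> real) i \<noteq> 0 \<and> y j = 0} \<in> sets borel" by measurable
    then show "{y::nat \<Rightarrow> real. y i \<noteq> 0 \<and> y j = 0} \<in> sets borel" by simp
    fix w :: "nat \<Rightarrow> real" assume "w i \<noteq> 0"
    then have "w j + w i * \<omega> = 0 \<longleftrightarrow> \<omega> = - w j / w i" for \<omega> by (auto simp: field_simps)
    moreover have "AE \<omega> in lborel. \<omega> \<noteq> - w j / w i" by (rule AE_lborel_singleton)
    ultimately show "AE \<omega> in lborel. (\<lambda>l. if l < n then w l + w i * (if l = j then \<omega> else 0) else 0) \<notin> {y. y i \<noteq> 0 \<and> y j = 0}"
      using ij by simp
  qed (use ij in \<open>auto intro: lborel.sigma_finite_measure_axioms\<close>)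
  then have "AE x in m. \<forall>p\<in>{p \<in> {..<n} \<times> {..<n}. fst p \<noteq> snd p}. primlat n x \<inter> {y. y (fst p) \<noteq> 0 \<and> y (snd p) = 0} = {}"
    by (subst AE_ball_countable) (auto intro!: countable_finite)
  then show ?thesis
  proof (rule AE_mp, intro AE_I2 impI ballI allI notI)
    fix x v j assume *: "\<forall>p\<in>{p \<in> {..<n} \<times> {..<n}. fst p \<noteq> snd p}. primlat n x \<inter> {y. y (fst p) \<noteq> 0 \<and> y (snd p) = 0} = {}"
      and v: "x \<in> space m" "v \<in> primlat n x" "j < n" "v j = 0"
    then obtain i where i: "i < n" "v i \<noteq> 0" using primlat_nonzero[of x n v] spm by auto
    then have "(i, j) \<in> {p \<in> {..<n} \<times> {..<n}. fst p \<noteq> snd p}" using v by auto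
    with * have "primlat n x \<inter> {y. y i \<noteq> 0 \<and> y j = 0} = {}" by fastforce
    then show False using v i by auto
  qed
qed

lemma AE_PiM_lborel_affine:
  fixes \<alpha> :: real and Z :: "('i \<Rightarrow> real) set"
  assumes "finite I" "\<alpha> \<noteq> 0" "Z \<in> null_sets (PiM I (\<lambda>_. lborel))"
  shows "AE x in PiM I (\<lambda>_. lborel). (\<lambda>i\<in>I. \<beta> i + \<alpha> * x i) \<notin> Z"
proof -
  let ?P = "PiM I (\<lambda>_. lborel :: real measure)" and ?f = "\<lambda>x. \<lambda>i\<in>I. \<alpha> * x i + \<beta> i"
  have "?f \<in> ?P \<rightarrow>\<^sub>M ?P" by (rule measurable_restrict) measurable
  then have s: "?f -` Z \<inter> space ?P \<in> sets ?P" by (rule measurable_sets) (use assms(3) in auto)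
  have "ennreal (\<bar>\<alpha>\<bar> ^ card I) * emeasure ?P (?f -` Z \<inter> space ?P) = 0"
    using PiM_lborel_affine[OF assms(1,2), of Z \<beta>] assms(3) by (simp add: null_sets_def)
  moreover have "\<bar>\<alpha>\<bar> ^ card I > 0" using assms(2) by simp
  ultimately have "emeasure ?P (?f -` Z \<inter> space ?P) = 0" by (simp add: ennreal_eq_0_iff not_le)
  with s show ?thesis by (intro AE_I[of _ _ "?f -` Z \<inter> space ?P"]) (auto simp: add.commute)
qed

lemma AE_lborel_affine:
  fixes \<alpha> \<beta> :: real
  assumes "\<alpha> \<noteq> 0" "AE t in lborel. Q t"
  shows "AE t in lborel. Q (\<beta> + \<alpha> * t)"
proof -
  obtain Z where Z: "Z \<in> null_sets lborel" "{t. \<not> Q t} \<subseteq> Z" using assms(2) by (auto simp: eventually_ae_filter)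
  have zb: "Z \<in> sets borel" using Z by auto
  have "emeasure (density (distr lborel borel (\<lambda>t. \<beta> + \<alpha> * t)) (\<lambda>_. ennreal \<bar>\<alpha>\<bar>)) Z = 0"
    using Z lborel_real_affine[OF assms(1), of \<beta>] by auto
  then have "emeasure lborel ((\<lambda>t. \<beta> + \<alpha> * t) -` Z) = 0"
    using assms(1) zb by (simp add: emeasure_density nn_integral_cmult emeasure_distr)
  then show ?thesis using Z zb by (intro AE_I[of _ _ "(\<lambda>t. \<beta> + \<alpha> * t) -` Z"]) (auto intro!: measurable_sets_borel)
qed

lemma PiM_lborel_component:
  "i \<in> I \<Longrightarrow> (\<lambda>f. f i) \<in> borel_measurable (PiM I (\<lambda>_. lborel :: real measure))"
  using measurable_component_singleton[of i I "\<lambda>_. lborel :: real measure"] by simp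

lemma emeasure_PiM_lborel_space_pos:
  "finite I \<Longrightarrow> emeasure (PiM I (\<lambda>_. lborel :: real measure)) (space (PiM I (\<lambda>_. lborel))) \<noteq> 0"
  using product_sigma_finite.emeasure_PiM[of "\<lambda>_. lborel :: real measure" I "\<lambda>_. UNIV"]
  by (simp add: space_PiM product_sigma_finite_def lborel.sigma_finite_measure_axioms)

lemma sigma_finite_PiM_lborel:
  "finite I \<Longrightarrow> sigma_finite_measure (PiM I (\<lambda>_. lborel :: real measure))"
  by (intro product_sigma_finite.sigma_finite) (simp_all add: product_sigma_finite_def lborel.sigma_finite_measure_axioms)

text \<open>Adding multiples of coordinate \<open>l\<close> to the first \<open>k\<close>
  coordinates translates the slope by the parameter itself, so the bad parameters form a translate
  of the null set \<open>Z\<close>.\<close>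

lemma AE_primlat_slope_avoids:
  assumes m: "invariant_prob n m" and kl: "k \<le> l" "l < n"
    and Z: "Z \<in> null_sets (PiM {..<k} (\<lambda>_. lborel :: real measure))"
  shows "AE x in m. primlat n x \<inter> {y. y l \<noteq> 0 \<and> (\<lambda>i\<in>{..<k}. y i / y l) \<in> Z} = {}"
proof (rule AE_primlat_avoids[OF m, where P = "PiM {..<k} (\<lambda>_. lborel)" and i = l and u = "\<lambda>\<omega> j. if j < k then \<omega> j else 0"])
  have [measurable]: "Z \<in> sets (PiM {..<k} (\<lambda>_. lborel))" using Z by auto
  have [measurable]: "(\<lambda>y::nat \<Rightarrow> real. \<lambda>i\<in>{..<k}. y i / y l) \<in> borel \<rightarrow>\<^sub>M PiM {..<k} (\<lambda>_. lborel)"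
    by (rule measurable_restrict) measurable
  have "{y \<in> space borel. (y::nat \<Rightarrow> real) l \<noteq> 0 \<and> (\<lambda>i\<in>{..<k}. y i / y l) \<in> Z} \<in> sets borel" by measurable
  then show "{y::nat \<Rightarrow> real. y l \<noteq> 0 \<and> (\<lambda>i\<in>{..<k}. y i / y l) \<in> Z} \<in> sets borel" by simp
  fix j show "(\<lambda>\<omega>. if j < k then \<omega> j else 0) \<in> borel_measurable (PiM {..<k} (\<lambda>_. lborel :: real measure))"
    by (cases "j < k") (auto intro: PiM_lborel_component)
  fix w :: "nat \<Rightarrow> real" assume w: "w l \<noteq> 0"
  have "(\<lambda>i\<in>{..<k}. (w i + w l * \<omega> i) / w l) = (\<lambda>i\<in>{..<k}. w i / w l + 1 * \<omega> i)" for \<omega> :: "nat \<Rightarrow> real"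
    using w by (auto simp: field_simps)
  moreover have "AE \<omega> in PiM {..<k} (\<lambda>_. lborel). (\<lambda>i\<in>{..<k}. w i / w l + 1 * \<omega> i) \<notin> Z"
    by (rule AE_PiM_lborel_affine) (use Z in auto)
  moreover have "(\<lambda>i\<in>{..<k}. (if i < n then w i + w l * (if i < k then \<omega> i else 0) else 0) / (if l < n then w l + w l * (if l < k then \<omega> l else 0) else 0))
      = (\<lambda>i\<in>{..<k}. (w i + w l * \<omega> i) / w l)" for \<omega> :: "nat \<Rightarrow> real"
    using kl by auto
  ultimately show "AE \<omega> in PiM {..<k} (\<lambda>_. lborel). (\<lambda>j. if j < n then w j + w l * (if j < k then \<omega> j else 0) else 0)
      \<notin> {y. y l \<noteq> 0 \<and> (\<lambda>i\<in>{..<k}. y i / y l) \<in> Z}"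
    by (elim AE_mp) (auto intro!: AE_I2)
qed (use kl in \<open>auto simp: emeasure_PiM_lborel_space_pos sigma_finite_PiM_lborel\<close>)

text \<open>Here the coordinates \<open>y''\<close> and \<open>y_n\<close> must move, so the pivot
  has to come from \<open>y'\<close>; coordinate 0 qualifies because \<open>k \<ge> 1\<close>. The
  pair is moved by \<open>w 0\<close> times a random vector.\<close>

lemma AE_primlat_section_avoids:
  assumes m: "invariant_prob (dimn k d) m" and k: "k \<ge> 1"
    and Z: "Z \<in> null_sets (PiM {..<d} (\<lambda>_. lborel :: real measure) \<Otimes>\<^sub>M lborel)"
  shows "AE x in m. primlat (dimn k d) x \<inter> {y. y 0 \<noteq> 0 \<and> (ydprime k d y, ylast k d y) \<in> Z} = {}"
proof -
  let ?D = "PiM {..<d} (\<lambda>_. lborel :: real measure)" and ?n = "dimn k d"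
  interpret D: sigma_finite_measure ?D by (rule sigma_finite_PiM_lborel) simp
  interpret DL: pair_sigma_finite ?D lborel by standard
  let ?u = "\<lambda>\<omega> j. if j < k then 0 else if j < k + d then fst \<omega> (j - k) else if j = k + d then snd \<omega> else (0::real)"
  have Zs [measurable]: "Z \<in> sets (?D \<Otimes>\<^sub>M (lborel :: real measure))" using Z by auto
  have "AE p in ?D \<Otimes>\<^sub>M lborel. p \<notin> Z" using Z by (rule AE_not_in)
  then have "AE \<omega> in ?D. AE t in lborel. (\<omega>, t) \<notin> Z" by (rule DL.AE_pair)
  \<comment> \<open>The product null set is handled by slices: outside the null set
    \<open>Z1\<close> of first components the slice is null, and the affine change of variables
    applies to each factor.\<close>
  then obtain Z1 where Z1: "Z1 \<in> null_sets ?D" "{\<omega> \<in> space ?D. \<not> (AE t in lborel. (\<omega>, t) \<notin> Z)} \<subseteq> Z1"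
    by (auto simp: eventually_ae_filter)
  show ?thesis
  proof (rule AE_primlat_avoids[OF m, where P = "?D \<Otimes>\<^sub>M lborel" and i = 0 and u = ?u])
    have [measurable]: "(\<lambda>y. ydprime k d y) \<in> borel \<rightarrow>\<^sub>M ?D"
      unfolding ydprime_def by (rule measurable_restrict) measurable
    have [measurable]: "(\<lambda>y. ylast k d y) \<in> borel \<rightarrow>\<^sub>M borel"
      unfolding ylast_def by measurable
    have "{y \<in> space borel. (y::nat \<Rightarrow> real) 0 \<noteq> 0 \<and> (ydprime k d y, ylast k d y) \<in> Z} \<in> sets borel" by measurable
    then show "{y::nat \<Rightarrow> real. y 0 \<noteq> 0 \<and> (ydprime k d y, ylast k d y) \<in> Z} \<in> sets borel" by simp
    fix j show "(\<lambda>\<omega>. ?u \<omega> j) \<in> borel_measurable (?D \<Otimes>\<^sub>M (lborel :: real measure))"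
    proof (cases "k \<le> j \<and> j < k + d")
      case True
      then have "(\<lambda>\<omega>. fst \<omega> (j - k)) \<in> borel_measurable (?D \<Otimes>\<^sub>M (lborel :: real measure))"
        by (intro measurable_compose[OF measurable_fst PiM_lborel_component]) auto
      with True show ?thesis by simp
    qed auto
  next
    show "sigma_finite_measure (?D \<Otimes>\<^sub>M (lborel :: real measure))" by (rule DL.sigma_finite_measure_axioms)
    have "emeasure (?D \<Otimes>\<^sub>M (lborel :: real measure)) (space ?D \<times> space lborel) = emeasure ?D (space ?D) * emeasure (lborel :: real measure) (space lborel)"
      by (rule lborel.emeasure_pair_measure_Times) auto
    then show "emeasure (?D \<Otimes>\<^sub>M (lborel :: real measure)) (space (?D \<Otimes>\<^sub>M (lborel :: real measure))) \<noteq> 0"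
      using emeasure_PiM_lborel_space_pos[of "{..<d}"] by (simp add: space_pair_measure)
  next
    fix w :: "nat \<Rightarrow> real" assume w: "w 0 \<noteq> 0"
    let ?a = "\<lambda>\<omega>. \<lambda>i\<in>{..<d}. w (k + i) + w 0 * \<omega> i" and ?b = "\<lambda>t. w (k + d) + w 0 * t"
    have "AE \<omega> in ?D. ?a \<omega> \<notin> Z1" by (rule AE_PiM_lborel_affine) (use w Z1 in auto)
    then have ae: "AE \<omega> in ?D. AE t in lborel. (?a \<omega>, ?b t) \<notin> Z"
    proof (rule AE_mp[OF _ AE_I2[OF impI]])
      fix \<omega> assume "?a \<omega> \<notin> Z1"
      moreover have "?a \<omega> \<in> space ?D" by (auto simp: space_PiM)
      ultimately have "AE t in lborel. (?a \<omega>, t) \<notin> Z" using Z1(2) by blast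
      then show "AE t in lborel. (?a \<omega>, ?b t) \<notin> Z" by (rule AE_lborel_affine[OF w])
    qed
    have ms: "{p \<in> space (?D \<Otimes>\<^sub>M (lborel :: real measure)). (?a (fst p), ?b (snd p)) \<notin> Z} \<in> sets (?D \<Otimes>\<^sub>M (lborel :: real measure))"
    proof -
      have [measurable]: "?a \<in> ?D \<rightarrow>\<^sub>M ?D" by (rule measurable_restrict) measurable
      show ?thesis by measurable
    qed
    have "AE p in ?D \<Otimes>\<^sub>M lborel. (?a (fst p), ?b (snd p)) \<notin> Z"
      by (rule DL.AE_pair_measure[OF ms], unfold fst_conv snd_conv) (rule ae)
    moreover have "ydprime k d (\<lambda>j. if j < ?n then w j + w 0 * ?u p j else 0) = ?a (fst p)"
      "ylast k d (\<lambda>j. if j < ?n then w j + w 0 * ?u p j else 0) = ?b (snd p)" for p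
      by (auto simp: ydprime_def ylast_def dimn_def)
    ultimately show "AE p in ?D \<Otimes>\<^sub>M lborel. (\<lambda>j. if j < ?n then w j + w 0 * ?u p j else 0)
        \<notin> {y. y 0 \<noteq> 0 \<and> (ydprime k d y, ylast k d y) \<in> Z}" using k by simp
  qed (use k in \<open>auto simp: dimn_def\<close>)
qed

section \<open>From the extensional coordinates of the boundaries to the function space of lattice
  vectors\<close>

lemma open_restrict_vimage:
  fixes U :: "(nat \<Rightarrow> real) set"
  assumes "openin (product_topology (\<lambda>_. euclideanreal) I) U"
  shows "open {f. restrict f I \<in> U}"
proof -
  have "continuous_map euclidean (product_topology (\<lambda>_. euclideanreal) I) (\<lambda>f::nat \<Rightarrow> real. restrict f I)"
    unfolding continuous_map_componentwise by (auto intro!: continuous_on_product_coordinates)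
  from openin_continuous_map_preimage[OF this assms] show ?thesis by simp
qed

lemma open_restrict_pair_vimage:
  fixes U :: "((nat \<Rightarrow> real) \<times> real) set"
  assumes "openin (prod_topology (product_topology (\<lambda>_. euclideanreal) I) euclideanreal) U"
  shows "open {p. (restrict (fst p) I, snd p) \<in> U}"
proof -
  have 1: "continuous_on UNIV (\<lambda>p::(nat \<Rightarrow> real) \<times> real. fst p i)" for i
    using continuous_on_product_coordinates by (intro continuous_on_compose2[OF _ continuous_on_fst[OF continuous_on_id], where t = UNIV]) auto
  have "continuous_map euclidean (prod_topology (product_topology (\<lambda>_. euclideanreal) I) euclideanreal)
      (\<lambda>p::(nat \<Rightarrow> real) \<times> real. (restrict (fst p) I, snd p))"
    unfolding continuous_map_pairwise continuous_map_componentwise comp_def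
    by (auto intro!: 1 continuous_intros)
  from openin_continuous_map_preimage[OF this assms] show ?thesis by simp
qed

text \<open>Extension by zero is measurable into the function space by coordinates, and there
  \<open>U\<close> comes from an open set. This places topological frontiers in the product
  sigma-algebra.\<close>

lemma openin_product_topology_sets_PiM:
  fixes I :: "nat set"
  assumes U: "openin (product_topology (\<lambda>_. euclideanreal) I) U"
  shows "U \<in> sets (PiM I (\<lambda>_. lborel :: real measure))"
proof -
  let ?e = "\<lambda>f i. if i \<in> I then f i else (0::real)"
  have "?e \<in> borel_measurable (PiM I (\<lambda>_. lborel))"
  proof (rule measurable_coordinatewise_then_product)
    fix i show "(\<lambda>f. ?e f i) \<in> borel_measurable (PiM I (\<lambda>_. lborel))" by (cases "i \<in> I") (auto intro: PiM_lborel_component)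
  qed
  then have "?e -` {f. restrict f I \<in> U} \<inter> space (PiM I (\<lambda>_. lborel)) \<in> sets (PiM I (\<lambda>_. lborel))"
    by (rule measurable_sets) (intro borel_open open_restrict_vimage U)
  moreover have "restrict (?e f) I = f" if "f \<in> PiE I (\<lambda>_. UNIV)" for f
    using that by (auto simp: fun_eq_iff PiE_def extensional_def)
  then have "?e -` {f. restrict f I \<in> U} \<inter> space (PiM I (\<lambda>_. lborel)) = U"
    using openin_subset[OF U] by (auto simp: space_PiM topspace_product_topology)
  ultimately show ?thesis by simp
qed

lemma openin_prod_topology_sets_PiM:
  fixes I :: "nat set"
  assumes U: "openin (prod_topology (product_topology (\<lambda>_. euclideanreal) I) euclideanreal) U"
  shows "U \<in> sets (PiM I (\<lambda>_. lborel :: real measure) \<Otimes>\<^sub>M lborel)"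
proof -
  let ?P = "PiM I (\<lambda>_. lborel :: real measure) \<Otimes>\<^sub>M (lborel :: real measure)"
  let ?e = "\<lambda>p. (\<lambda>i. if i \<in> I then fst p i else (0::real), snd p)"
  have "(\<lambda>p i. if i \<in> I then fst p i else (0::real)) \<in> borel_measurable ?P"
  proof (rule measurable_coordinatewise_then_product)
    fix i show "(\<lambda>p. if i \<in> I then fst p i else (0::real)) \<in> borel_measurable ?P"
    proof (cases "i \<in> I")
      case True
      then have "(\<lambda>f. f i) \<in> borel_measurable (PiM I (\<lambda>_. lborel :: real measure))" by (rule PiM_lborel_component)
      from measurable_compose[OF measurable_fst this] True show ?thesis by simp
    qed simp
  qed
  then have "?e \<in> ?P \<rightarrow>\<^sub>M borel \<Otimes>\<^sub>M borel" by (intro measurable_Pair) auto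
  then have "?e \<in> borel_measurable ?P" by (simp add: borel_prod)
  then have "?e -` {p. (restrict (fst p) I, snd p) \<in> U} \<inter> space ?P \<in> sets ?P"
    by (rule measurable_sets) (intro borel_open open_restrict_pair_vimage U)
  moreover have "restrict (\<lambda>i. if i \<in> I then f i else 0) I = f" if "f \<in> PiE I (\<lambda>_. UNIV)" for f :: "nat \<Rightarrow> real"
    using that by (auto simp: fun_eq_iff PiE_def extensional_def)
  then have "?e -` {p. (restrict (fst p) I, snd p) \<in> U} \<inter> space ?P = U"
    using openin_subset[OF U] by (auto simp: space_PiM space_pair_measure topspace_product_topology)
  ultimately show ?thesis by simp
qed

lemma frontier_of_complement:
  "topspace X - X frontier_of S = X interior_of S \<union> X interior_of (topspace X - S)"
  unfolding frontier_of_def interior_of_complement using interior_of_subset_topspace[of X S] by blast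

section \<open>Cones and the counting function\<close>

text \<open>A cylinder over the cone: the cone itself lies in \<open>vec_n\<close>, so every point of it is a frontier point
  in \<open>nat \<Rightarrow> real\<close>.\<close>
definition cone_cyl :: "nat \<Rightarrow> nat \<Rightarrow> (nat \<Rightarrow> real) set \<Rightarrow> ((nat \<Rightarrow> real) \<times> real) set \<Rightarrow> (nat \<Rightarrow> real) set" where
  "cone_cyl k d A W = {y. (\<lambda>i\<in>{..<k}. y i / ylast k d y) \<in> A \<and> (ydprime k d y, ylast k d y) \<in> W}"

text \<open>On \<open>W\<close> the last coordinate is positive, so the cone condition can be
  divided by it; extensionality of the points of \<open>A\<close> makes the slope equal to
  \<open>a\<close>.\<close>

lemma cone_eq_cone_cyl:
  assumes A: "A \<subseteq> PiE {..<k} (\<lambda>_. UNIV)" and W: "W \<subseteq> PiE {..<d} (\<lambda>_. UNIV) \<times> {0<..}"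
  shows "cone k d A W = vec_n (dimn k d) \<inter> cone_cyl k d A W"
proof (rule Set.set_eqI)
  fix y
  let ?s = "\<lambda>i\<in>{..<k}. y i / ylast k d y"
  have "(\<exists>a\<in>A. \<forall>i<k. y i = ylast k d y * a i) \<longleftrightarrow> ?s \<in> A" if "(ydprime k d y, ylast k d y) \<in> W"
  proof -
    have pos: "ylast k d y > 0" using that W by auto
    have "?s = a" if "a \<in> A" "\<forall>i<k. y i = ylast k d y * a i" for a
    proof
      fix i
      have "a \<in> extensional {..<k}" using that A by (auto simp: PiE_def)
      then show "?s i = a i" using that pos by (cases "i < k") (auto simp: extensional_def)
    qed
    moreover have "\<forall>i<k. y i = ylast k d y * ?s i" using pos by simp
    ultimately show ?thesis by metis
  qed
  then show "y \<in> cone k d A W \<longleftrightarrow> y \<in> vec_n (dimn k d) \<inter> cone_cyl k d A W"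
    unfolding cone_def cone_cyl_def by blast
qed

lemma open_slope_vimage:
  fixes l :: nat
  assumes "openin (product_topology (\<lambda>_. euclideanreal) {..<k}) U"
  shows "open {y. y l \<noteq> 0 \<and> (\<lambda>i\<in>{..<k}. y i / y l) \<in> U}"
proof -
  let ?S = "{y::nat \<Rightarrow> real. y l \<noteq> 0}"
  have "open ?S" by (intro open_Collect_neq continuous_on_product_coordinates continuous_on_const)
  moreover have "continuous_on ?S (\<lambda>y i. y i / y l)"
    by (intro continuous_on_coordinatewise_then_product continuous_on_divide
        continuous_on_subset[OF continuous_on_product_coordinates]) auto
  ultimately have "open (?S \<inter> (\<lambda>y i. y i / y l) -` {f. restrict f {..<k} \<in> U})"
    using open_restrict_vimage[OF assms] by (intro continuous_open_preimage)
  then show ?thesis by (simp add: vimage_def Collect_conj_eq)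
qed

lemma open_section_vimage:
  assumes "openin (prod_topology (product_topology (\<lambda>_. euclideanreal) {..<d}) euclideanreal) U"
  shows "open {y. (ydprime k d y, ylast k d y) \<in> U}"
proof -
  have "continuous_on UNIV (\<lambda>y::nat \<Rightarrow> real. (\<lambda>i. y (k + i), y (k + d)))"
    by (intro continuous_on_Pair continuous_on_coordinatewise_then_product continuous_on_product_coordinates)
  from open_vimage[OF open_restrict_pair_vimage[OF assms] this]
  show ?thesis by (simp add: vimage_def ydprime_def ylast_def)
qed

text \<open>Slope and section are continuous where the last coordinate is nonzero. Away from both
  frontiers each of them has a neighbourhood on which membership is decided, and these pull back to
  the cylinder.\<close>

lemma not_in_frontier_cone_cyl:
  fixes A W k d
  defines "TA \<equiv> product_topology (\<lambda>_. euclideanreal) {..<k}"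
    and "TW \<equiv> prod_topology (product_topology (\<lambda>_. euclideanreal) {..<d}) euclideanreal"
  assumes y: "y (k + d) \<noteq> 0" "(\<lambda>i\<in>{..<k}. y i / y (k + d)) \<notin> TA frontier_of A"
    "(ydprime k d y, ylast k d y) \<notin> TW frontier_of W"
  shows "y \<notin> frontier (cone_cyl k d A W)"
proof -
  let ?C = "cone_cyl k d A W" and ?s = "\<lambda>y::nat \<Rightarrow> real. \<lambda>i\<in>{..<k}. y i / y (k + d)" and ?q = "\<lambda>y. (ydprime k d y, ylast k d y)"
  have C: "y \<in> ?C \<longleftrightarrow> ?s y \<in> A \<and> ?q y \<in> W" for y by (simp add: cone_cyl_def ylast_def)
  have "?s y \<in> topspace TA" "?q y \<in> topspace TW"
    by (auto simp: TA_def TW_def topspace_product_topology ydprime_def)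
  then have s: "?s y \<in> TA interior_of A \<or> ?s y \<in> TA interior_of (topspace TA - A)"
    and q: "?q y \<in> TW interior_of W \<or> ?q y \<in> TW interior_of (topspace TW - W)"
    using y frontier_of_complement[of TA A] frontier_of_complement[of TW W] by blast+
  note opA = open_slope_vimage[of k _ "k + d", folded TA_def, OF openin_interior_of]
    and opW = open_section_vimage[of d _ k, folded TW_def, OF openin_interior_of]
  consider (in_both) "?s y \<in> TA interior_of A" "?q y \<in> TW interior_of W"
    | (notA) "?s y \<in> TA interior_of (topspace TA - A)" | (notW) "?q y \<in> TW interior_of (topspace TW - W)"
    using s q by blast
  then show ?thesis
  proof cases
    case in_both
    let ?O = "{y. y (k + d) \<noteq> 0 \<and> ?s y \<in> TA interior_of A} \<inter> {y. ?q y \<in> TW interior_of W}"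
    have "?O \<subseteq> ?C" using interior_of_subset[of TA A] interior_of_subset[of TW W] C by blast
    moreover have "y \<in> ?O" using in_both y(1) by simp
    ultimately have "y \<in> interior ?C" using opA opW by (intro interiorI[of ?O]) auto
    then show ?thesis by (simp add: frontier_def)
  next
    case notA
    let ?O = "{y. y (k + d) \<noteq> 0 \<and> ?s y \<in> TA interior_of (topspace TA - A)}"
    have "?O \<subseteq> - ?C" using interior_of_subset[of TA "topspace TA - A"] C by blast
    moreover have "y \<in> ?O" using notA y(1) by simp
    ultimately have "y \<in> interior (- ?C)" using opA by (intro interiorI[of ?O]) auto
    then show ?thesis by (simp add: frontier_def interior_complement)
  next
    case notW
    let ?O = "{y. ?q y \<in> TW interior_of (topspace TW - W)}"
    have "?O \<subseteq> - ?C" using interior_of_subset[of TW "topspace TW - W"] C by blast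
    moreover have "y \<in> ?O" using notW by simp
    ultimately have "y \<in> interior (- ?C)" using opW by (intro interiorI[of ?O]) auto
    then show ?thesis by (simp add: frontier_def interior_complement)
  qed
qed

lemma frontier_of_sets_PiM:
  fixes I :: "nat set"
  shows "product_topology (\<lambda>_. euclideanreal) I frontier_of S \<in> sets (PiM I (\<lambda>_. lborel :: real measure))"
proof -
  let ?T = "product_topology (\<lambda>_. euclideanreal) I"
  have "topspace ?T - ?T frontier_of S \<in> sets (PiM I (\<lambda>_. lborel :: real measure))"
    unfolding frontier_of_complement by (intro sets.Un openin_product_topology_sets_PiM openin_interior_of)
  from sets.compl_sets[OF this]
  show ?thesis using frontier_of_subset_topspace[of ?T S] by (simp add: space_PiM topspace_product_topology double_diff)
qed

lemma frontier_of_sets_pair_PiM: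
  fixes I :: "nat set"
  shows "prod_topology (product_topology (\<lambda>_. euclideanreal) I) euclideanreal frontier_of S
    \<in> sets (PiM I (\<lambda>_. lborel :: real measure) \<Otimes>\<^sub>M lborel)"
proof -
  let ?T = "prod_topology (product_topology (\<lambda>_. euclideanreal) I) euclideanreal"
  have "topspace ?T - ?T frontier_of S \<in> sets (PiM I (\<lambda>_. lborel :: real measure) \<Otimes>\<^sub>M (lborel :: real measure))"
    unfolding frontier_of_complement by (intro sets.Un openin_prod_topology_sets_PiM openin_interior_of)
  from sets.compl_sets[OF this]
  show ?thesis using frontier_of_subset_topspace[of ?T S]
    by (simp add: space_PiM space_pair_measure topspace_product_topology double_diff)
qed

lemma AE_primlat_frontier_cone_cyl:
  assumes m: "invariant_prob (dimn k d) m" and k: "k \<ge> 1"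
    and A: "emeasure (PiM {..<k} (\<lambda>_. lborel)) (product_topology (\<lambda>_. euclideanreal) {..<k} frontier_of A) = 0"
    and W: "emeasure (PiM {..<d} (\<lambda>_. lborel) \<Otimes>\<^sub>M lborel)
      (prod_topology (product_topology (\<lambda>_. euclideanreal) {..<d}) euclideanreal frontier_of W) = 0"
  shows "AE x in m. primlat (dimn k d) x \<inter> frontier (cone_cyl k d A W) = {}"
proof -
  let ?n = "dimn k d"
  have n: "?n \<ge> 2" "k + d < ?n" "0 < ?n" using k by (auto simp: dimn_def)
  have "AE x in m. \<forall>v\<in>primlat ?n x. \<forall>j<?n. v j \<noteq> 0"
    by (rule AE_primlat_coordinates_nonzero[OF m n(1)])
  moreover have "AE x in m. primlat ?n x \<inter> {y. y (k + d) \<noteq> 0 \<and>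
      (\<lambda>i\<in>{..<k}. y i / y (k + d)) \<in> product_topology (\<lambda>_. euclideanreal) {..<k} frontier_of A} = {}"
    using A n by (intro AE_primlat_slope_avoids[OF m]) (auto simp: null_sets_def frontier_of_sets_PiM)
  moreover have "AE x in m. primlat ?n x \<inter> {y. y 0 \<noteq> 0 \<and> (ydprime k d y, ylast k d y) \<in>
      prod_topology (product_topology (\<lambda>_. euclideanreal) {..<d}) euclideanreal frontier_of W} = {}"
    by (intro AE_primlat_section_avoids[OF m k] null_setsI W frontier_of_sets_pair_PiM)
  ultimately show ?thesis
  proof eventually_elim
    case (elim x)
    have "v \<notin> frontier (cone_cyl k d A W)" if v: "v \<in> primlat ?n x" for v
    proof (rule not_in_frontier_cone_cyl)
      have nz: "v (k + d) \<noteq> 0" "v 0 \<noteq> 0" using elim(1) v n by auto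
      then show "v (k + d) \<noteq> 0" by simp
      show "(\<lambda>i\<in>{..<k}. v i / v (k + d)) \<notin> product_topology (\<lambda>_. euclideanreal) {..<k} frontier_of A"
        using elim(2) v nz by blast
      show "(ydprime k d v, ylast k d v) \<notin> prod_topology (product_topology (\<lambda>_. euclideanreal) {..<d}) euclideanreal frontier_of W"
        using elim(3) v nz by blast
    qed
    then show ?case by blast
  qed
qed

section \<open>Local constancy and measurability of the counts\<close>

lemma finite_bounded_integer_vectors:
  "finite {w \<in> vec_n n. (\<forall>i. w i \<in> \<int>) \<and> (\<Sum>i<n. \<bar>w i\<bar>) \<le> R}"
proof -
  let ?B = "(of_int :: int \<Rightarrow> real) ` {-\<lceil>R\<rceil>..\<lceil>R\<rceil>}"
  have "finite (PiE {..<n} (\<lambda>_. ?B))" by (intro finite_PiE) auto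
  then have "finite ((\<lambda>v i. if i < n then v i else 0) ` PiE {..<n} (\<lambda>_. ?B))" by (rule finite_imageI)
  moreover have "{w \<in> vec_n n. (\<forall>i. w i \<in> \<int>) \<and> (\<Sum>i<n. \<bar>w i\<bar>) \<le> R}
      \<subseteq> (\<lambda>v i. if i < n then v i else 0) ` PiE {..<n} (\<lambda>_. ?B)"
  proof
    fix w assume "w \<in> {w \<in> vec_n n. (\<forall>i. w i \<in> \<int>) \<and> (\<Sum>i<n. \<bar>w i\<bar>) \<le> R}"
    then have w: "w \<in> vec_n n" "\<And>i. w i \<in> \<int>" "(\<Sum>i<n. \<bar>w i\<bar>) \<le> R" by auto
    have "w i \<in> ?B" if "i < n" for i
    proof -
      obtain z :: int where z: "w i = of_int z" using w(2)[of i] by (auto elim: Ints_cases)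
      have "\<bar>w i\<bar> \<le> (\<Sum>i<n. \<bar>w i\<bar>)" using that by (intro member_le_sum[of i _ "\<lambda>i. \<bar>w i\<bar>"]) auto
      then have "\<bar>real_of_int z\<bar> \<le> R" using w(3) z by simp
      then have "z \<in> {-\<lceil>R\<rceil>..\<lceil>R\<rceil>}" by (auto; linarith)
      then show ?thesis using z by auto
    qed
    then have "restrict w {..<n} \<in> PiE {..<n} (\<lambda>_. ?B)" by auto
    moreover have "w = (\<lambda>i. if i < n then restrict w {..<n} i else 0)" using w(1) by (auto simp: vec_n_def)
    ultimately show "w \<in> (\<lambda>v i. if i < n then v i else 0) ` PiE {..<n} (\<lambda>_. ?B)" by blast
  qed
  ultimately show ?thesis by (rule finite_subset[rotated])
qed

lemma primlat_coset_Int: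
  assumes "g \<in> SLR n"
  shows "primlat n (coset n g) \<inter> C = (\<lambda>w. vmul n w g) ` {w. primitive n w \<and> vmul n w g \<in> C}"
    "inj_on (\<lambda>w. vmul n w g) {w. primitive n w \<and> vmul n w g \<in> C}"
proof -
  show "primlat n (coset n g) \<inter> C = (\<lambda>w. vmul n w g) ` {w. primitive n w \<and> vmul n w g \<in> C}"
    using assms by (auto simp: primlat_coset)
  show "inj_on (\<lambda>w. vmul n w g) {w. primitive n w \<and> vmul n w g \<in> C}"
    by (rule inj_on_subset[OF inj_on_vmul[OF assms]]) (auto simp: primitive_vec_n)
qed

text \<open>The counting is done on integer vectors \<open>w\<close>, which label the lattice
  vectors of all nearby \<open>h\<close> at once. The local bound leaves a finite set
  \<open>J\<close> of labels that can ever enter \<open>C\<close>, and for each of them membership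
  is stable near \<open>g\<close> because \<open>w g\<close> avoids the frontier.\<close>

lemma primlat_count_locally_constant:
  assumes x: "x \<in> Xsp n" and bdd: "\<And>y j. y \<in> C \<Longrightarrow> j < n \<Longrightarrow> \<bar>y j\<bar> \<le> K"
    and fr: "primlat n x \<inter> frontier C = {}"
  shows "\<exists>V. openin (Xtop n) V \<and> x \<in> V \<and>
    (\<forall>x'\<in>V. finite (primlat n x' \<inter> C) \<and> card (primlat n x' \<inter> C) = card (primlat n x \<inter> C))"
proof -
  obtain g where g: "g \<in> SLR n" "x = coset n g" using x by (auto simp: Xsp_def)
  obtain U B where U: "open U" "g \<in> U" "B > 0"
    "\<And>h w. h \<in> U \<Longrightarrow> w \<in> vec_n n \<Longrightarrow> (\<Sum>i<n. \<bar>w i\<bar>) \<le> B * (\<Sum>i<n. \<bar>vmul n w h i\<bar>)"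
    using SLR_local_bound[OF g(1)] by metis
  define J where "J = {w. primitive n w \<and> (\<Sum>i<n. \<bar>w i\<bar>) \<le> B * (real n * K)}"
  have finJ: "finite J"
    by (rule finite_subset[OF _ finite_bounded_integer_vectors[of n "B * (real n * K)"]]) (auto simp: J_def primitive_def)
  have inJ: "w \<in> J" if "primitive n w" "vmul n w h \<in> C" "h \<in> U" for w h
  proof -
    have "(\<Sum>i<n. \<bar>vmul n w h i\<bar>) \<le> real n * K"
      using sum_bounded_above[of "{..<n}" "\<lambda>i. \<bar>vmul n w h i\<bar>" K] bdd[OF that(2)] by simp
    then have "B * (\<Sum>i<n. \<bar>vmul n w h i\<bar>) \<le> B * (real n * K)" using U(3) by simp
    then show ?thesis using U(4)[OF that(3) primitive_vec_n[OF that(1)]] that(1) by (simp add: J_def)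
  qed
  have cont: "continuous_on UNIV (\<lambda>h. vmul n w h)" for w
  proof (rule continuous_on_coordinatewise_then_product)
    fix j
    show "continuous_on UNIV (\<lambda>h. vmul n w h j)"
      unfolding vmul_def by (cases "j < n") (auto intro!: continuous_on_sum continuous_on_mult continuous_on_rmat_entry)
  qed
  have "\<exists>V. open V \<and> g \<in> V \<and> (\<forall>h\<in>V. vmul n w h \<in> C \<longleftrightarrow> vmul n w g \<in> C)" if "w \<in> J" for w
  proof -
    have "vmul n w g \<in> primlat n x" using that g by (auto simp: J_def primlat_coset)
    then have "vmul n w g \<notin> frontier C" using fr by blast
    then consider "vmul n w g \<in> interior C" | "vmul n w g \<in> interior (- C)"
      by (auto simp: frontier_def interior_complement)
    then show ?thesis
    proof cases
      case 1
      have "open ((\<lambda>h. vmul n w h) -` interior C)" by (rule open_vimage[OF open_interior cont])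
      then show ?thesis using 1 interior_subset[of C] by (intro exI[of _ "(\<lambda>h. vmul n w h) -` interior C"]) auto
    next
      case 2
      have "open ((\<lambda>h. vmul n w h) -` interior (- C))" by (rule open_vimage[OF open_interior cont])
      then show ?thesis using 2 interior_subset[of "- C"] by (intro exI[of _ "(\<lambda>h. vmul n w h) -` interior (- C)"]) blast
    qed
  qed
  then obtain V where V: "\<And>w. w \<in> J \<Longrightarrow> open (V w)" "\<And>w. w \<in> J \<Longrightarrow> g \<in> V w"
    "\<And>w h. w \<in> J \<Longrightarrow> h \<in> V w \<Longrightarrow> vmul n w h \<in> C \<longleftrightarrow> vmul n w g \<in> C" by metis
  define T where "T = U \<inter> (\<Inter>w\<in>J. V w)"
  have T: "open T" "g \<in> T" using U V finJ by (auto simp: T_def intro!: open_Int open_INT)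
  have same: "{w. primitive n w \<and> vmul n w h \<in> C} = {w \<in> J. vmul n w g \<in> C}" if "h \<in> T" for h
    using inJ[of _ h] that V(3)[of _ h] by (auto simp: T_def) (auto simp: J_def)
  have cnt: "finite (primlat n (coset n h) \<inter> C) \<and> card (primlat n (coset n h) \<inter> C) = card {w \<in> J. vmul n w g \<in> C}"
    if "h \<in> T" "h \<in> SLR n" for h
    using primlat_coset_Int[OF that(2), of C] finJ unfolding same[OF that(1)] by (simp add: card_image)
  show ?thesis
  proof (intro exI[of _ "coset n ` (T \<inter> SLR n)"] conjI ballI)
    show "openin (Xtop n) (coset n ` (T \<inter> SLR n))" by (rule openin_coset_image[OF T(1)])
    show "x \<in> coset n ` (T \<inter> SLR n)" using g T by blast
    fix x' assume "x' \<in> coset n ` (T \<inter> SLR n)"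
    then obtain h where h: "h \<in> T" "h \<in> SLR n" "x' = coset n h" by blast
    show "finite (primlat n x' \<inter> C)" using cnt[OF h(1,2)] h(3) by simp
    show "card (primlat n x' \<inter> C) = card (primlat n x \<inter> C)"
      using cnt[OF h(1,2)] cnt[OF T(2) g(1)] h(3) g(2) by simp
  qed
qed

text \<open>The count is a sum of indicators over the countable set of primitive vectors with values
  up to infinity, so finiteness and cardinality together are the one equation that this sum equals
  \<open>N\<close>.\<close>

lemma primlat_count_Xborel:
  assumes [measurable]: "C \<in> sets borel"
  shows "{x \<in> Xsp n. finite (primlat n x \<inter> C) \<and> card (primlat n x \<inter> C) = N} \<in> sets (Xborel n)"
proof (rule Xborel_CollectI)
  let ?P = "{w. primitive n w}"
  let ?I = "\<lambda>g. \<integral>\<^sup>+w. indicator C (vmul n w g) \<partial>count_space ?P"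
  fix g assume g: "g \<in> SLR n"
  let ?J = "{w. primitive n w \<and> vmul n w g \<in> C}"
  have "?I g = (\<integral>\<^sup>+w. indicator ?J w \<partial>count_space ?P)" by (rule nn_integral_cong) (simp add: indicator_def)
  also have "\<dots> = emeasure (count_space ?P) ?J" by (rule nn_integral_indicator) auto
  finally have I: "?I g = emeasure (count_space ?P) ?J" .
  have "?I g = ennreal (real N) \<longleftrightarrow> finite ?J \<and> card ?J = N"
  proof (cases "finite ?J")
    case True
    then have "emeasure (count_space ?P) ?J = ennreal (real (card ?J))"
      by (subst emeasure_count_space_finite) (auto simp: ennreal_of_nat_eq_real_of_nat)
    then show ?thesis using True I by simp
  next
    case False
    then have "emeasure (count_space ?P) ?J = \<infinity>" by (subst emeasure_count_space_infinite) auto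
    then show ?thesis using False I by simp
  qed
  then show "(finite (primlat n (coset n g) \<inter> C) \<and> card (primlat n (coset n g) \<inter> C) = N) \<longleftrightarrow> ?I g = ennreal (real N)"
    using primlat_coset_Int[OF g, of C] by (simp add: card_image finite_image_iff)
next
  have [measurable]: "(\<lambda>g. \<integral>\<^sup>+w. indicator C (vmul n w g) \<partial>count_space {w. primitive n w}) \<in> borel_measurable borel"
    by (rule borel_measurable_nn_integral_count_space[OF countable_primitive]) measurable
  have "{g \<in> space borel. g \<in> SLR n \<and> (\<integral>\<^sup>+w. indicator C (vmul n w g) \<partial>count_space {w. primitive n w}) = ennreal (real N)} \<in> sets borel"
    by measurable
  then show "{g \<in> SLR n. (\<integral>\<^sup>+w. indicator C (vmul n w g) \<partial>count_space {w. primitive n w}) = ennreal (real N)} \<in> sets borel"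
    by simp
qed

lemma cone_cyl_borel:
  assumes [measurable]: "A \<in> sets (PiM {..<k} (\<lambda>_. lborel))" "W \<in> sets (PiM {..<d} (\<lambda>_. lborel) \<Otimes>\<^sub>M lborel)"
  shows "cone_cyl k d A W \<in> sets borel"
proof -
  have [measurable]: "(\<lambda>y. ydprime k d y) \<in> borel \<rightarrow>\<^sub>M PiM {..<d} (\<lambda>_. lborel)"
    unfolding ydprime_def by (rule measurable_restrict) measurable
  have [measurable]: "(\<lambda>y. ylast k d y) \<in> borel \<rightarrow>\<^sub>M borel"
    unfolding ylast_def by measurable
  have [measurable]: "(\<lambda>y. \<lambda>i\<in>{..<k}. y i / ylast k d y) \<in> borel \<rightarrow>\<^sub>M PiM {..<k} (\<lambda>_. lborel)"
    by (rule measurable_restrict) measurable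
  have "{y \<in> space borel. (\<lambda>i\<in>{..<k}. y i / ylast k d y) \<in> A \<and> (ydprime k d y, ylast k d y) \<in> W} \<in> sets borel" by measurable
  then show ?thesis by (simp add: cone_cyl_def)
qed

text \<open>The first \<open>k\<close> coordinates are slope times last coordinate, bounded by
  \<open>C * D\<close>; the others are bounded by \<open>W\<close> directly. Coordinates from
  \<open>dimn k d\<close> on are free in the cylinder.\<close>

lemma cone_cyl_bounded:
  assumes W: "\<exists>C. \<forall>(a, b) \<in> W. \<bar>b\<bar> \<le> C \<and> (\<forall>i<d. \<bar>a i\<bar> \<le> C)" "W \<subseteq> PiE {..<d} (\<lambda>_. UNIV) \<times> {0<..}"
    and A: "\<exists>C. \<forall>s\<in>A. \<forall>j<k. \<bar>s j\<bar> \<le> C"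
  shows "\<exists>K. \<forall>y\<in>cone_cyl k d A W. \<forall>j<dimn k d. \<bar>y j\<bar> \<le> K"
proof -
  obtain C where C: "\<And>a b. (a, b) \<in> W \<Longrightarrow> \<bar>b\<bar> \<le> C \<and> (\<forall>i<d. \<bar>a i\<bar> \<le> C)" using W(1) by fast
  obtain D where D: "\<And>s j. s \<in> A \<Longrightarrow> j < k \<Longrightarrow> \<bar>s j\<bar> \<le> D" using A by blast
  have "\<bar>y j\<bar> \<le> max C (C * D)" if y: "y \<in> cone_cyl k d A W" and j: "j < dimn k d" for y j
  proof -
    let ?l = "ylast k d y"
    have yW: "(ydprime k d y, ?l) \<in> W" and yA: "(\<lambda>i\<in>{..<k}. y i / ?l) \<in> A" using y by (auto simp: cone_cyl_def)
    have l: "?l > 0" using yW W(2) by auto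
    note CC = C[OF yW]
    consider "j < k" | i where "j = k + i" "i < d" | "j = k + d"
      using j by (metis dimn_def Suc_eq_plus1 add_diff_inverse_nat less_Suc_eq nat_add_left_cancel_less)
    then show ?thesis
    proof cases
      case 1
      then have "\<bar>y j / ?l\<bar> \<le> D" using D[OF yA, of j] by simp
      then have "\<bar>y j\<bar> \<le> ?l * D" using l by (simp add: abs_divide field_simps)
      also have "\<dots> \<le> C * D"
        using CC l order_trans[OF abs_ge_zero \<open>\<bar>y j / ?l\<bar> \<le> D\<close>] by (intro mult_right_mono) auto
      finally show ?thesis by simp
    next
      case 2
      then have "\<bar>y j\<bar> \<le> C" using CC by (auto simp: ydprime_def)
      then show ?thesis by simp
    next
      case 3
      then have "\<bar>y j\<bar> \<le> C" using CC by (simp add: ylast_def)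
      then show ?thesis by simp
    qed
  qed
  then show ?thesis by blast
qed

section \<open>The flow and the rescaled hitting times\<close>

lemma vmul_Phi:
  "vmul (dimn k d) v (Phi k d t) =
    (\<lambda>j. if j < dimn k d then v j * (if j < k then exp (real (d + 1) * t) else exp (- real k * t)) else 0)"
proof
  fix j
  show "vmul (dimn k d) v (Phi k d t) j =
    (if j < dimn k d then v j * (if j < k then exp (real (d + 1) * t) else exp (- real k * t)) else 0)"
  proof (cases "j < dimn k d")
    case True
    have "(\<Sum>i<dimn k d. v i * Phi k d t i j) =
        (\<Sum>i<dimn k d. if i = j then v j * (if j < k then exp (real (d + 1) * t) else exp (- real k * t)) else 0)"
      using True by (intro sum.cong) (auto simp: Phi_def)
    then show ?thesis using True by (simp add: vmul_def)
  qed (simp add: vmul_def)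
qed

lemma Phi_SLR: "Phi k d t \<in> SLR (dimn k d)"
proof -
  let ?n = "dimn k d" and ?f = "\<lambda>i. if i < k then exp (real (d + 1) * t) else exp (- real k * t)"
  have "upper_triangular (tomat ?n (Phi k d t))" by (auto simp: upper_triangular_def Phi_def)
  then have "det_n ?n (Phi k d t) = prod_list (diag_mat (tomat ?n (Phi k d t)))"
    unfolding det_tomat[symmetric] by (rule det_upper_triangular[of _ ?n]) simp
  also have "\<dots> = (\<Prod>i<?n. ?f i)"
    by (simp add: prod_list_diag_prod atLeast0LessThan Phi_def)
  also have "\<dots> = (\<Prod>i<k. ?f i) * (\<Prod>i=k..<?n. ?f i)"
    unfolding lessThan_atLeast0 by (rule prod.atLeastLessThan_concat[symmetric]) (auto simp: dimn_def)
  also have "\<dots> = exp (real (d + 1) * t) ^ k * exp (- real k * t) ^ (d + 1)" by (simp add: dimn_def)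
  also have "\<dots> = exp (real k * (real (d + 1) * t)) * exp (real (d + 1) * (- real k * t))"
    unfolding exp_of_nat_mult ..
  also have "\<dots> = 1" unfolding exp_add[symmetric] by (simp add: algebra_simps)
  finally show ?thesis by (auto simp: SLR_def mat_n_def Phi_def)
qed

text \<open>With \<open>t = ln L / k\<close> the flow multiplies the section coordinates by
  \<open>1 / L\<close>, which cancels the factor \<open>L\<close> in \<open>hit_set\<close>. Slopes
  are multiplied by \<open>exp (dimn k d * t)\<close>, and this is exactly what the power of
  \<open>L\<close> removes.\<close>

lemma hit_set_phi_flow:
  assumes k: "k \<ge> 1" and L: "L > 0" and x: "x \<in> Xsp (dimn k d)"
  shows "hit_set k d W (phi_flow k d (ln L / real k) x) L A =
    (\<lambda>v. vmul (dimn k d) v (Phi k d (ln L / real k))) ` (primlat (dimn k d) x \<inter> cone_cyl k d A W)"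
proof -
  let ?n = "dimn k d" and ?t = "ln L / real k"
  let ?v = "\<lambda>y. vmul ?n y (Phi k d ?t)"
  have e1: "L * exp (- real k * ?t) = 1" using k L by (simp add: exp_minus)
  have p: "L powr (- real ?n / real k) = exp (- real ?n * ?t)" using L by (simp add: powr_def)
  have q: "exp (- real ?n * t) * exp (real (d + 1) * t) = exp (- real k * t)" for t :: real
    unfolding exp_add[symmetric] by (simp add: dimn_def algebra_simps)
  have e2: "L powr (- real ?n / real k) * exp (real (d + 1) * ?t) = exp (- real k * ?t)" unfolding p by (rule q)
  have last: "ylast k d (?v y) = ylast k d y * exp (- real k * ?t)" for y
    unfolding ylast_def vmul_Phi by (simp add: dimn_def)
  have "(\<lambda>i\<in>{..<d}. L * ydprime k d (?v y) i) = ydprime k d y" for y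
    using e1 unfolding ydprime_def vmul_Phi by (auto simp: fun_eq_iff dimn_def mult.left_commute)
  moreover have "L * ylast k d (?v y) = ylast k d y" for y
    using e1 unfolding last by (simp add: mult.left_commute)
  moreover have "(\<lambda>i\<in>{..<k}. L powr (- real ?n / real k) * (?v y i / ylast k d (?v y))) = (\<lambda>i\<in>{..<k}. y i / ylast k d y)" for y
  proof (rule restrict_ext)
    fix i assume "i \<in> {..<k}"
    then have "?v y i = y i * exp (real (d + 1) * ?t)" unfolding vmul_Phi by (simp add: dimn_def)
    then have "L powr (- real ?n / real k) * (?v y i / ylast k d (?v y)) =
        y i * (L powr (- real ?n / real k) * exp (real (d + 1) * ?t)) / (ylast k d y * exp (- real k * ?t))"
      unfolding last by simp
    then show "L powr (- real ?n / real k) * (?v y i / ylast k d (?v y)) = y i / ylast k d y"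
      unfolding e2 by simp
  qed
  ultimately show ?thesis
    unfolding hit_set_def phi_flow_def primlat_Xact[OF x Phi_SLR] cone_cyl_def by auto
qed

theorem theorem2:
  fixes k m r :: nat
    and lam :: "(nat \<Rightarrow> nat \<Rightarrow> real) set measure"
    and A :: "nat \<Rightarrow> (nat \<Rightarrow> real) set"
    and W :: "((nat \<Rightarrow> real) \<times> real) set"
    and N :: "nat \<Rightarrow> nat"
  assumes k_pos: "k \<ge> 1"
    and W_sub: "W \<subseteq> (PiE {..<m} (\<lambda>_. UNIV)) \<times> {0<..}"
    and W_bdd: "\<exists>C. \<forall>(a, b) \<in> W. \<bar>b\<bar> \<le> C \<and> (\<forall>i<m. \<bar>a i\<bar> \<le> C)"
    and W_borel: "W \<in> sets (PiM {..<m} (\<lambda>_. lborel) \<Otimes>\<^sub>M lborel)"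
    and W_int: "prod_topology (product_topology (\<lambda>_. euclideanreal) {..<m}) euclideanreal
                  interior_of W \<noteq> {}"
    and W_bdry: "emeasure (PiM {..<m} (\<lambda>_. lborel) \<Otimes>\<^sub>M lborel)
                  (prod_topology (product_topology (\<lambda>_. euclideanreal) {..<m}) euclideanreal
                    frontier_of W) = 0"
    and lam_adm: "admissible k m lam"
    and A_sub: "\<And>i. i < r \<Longrightarrow> A i \<subseteq> PiE {..<k} (\<lambda>_. UNIV)"
    and A_bdd: "\<And>i. i < r \<Longrightarrow> \<exists>C. \<forall>s \<in> A i. \<forall>j<k. \<bar>s j\<bar> \<le> C"
    and A_borel: "\<And>i. i < r \<Longrightarrow> A i \<in> sets (PiM {..<k} (\<lambda>_. lborel))"
    and A_bdry: "\<And>i. i < r \<Longrightarrow>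
        emeasure (PiM {..<k} (\<lambda>_. lborel))
          (product_topology (\<lambda>_. euclideanreal) {..<k} frontier_of (A i)) = 0"
  shows "((\<lambda>L. measure lam
            {x \<in> Xsp (dimn k m). \<forall>i<r. finite (hit_set k m W x L (A i)) \<and>
                                     card (hit_set k m W x L (A i)) = N i})
          \<longlongrightarrow> measure (Xmu (dimn k m))
            {x \<in> Xsp (dimn k m). \<forall>i<r.
                finite (primlat (dimn k m) x \<inter> cone k m (A i) W) \<and>
                card (primlat (dimn k m) x \<inter> cone k m (A i) W) = N i}) at_top"
proof -
  let ?n = "dimn k m"
  let ?C = "\<lambda>i. cone_cyl k m (A i) W"
  have inv: "invariant_prob ?n (Xmu ?n)" by (rule invariant_prob_Xmu) (simp add: dimn_def)
  have sets_mu: "sets (Xmu ?n) = sets (Xborel ?n)" using inv by (simp add: invariant_prob_def)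
  define E where "E = {x \<in> Xsp ?n. \<forall>i<r. finite (primlat ?n x \<inter> ?C i) \<and> card (primlat ?n x \<inter> ?C i) = N i}"
  have cone: "primlat ?n x \<inter> cone k m (A i) W = primlat ?n x \<inter> ?C i" if "i < r" for x i
    using cone_eq_cone_cyl[OF A_sub[OF that] W_sub] primlat_vec_n[of _ ?n x] by blast
  have "{x \<in> space (Xborel ?n). \<forall>i\<in>{..<r}. finite (primlat ?n x \<inter> ?C i) \<and> card (primlat ?n x \<inter> ?C i) = N i} \<in> sets (Xborel ?n)"
  proof (intro sets.sets_Collect_countable_All' countable_finite finite_lessThan)
    fix i assume "i \<in> {..<r}"
    then show "{x \<in> space (Xborel ?n). finite (primlat ?n x \<inter> ?C i) \<and> card (primlat ?n x \<inter> ?C i) = N i} \<in> sets (Xborel ?n)"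
      unfolding space_Xborel by (intro primlat_count_Xborel cone_cyl_borel A_borel W_borel) simp
  qed
  then have E: "E \<in> sets (Xborel ?n)" unfolding E_def Ball_def lessThan_iff space_Xborel .
  have front: "Xtop ?n frontier_of E \<subseteq> {x \<in> Xsp ?n. \<not> (\<forall>i<r. primlat ?n x \<inter> frontier (?C i) = {})}"
  proof
    fix x assume x: "x \<in> Xtop ?n frontier_of E"
    then have xt: "x \<in> topspace (Xtop ?n)" by (rule subsetD[OF frontier_of_subset_topspace])
    then have xX: "x \<in> Xsp ?n" using openin_Xtop[OF openin_topspace[of "Xtop ?n"]] by blast
    \<comment> \<open>If no primitive vector of \<open>x\<close> is on a frontier, all counts are
      constant on a common neighbourhood, so \<open>x\<close> is interior to \<open>E\<close> or
      outside its closure.\<close>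
    moreover have False if no: "\<forall>i<r. primlat ?n x \<inter> frontier (?C i) = {}"
    proof -
      have "\<exists>V. openin (Xtop ?n) V \<and> x \<in> V \<and>
          (\<forall>x'\<in>V. finite (primlat ?n x' \<inter> ?C i) \<and> card (primlat ?n x' \<inter> ?C i) = card (primlat ?n x \<inter> ?C i))"
        if i: "i < r" for i
      proof -
        obtain K where "\<forall>y\<in>?C i. \<forall>j<?n. \<bar>y j\<bar> \<le> K" using cone_cyl_bounded[OF W_bdd W_sub A_bdd[OF i]] by blast
        then show ?thesis using primlat_count_locally_constant[OF xX, of "?C i" K] no i by blast
      qed
      then obtain V where V: "\<And>i. i < r \<Longrightarrow> openin (Xtop ?n) (V i)" "\<And>i. i < r \<Longrightarrow> x \<in> V i"
        "\<And>i x'. i < r \<Longrightarrow> x' \<in> V i \<Longrightarrow> finite (primlat ?n x' \<inter> ?C i) \<and>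
          card (primlat ?n x' \<inter> ?C i) = card (primlat ?n x \<inter> ?C i)" by metis
      \<comment> \<open>Intersecting with the whole space also covers the empty family,
        \<open>r = 0\<close>.\<close>
      define T where "T = topspace (Xtop ?n) \<inter> (\<Inter>i<r. V i)"
      have T: "openin (Xtop ?n) T" unfolding T_def by (intro openin_Int_Inter) (use V in auto)
      have xT: "x \<in> T" using V(2) xt by (simp add: T_def)
      have TX: "T \<subseteq> Xsp ?n" using openin_Xtop[OF T] by simp
      have same: "x' \<in> E \<longleftrightarrow> x \<in> E" if "x' \<in> T" for x'
      proof -
        have "finite (primlat ?n x' \<inter> ?C i) \<and> finite (primlat ?n x \<inter> ?C i) \<and>
            card (primlat ?n x' \<inter> ?C i) = card (primlat ?n x \<inter> ?C i)" if i: "i < r" for i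
        proof -
          have "x' \<in> V i" using \<open>x' \<in> T\<close> i by (simp add: T_def)
          then show ?thesis using V(3)[OF i] V(3)[OF i V(2)[OF i]] by blast
        qed
        then show ?thesis using that xT TX by (auto simp: E_def)
      qed
      show False
      proof (cases "x \<in> E")
        case True
        then have "T \<subseteq> E" using same by blast
        then have "x \<in> Xtop ?n interior_of E" using interior_of_maximal[OF _ T] xT by blast
        then show False using x by (simp add: frontier_of_def)
      next
        case False
        then have "T \<inter> E = {}" using same by blast
        then have "x \<notin> Xtop ?n closure_of E" using T xT unfolding in_closure_of by blast
        then show False using x by (simp add: frontier_of_def)
      qed
    qed
    ultimately show "x \<in> {x \<in> Xsp ?n. \<not> (\<forall>i<r. primlat ?n x \<inter> frontier (?C i) = {})}" by blast
  qed
  have "AE x in Xmu ?n. \<forall>i\<in>{..<r}. primlat ?n x \<inter> frontier (?C i) = {}"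
    by (intro AE_ball_countable' AE_primlat_frontier_cone_cyl[OF inv k_pos] countable_finite) (auto simp: A_bdry W_bdry)
  then obtain Z where Z: "Z \<in> null_sets (Xmu ?n)"
    \<comment> \<open>The frontier is estimated through this measurable null set, which contains
      every point having a bad vector.\<close>
    "{x \<in> space (Xmu ?n). \<not> (\<forall>i\<in>{..<r}. primlat ?n x \<inter> frontier (?C i) = {})} \<subseteq> Z"
    unfolding eventually_ae_filter by blast
  then have "Xtop ?n frontier_of E \<subseteq> Z" by (intro subset_trans[OF front]) (simp only: space_eq_Xsp[OF sets_mu] Ball_def lessThan_iff)
  then have "emeasure (Xmu ?n) (Xtop ?n frontier_of E) \<le> emeasure (Xmu ?n) Z" using Z by (intro emeasure_mono) auto
  then have "measure (Xmu ?n) (Xtop ?n frontier_of E) = 0" using Z by (simp add: measure_def null_sets_def)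
  then have lim: "((\<lambda>t. measure lam (phi_flow k m t ` E)) \<longlongrightarrow> measure (Xmu ?n) E) at_top"
    using lam_adm E by (simp add: admissible_def)
  have kr: "real k > 0" using k_pos by simp
  have "filterlim (\<lambda>L. ln L / real k) at_top at_top"
    using filterlim_tendsto_pos_mult_at_top[OF tendsto_const[of "inverse (real k)"] _ ln_at_top] kr
    by (simp add: field_simps)
  from filterlim_compose[OF lim this]
  have lim': "((\<lambda>L. measure lam (phi_flow k m (ln L / real k) ` E)) \<longlongrightarrow> measure (Xmu ?n) E) at_top" .
  have hit: "phi_flow k m (ln L / real k) ` E =
      {x \<in> Xsp ?n. \<forall>i<r. finite (hit_set k m W x L (A i)) \<and> card (hit_set k m W x L (A i)) = N i}" if L: "L > 0" for L
  proof -
    let ?t = "ln L / real k"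
    let ?h = "Phi k m ?t"
    have h: "?h \<in> SLR ?n" by (rule Phi_SLR)
    have cnt: "finite (hit_set k m W (phi_flow k m ?t x) L (A i)) = finite (primlat ?n x \<inter> ?C i) \<and>
        card (hit_set k m W (phi_flow k m ?t x) L (A i)) = card (primlat ?n x \<inter> ?C i)" if "x \<in> Xsp ?n" for x i
    proof -
      have "inj_on (\<lambda>v. vmul ?n v ?h) (primlat ?n x \<inter> ?C i)"
        by (rule inj_on_subset[OF inj_on_vmul[OF h]]) (auto simp: primlat_vec_n)
      then show ?thesis unfolding hit_set_phi_flow[OF k_pos L that] by (simp add: card_image finite_image_iff)
    qed
    show ?thesis
    proof (intro subset_antisym subsetI)
      fix x assume "x \<in> phi_flow k m ?t ` E"
      then obtain x0 where x0: "x0 \<in> E" "x = phi_flow k m ?t x0" by blast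
      then have "x0 \<in> Xsp ?n" by (simp add: E_def)
      then show "x \<in> {x \<in> Xsp ?n. \<forall>i<r. finite (hit_set k m W x L (A i)) \<and> card (hit_set k m W x L (A i)) = N i}"
        using x0 cnt[of x0] Xact_Xsp[OF _ h, of x0] by (simp add: E_def phi_flow_def)
    next
      fix x assume x: "x \<in> {x \<in> Xsp ?n. \<forall>i<r. finite (hit_set k m W x L (A i)) \<and> card (hit_set k m W x L (A i)) = N i}"
      \<comment> \<open>Flowing back gives the preimage in \<open>E\<close>, since the counts of
        hits at \<open>x\<close> are the cone counts at this point.\<close>
      let ?x0 = "Xact ?n x (minv ?n ?h)"
      have x0: "?x0 \<in> Xsp ?n" using x by (auto intro: Xact_Xsp minv_SLR h)
      have e: "phi_flow k m ?t ?x0 = x" unfolding phi_flow_def using x by (intro Xact_inverse h) simp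
      have "?x0 \<in> E" using x cnt[OF x0] x0 unfolding e by (simp add: E_def)
      then show "x \<in> phi_flow k m ?t ` E" using e by (metis imageI)
    qed
  qed
  have mu: "measure (Xmu ?n) E = measure (Xmu ?n) {x \<in> Xsp ?n. \<forall>i<r. finite (primlat ?n x \<inter> cone k m (A i) W) \<and>
      card (primlat ?n x \<inter> cone k m (A i) W) = N i}"
    unfolding E_def by (simp add: cone cong: conj_cong)
  \<comment> \<open>The identification of the two events requires \<open>L > 0\<close> for the
    logarithm, which holds eventually.\<close>
  have "\<forall>\<^sub>F L in at_top. measure lam (phi_flow k m (ln L / real k) ` E) =
      measure lam {x \<in> Xsp ?n. \<forall>i<r. finite (hit_set k m W x L (A i)) \<and> card (hit_set k m W x L (A i)) = N i}"
    using eventually_gt_at_top[of 0] by eventually_elim (simp only: hit)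
  from Lim_transform_eventually[OF lim' this] show ?thesis unfolding mu .
qed

end
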